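(* Let $H$ be a Hilbert space, $\mathbf{a}=[a_1,\dots,a_\ell]$ a row and $\mathbf{b}=[b_1,\dots,b_\ell]^t$ a column of operators in $\mathcal{B}(H)$, and $Tx=\sum_{j=1}^\ell a_jxb_j$. Let $H_1$ be the closed unit ball of $H$ and $f_T\colon H_1\times H_1\to\mathbb{C}$, $f_T(\xi,\eta)=\operatorname{tgm}(Q(\mathbf{a}^*,\xi),Q(\mathbf{b},\eta))$. The following are equivalent: (i) $T\colon\mathcal{B}(H)\to\mathcal{B}(H)$ is weakly compact; (ii) $T\colon\mathcal{K}(H)\to\mathcal{K}(H)$ is weakly compact; (iii) $f_T$ is continuous at $(0,0)$ for the product of the weak topologies on $H_1\times H_1$; (iv) the function $g_T(\xi)=f_T(\xi,\xi)$ on $H_1$ is continuous at $0$ (weak topology on $H_1$); (v) there exist $c_1,\dots,c_\ell\in\mathcal{K}(H)$, $d_1,\dots,d_\ell\in\mathcal{B}(H)$ and $0\le m\le\ell$ such that $Tx=\sum_{j=1}^mc_jxd_j+\sum_{j=m+1}^\ell d_jxc_j$ for all $x\in\mathcal{B}(H)$.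
   Context: $\mathcal{K}(H)$ denotes the compact operators on $H$ (note $T$ maps $\mathcal{K}(H)$ into itself). For a column $\mathbf{c}=[c_1,\dots,c_\ell]^t$ and $\eta\in H$, $Q(\mathbf{c},\eta)=(\langle c_j\eta,c_i\eta\rangle)_{i,j=1}^\ell$; $\mathbf{a}^*=[a_1^*,\dots,a_\ell^*]^t$. For positive semidefinite $X,Y\in M_\ell(\mathbb{C})$, $\operatorname{tgm}(X,Y)=\operatorname{trace}\sqrt{\sqrt{X}Y\sqrt{X}}$. *)

theory Defs
  imports "HOL-Analysis.Analysis"
begin

text \<open>Complex inner product spaces; the inner product is linear in the first
  argument and conjugate linear in the second (so that Q(c,eta) below is a Gram
  matrix, hence positive semidefinite).\<close>

class complex_inner = real_normed_vector +
  fixes scaleC :: "complex \<Rightarrow> 'a \<Rightarrow> 'a"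
  fixes cinner :: "'a \<Rightarrow> 'a \<Rightarrow> complex"
  assumes scaleC_add_right: "scaleC c (x + y) = scaleC c x + scaleC c y"
    and scaleC_add_left: "scaleC (c + d) x = scaleC c x + scaleC d x"
    and scaleC_scaleC: "scaleC c (scaleC d x) = scaleC (c * d) x"
    and scaleC_one: "scaleC 1 x = x"
    and scaleR_scaleC: "scaleR r x = scaleC (complex_of_real r) x"
    and cinner_commute: "cinner x y = cnj (cinner y x)"
    and cinner_add_left: "cinner (x + y) z = cinner x z + cinner y z"
    and cinner_scaleC_left: "cinner (scaleC c x) y = c * cinner x y"
    and cinner_ge_zero: "0 \<le> Re (cinner x x)"
    and cinner_eq_zero_iff: "cinner x x = 0 \<longleftrightarrow> x = 0"
    and norm_eq_sqrt_cinner: "norm x = sqrt (Re (cinner x x))"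

class chilbert_space = complex_inner + complete_space

definition bounded_clinear :: "('a::complex_inner \<Rightarrow> 'a) \<Rightarrow> bool" where
  "bounded_clinear f \<longleftrightarrow>
     (\<forall>x y. f (x + y) = f x + f y) \<and> (\<forall>c x. f (scaleC c x) = scaleC c (f x)) \<and>
     (\<exists>K. \<forall>x. norm (f x) \<le> norm x * K)"

definition compact_op :: "('a::complex_inner \<Rightarrow> 'a) \<Rightarrow> bool" where
  "compact_op f \<longleftrightarrow> bounded_clinear f \<and> compact (closure (f ` cball 0 1))"

definition cadjoint :: "('a::complex_inner \<Rightarrow> 'a) \<Rightarrow> ('a \<Rightarrow> 'a)" where
  "cadjoint f = (THE g. \<forall>x y. cinner (f x) y = cinner x (g y))"

definition op_add :: "('a::complex_inner \<Rightarrow> 'a) \<Rightarrow> ('a \<Rightarrow> 'a) \<Rightarrow> ('a \<Rightarrow> 'a)" where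
  "op_add f g = (\<lambda>h. f h + g h)"

definition op_scale :: "complex \<Rightarrow> ('a::complex_inner \<Rightarrow> 'a) \<Rightarrow> ('a \<Rightarrow> 'a)" where
  "op_scale c f = (\<lambda>h. scaleC c (f h))"

definition cdual :: "'v set \<Rightarrow> ('v \<Rightarrow> 'v \<Rightarrow> 'v) \<Rightarrow> (complex \<Rightarrow> 'v \<Rightarrow> 'v) \<Rightarrow> ('v \<Rightarrow> real)
                      \<Rightarrow> ('v \<Rightarrow> complex) set" where
  "cdual X add sc nrm = {\<phi>.
      (\<forall>x\<in>X. \<forall>y\<in>X. \<phi> (add x y) = \<phi> x + \<phi> y) \<and>
      (\<forall>c. \<forall>x\<in>X. \<phi> (sc c x) = c * \<phi> x) \<and>
      (\<exists>C. \<forall>x\<in>X. norm (\<phi> x) \<le> C * nrm x)}"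

definition weak_topology :: "'v set \<Rightarrow> ('v \<Rightarrow> 'v \<Rightarrow> 'v) \<Rightarrow> (complex \<Rightarrow> 'v \<Rightarrow> 'v) \<Rightarrow> ('v \<Rightarrow> real)
                      \<Rightarrow> 'v topology" where
  "weak_topology X add sc nrm =
     topology_generated_by {{x\<in>X. \<phi> x \<in> U} | \<phi> U. \<phi> \<in> cdual X add sc nrm \<and> open U}"

definition weakly_compact_map :: "'v set \<Rightarrow> ('v \<Rightarrow> 'v \<Rightarrow> 'v) \<Rightarrow> (complex \<Rightarrow> 'v \<Rightarrow> 'v)
                      \<Rightarrow> ('v \<Rightarrow> real) \<Rightarrow> ('v \<Rightarrow> 'v) \<Rightarrow> bool" where
  "weakly_compact_map X add sc nrm T \<longleftrightarrow>
     (\<exists>K\<subseteq>X. compactin (weak_topology X add sc nrm) K \<and> T ` {x\<in>X. nrm x \<le> 1} \<subseteq> K)"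

abbreviation BH :: "('a::complex_inner \<Rightarrow> 'a) set" where
  "BH \<equiv> {f. bounded_clinear f}"

abbreviation KH :: "('a::complex_inner \<Rightarrow> 'a) set" where
  "KH \<equiv> {f. compact_op f}"

definition weak_ball_topology :: "('a::complex_inner) topology" where
  "weak_ball_topology = subtopology (weak_topology UNIV (+) scaleC norm) (cball 0 1)"

definition elem_op :: "nat \<Rightarrow> (nat \<Rightarrow> 'a \<Rightarrow> 'a) \<Rightarrow> (nat \<Rightarrow> 'a \<Rightarrow> 'a) \<Rightarrow> ('a \<Rightarrow> 'a)
                         \<Rightarrow> ('a::complex_inner \<Rightarrow> 'a)" where
  "elem_op l a b x = (\<lambda>h. \<Sum>j<l. a j (x (b j h)))"

definition mtrunc :: "nat \<Rightarrow> (nat \<Rightarrow> nat \<Rightarrow> complex) \<Rightarrow> (nat \<Rightarrow> nat \<Rightarrow> complex)" where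
  "mtrunc l A = (\<lambda>i j. if i < l \<and> j < l then A i j else 0)"

definition mmult :: "nat \<Rightarrow> (nat \<Rightarrow> nat \<Rightarrow> complex) \<Rightarrow> (nat \<Rightarrow> nat \<Rightarrow> complex)
                       \<Rightarrow> (nat \<Rightarrow> nat \<Rightarrow> complex)" where
  "mmult l A B = (\<lambda>i j. if i < l \<and> j < l then \<Sum>k<l. A i k * B k j else 0)"

definition mtrace :: "nat \<Rightarrow> (nat \<Rightarrow> nat \<Rightarrow> complex) \<Rightarrow> complex" where
  "mtrace l A = (\<Sum>i<l. A i i)"

definition mpsd :: "nat \<Rightarrow> (nat \<Rightarrow> nat \<Rightarrow> complex) \<Rightarrow> bool" where
  "mpsd l A \<longleftrightarrow> (\<forall>i<l. \<forall>j<l. A j i = cnj (A i j)) \<and>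
     (\<forall>v. 0 \<le> Re (\<Sum>i<l. \<Sum>j<l. cnj (v i) * A i j * v j))"

definition msqrt :: "nat \<Rightarrow> (nat \<Rightarrow> nat \<Rightarrow> complex) \<Rightarrow> (nat \<Rightarrow> nat \<Rightarrow> complex)" where
  "msqrt l A = (THE S. mtrunc l S = S \<and> mpsd l S \<and> mmult l S S = mtrunc l A)"

definition tgm :: "nat \<Rightarrow> (nat \<Rightarrow> nat \<Rightarrow> complex) \<Rightarrow> (nat \<Rightarrow> nat \<Rightarrow> complex) \<Rightarrow> complex" where
  "tgm l X Y = mtrace l (msqrt l (mmult l (mmult l (msqrt l X) Y) (msqrt l X)))"

definition Qmat :: "(nat \<Rightarrow> 'a \<Rightarrow> 'a) \<Rightarrow> 'a::complex_inner \<Rightarrow> (nat \<Rightarrow> nat \<Rightarrow> complex)" where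
  "Qmat c \<eta> = (\<lambda>i j. cinner (c j \<eta>) (c i \<eta>))"

definition fT :: "nat \<Rightarrow> (nat \<Rightarrow> 'a \<Rightarrow> 'a) \<Rightarrow> (nat \<Rightarrow> 'a \<Rightarrow> 'a) \<Rightarrow> 'a::complex_inner \<times> 'a \<Rightarrow> complex" where
  "fT l a b = (\<lambda>(\<xi>, \<eta>). tgm l (Qmat (\<lambda>j. cadjoint (a j)) \<xi>) (Qmat b \<eta>))"

end

theory Submission
  imports Defs
begin

text \<open>
  Write \<open>K(\<xi>, \<eta>)\<close> for the tensor \<open>\<Sum>j<l. a j\<^sup>* \<xi> \<otimes> cnj (b j \<eta>)\<close>; pairing it with an operator \<open>x\<close> gives
  \<open>cinner (T x \<eta>) \<xi>\<close>. The squared Hilbert--Schmidt norm of \<open>K(\<xi>, \<eta>)\<close> is the trace of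
  \<open>Q(a\<^sup>*, \<xi>) Q(b, \<eta>)\<close>, so that \<open>f\<^sub>T\<close> is comparable to this norm, up to a factor \<open>sqrt l\<close>. Hence (iii) and,
  by polarization, (iv) say that \<open>T\<close> is small: \<open>cinner (T x \<eta>) \<xi>\<close> tends to zero when \<open>\<xi>\<close> and \<open>\<eta>\<close> do so
  weakly, uniformly for \<open>x\<close> in the Hilbert--Schmidt unit ball. If \<open>T\<close> is small and some \<open>a k\<close> is not
  compact, then a linear combination of the \<open>b i\<close> involving \<open>b k\<close> is compact, and one term can be split off;
  by induction on \<open>l\<close> this gives (v). Under (v), \<open>T\<close> is continuous from the unit ball of \<open>B(H)\<close> with the
  weak operator topology to \<open>K(H)\<close> with the weak topology, whence (i) and (ii). Finally, if \<open>T\<close> is not small,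
  a gliding hump produces a bounded sequence of finite rank operators whose image under \<open>T\<close> has no weak
  cluster point.
\<close>

text \<open>\<open>fT\<close> is the trace norm of this tensor, dual to the operator norm. For at
  most \<open>l\<close> terms the trace norm and the Hilbert-Schmidt norm are equivalent, and the
  latter is chosen because its duality, with \<open>HS_ball\<close>, follows from positivity of
  \<open>hsip\<close> alone. The main obstacle is that the dual of B(H) has no manageable
  description. It is met in two ways. Under (v) every \<open>T x\<close> is compact, so a functional
  enters only through its restriction to compact operators; after finite rank approximation it is
  enough to know it on rank one operators, where Riesz makes it explicit. In the converse a single
  functional refutes a weak cluster point, and Tychonoff provides it as a pointwise cluster point of
  vector functionals. Both arguments work for every space \<open>X\<close> between \<open>KH\<close>
  and \<open>BH\<close>, which treats (i) and (ii) together. The hump is made of vectors exactly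
  orthogonal to earlier data rather than merely weakly small, since exact orthogonality removes all
  cross terms: the partial sums stay bounded and each vector functional sees only one
  summand.\<close>

section \<open>Complex inner product spaces\<close>

lemma cinner_add_right: "cinner x (y + z) = cinner x y + cinner (x::'a::complex_inner) z"
  by (metis cinner_commute cinner_add_left complex_cnj_add)

lemma cinner_scaleC_right: "cinner x (scaleC c y) = cnj c * cinner (x::'a::complex_inner) y"
  by (metis cinner_commute cinner_scaleC_left complex_cnj_mult)

lemma scaleC_zero_left [simp]: "scaleC 0 (x::'a::complex_inner) = 0"
  by (metis of_real_0 scaleR_scaleC scale_zero_left)

lemma scaleC_zero_right [simp]: "scaleC c (0::'a::complex_inner) = 0"
  by (metis add_cancel_right_right scaleC_add_right)

lemma scaleC_minus_one: "scaleC (-1) (x::'a::complex_inner) = - x"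
  by (metis add.inverse_unique add.right_inverse scaleC_add_left scaleC_one scaleC_zero_left)

lemma scaleC_minus_right: "scaleC c (- (x::'a::complex_inner)) = - scaleC c x"
  by (metis mult.commute scaleC_minus_one scaleC_scaleC)

lemma cinner_zero_left [simp]: "cinner 0 (x::'a::complex_inner) = 0"
  by (metis cinner_scaleC_left mult_zero_left scaleC_zero_left)

lemma cinner_zero_right [simp]: "cinner (x::'a::complex_inner) 0 = 0"
  by (metis cinner_commute cinner_zero_left complex_cnj_zero)

lemma cinner_minus_left: "cinner (- x) y = - cinner (x::'a::complex_inner) y"
  by (metis cinner_scaleC_left mult_minus1 scaleC_minus_one)

lemma cinner_minus_right: "cinner x (- y) = - cinner (x::'a::complex_inner) y"
  by (metis cinner_minus_left cinner_commute complex_cnj_minus)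

lemma cinner_diff_left: "cinner (x - y) z = cinner x z - cinner (y::'a::complex_inner) z"
  by (metis cinner_add_left cinner_minus_left diff_conv_add_uminus)

lemma cinner_diff_right: "cinner x (y - z) = cinner x y - cinner (x::'a::complex_inner) z"
  by (metis cinner_add_right cinner_minus_right diff_conv_add_uminus)

lemma cinner_sum_left: "cinner (sum f I) y = (\<Sum>i\<in>I. cinner (f i) (y::'a::complex_inner))"
  by (induction I rule: infinite_finite_induct) (auto simp: cinner_add_left)

lemma cinner_sum_right: "cinner y (sum f I) = (\<Sum>i\<in>I. cinner (y::'a::complex_inner) (f i))"
  by (induction I rule: infinite_finite_induct) (auto simp: cinner_add_right)

lemma scaleC_sum_right: "scaleC c (sum f I) = (\<Sum>i\<in>I. scaleC c (f i::'a::complex_inner))"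
  by (induction I rule: infinite_finite_induct) (auto simp: scaleC_add_right)

lemmas cinner_simps = cinner_add_left cinner_add_right cinner_diff_left cinner_diff_right
  cinner_minus_left cinner_minus_right cinner_scaleC_left cinner_scaleC_right

lemma cinner_self: "cinner x x = complex_of_real ((norm (x::'a::complex_inner))\<^sup>2)"
proof (rule complex_eqI)
  show "Re (cinner x x) = Re (complex_of_real ((norm x)\<^sup>2))"
    using cinner_ge_zero[of x] by (simp add: norm_eq_sqrt_cinner)
  have "Im (cinner x x) = - Im (cinner x x)"
    by (metis cinner_commute cnj.simps(2))
  then show "Im (cinner x x) = Im (complex_of_real ((norm x)\<^sup>2))"
    by simp
qed

lemma power2_norm_eq_cinner: "(norm x)\<^sup>2 = Re (cinner x (x::'a::complex_inner))"
  by (simp add: cinner_self)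

lemma norm_scaleC: "norm (scaleC c x) = cmod c * norm (x::'a::complex_inner)"
proof -
  have "(norm (scaleC c x))\<^sup>2 = Re ((c * cnj c) * cinner x x)"
    by (simp add: power2_norm_eq_cinner cinner_simps mult_ac del: times_complex.sel)
  also have "\<dots> = (cmod c * norm x)\<^sup>2"
    unfolding cinner_self complex_norm_square[symmetric]
    by (metis Re_complex_of_real of_real_mult power_mult_distrib)
  finally show ?thesis
    by (simp add: power2_eq_iff_nonneg)
qed

lemma cinner_Cauchy_Schwarz: "cmod (cinner x y) \<le> norm x * norm (y::'a::complex_inner)"
proof (cases "y = 0")
  case False
  then have ny: "norm y > 0" by simp
  define c where "c = cinner x y / cinner y y"
  have yy: "cinner y y \<noteq> 0" using False by (simp add: cinner_eq_zero_iff)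
  have "0 \<le> Re (cinner (x - scaleC c y) (x - scaleC c y))"
    by (rule cinner_ge_zero)
  also have "cinner (x - scaleC c y) (x - scaleC c y)
      = cinner x x - cnj c * cinner x y - c * (cinner y x - cnj c * cinner y y)"
    by (simp add: cinner_simps algebra_simps)
  also have "cnj c * cinner y y = cinner y x"
    using yy by (simp add: c_def cinner_self flip: cinner_commute[of y x])
  also have "cinner x x - cnj c * cinner x y - c * (cinner y x - cinner y x)
      = cinner x x - complex_of_real ((cmod (cinner x y))\<^sup>2 / (norm y)\<^sup>2)"
    unfolding c_def of_real_divide complex_norm_square cinner_self by (simp add: mult.commute)
  finally have "(cmod (cinner x y))\<^sup>2 / (norm y)\<^sup>2 \<le> (norm x)\<^sup>2"
    by (simp add: cinner_self)
  then have "(cmod (cinner x y))\<^sup>2 \<le> (norm x * norm y)\<^sup>2"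
    using ny by (simp add: field_simps)
  then show ?thesis
    by (rule power2_le_imp_le) simp
qed auto

lemma norm_le_if_cinner_le:
  assumes "\<And>y. norm y \<le> 1 \<Longrightarrow> cmod (cinner x y) \<le> K"
  shows "norm (x::'a::complex_inner) \<le> K"
proof (cases "x = 0")
  case True
  then show ?thesis using assms[of 0] by simp
next
  case False
  have "cinner x (scaleC (complex_of_real (inverse (norm x))) x) = complex_of_real (norm x)"
    using False by (simp add: cinner_simps cinner_self power2_eq_square)
  moreover have "norm (scaleC (complex_of_real (inverse (norm x))) x) \<le> 1"
    using False by (simp add: norm_scaleC norm_inverse)
  ultimately show ?thesis
    using assms by (metis norm_ge_zero norm_of_real abs_of_nonneg)
qed

lemma cinner_eqI:
  assumes "\<And>y. cinner x y = cinner z (y::'a::complex_inner)"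
  shows "x = z"
  using assms[of "x - z"] by (metis cinner_diff_left cinner_eq_zero_iff eq_iff_diff_eq_0)

lemma parallelogram_law:
  "(norm (x + y))\<^sup>2 + (norm (x - y))\<^sup>2 = 2 * (norm x)\<^sup>2 + 2 * (norm (y::'a::complex_inner))\<^sup>2"
  by (simp add: power2_norm_eq_cinner cinner_simps)

lemma norm_sum_pythagoras:
  assumes "finite I" "\<And>i j. i \<in> I \<Longrightarrow> j \<in> I \<Longrightarrow> i \<noteq> j \<Longrightarrow> cinner (f i) (f j) = 0"
  shows "(norm (sum f I))\<^sup>2 = (\<Sum>i\<in>I. (norm (f i::'a::complex_inner))\<^sup>2)"
proof -
  have "cinner (sum f I) (sum f I) = (\<Sum>i\<in>I. \<Sum>j\<in>I. cinner (f i) (f j))"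
    unfolding cinner_sum_left by (simp add: cinner_sum_right)
  also have "\<dots> = (\<Sum>i\<in>I. \<Sum>j\<in>I. if j = i then cinner (f i) (f i) else 0)"
    using assms(2) by (intro sum.cong) (auto split: if_splits)
  also have "\<dots> = (\<Sum>i\<in>I. cinner (f i) (f i))"
    using assms(1) by simp
  finally show ?thesis
    by (simp add: power2_norm_eq_cinner)
qed

subsection \<open>The Riesz representation theorem\<close>

text \<open>A minimizing sequence is Cauchy by the parallelogram law, because the midpoint of two of
  its terms lies in \<open>M\<close> and so still has norm at least the infimum.\<close>

lemma minimal_norm_exists:
  fixes M :: "'a::chilbert_space set"
  assumes "closed M" "M \<noteq> {}" and mid: "\<And>x y. x \<in> M \<Longrightarrow> y \<in> M \<Longrightarrow> scaleR (1/2) (x + y) \<in> M"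
  obtains q where "q \<in> M" "\<And>x. x \<in> M \<Longrightarrow> norm q \<le> norm x"
proof -
  define d where "d = Inf (norm ` M)"
  have bdd: "bdd_below (norm ` M)" by (rule bdd_belowI2[of _ 0]) simp
  have d_le: "d \<le> norm x" if "x \<in> M" for x
    unfolding d_def using that bdd by (simp add: cInf_lower)
  have d0: "0 \<le> d"
    unfolding d_def using assms(2) by (intro cInf_greatest) auto
  have "\<exists>h\<in>M. norm h < d + inverse (real (Suc n))" for n
    using cInf_lessD[of "norm ` M" "d + inverse (real (Suc n))"] assms(2)
    by (auto simp: d_def)
  then obtain h where hM: "\<And>n. h n \<in> M" and hn: "\<And>n. norm (h n) < d + inverse (real (Suc n))"
    by metis
  have "(\<lambda>n. norm (h n)) \<longlonglongrightarrow> d"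
  proof (rule tendsto_sandwich[where f = "\<lambda>_. d" and h = "\<lambda>n. d + inverse (real (Suc n))"])
    show "(\<lambda>n. d + inverse (real (Suc n))) \<longlonglongrightarrow> d"
      using tendsto_add[OF tendsto_const LIMSEQ_inverse_real_of_nat, of d] by simp
    show "\<forall>\<^sub>F n in sequentially. norm (h n) \<le> d + inverse (real (Suc n))"
      using hn by (intro always_eventually allI less_imp_le)
    show "\<forall>\<^sub>F n in sequentially. d \<le> norm (h n)"
      using d_le[OF hM] by (intro always_eventually allI)
  qed simp
  then have lim: "(\<lambda>n. (norm (h n))\<^sup>2) \<longlonglongrightarrow> d\<^sup>2"
    by (intro tendsto_power)
  have "Cauchy h"
  proof (rule metric_CauchyI)
    fix e :: real assume e: "0 < e"
    have "\<forall>\<^sub>F n in sequentially. (norm (h n))\<^sup>2 < d\<^sup>2 + e\<^sup>2 / 4"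
      using order_tendstoD(2)[OF lim] e by simp
    then obtain N where N: "\<And>n. n \<ge> N \<Longrightarrow> (norm (h n))\<^sup>2 < d\<^sup>2 + e\<^sup>2 / 4"
      by (auto simp: eventually_sequentially)
    have "dist (h m) (h n) < e" if "m \<ge> N" "n \<ge> N" for m n
    proof -
      have "d \<le> norm (scaleR (1/2) (h m + h n))"
        by (intro d_le mid hM)
      then have "(2 * d)\<^sup>2 \<le> (norm (h m + h n))\<^sup>2"
        using d0 by (intro power_mono) auto
      then have "(norm (h m - h n))\<^sup>2 < e\<^sup>2"
        using parallelogram_law[of "h m" "h n"] N[OF that(1)] N[OF that(2)]
        by (simp add: power_mult_distrib)
      then show ?thesis
        using e by (simp add: dist_norm power2_less_imp_less)
    qed
    then show "\<exists>N. \<forall>m\<ge>N. \<forall>n\<ge>N. dist (h m) (h n) < e" by blast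
  qed
  then obtain q where q: "h \<longlonglongrightarrow> q"
    using Cauchy_convergent_iff convergent_def by blast
  have "q \<in> M"
    using closed_sequentially[OF assms(1)] hM q by blast
  moreover have "norm q = d"
    using tendsto_norm[OF q] \<open>(\<lambda>n. norm (h n)) \<longlonglongrightarrow> d\<close> LIMSEQ_unique by blast
  ultimately show ?thesis
    using that d_le by blast
qed

lemma orthogonal_if_minimal_norm:
  fixes q k :: "'a::complex_inner"
  assumes "\<And>c. norm q \<le> norm (q + scaleC c k)"
  shows "cinner q k = 0"
proof (cases "k = 0")
  case False
  \<comment> \<open>The coefficient that minimizes the norm of \<open>q + scaleC c k\<close>. It
    lowers the squared norm by |<q,k>|^2 / |k|^2, which must therefore vanish.\<close>
  define c where "c = - cinner q k / cinner k k"
  have kk: "cinner k k \<noteq> 0" using False by (simp add: cinner_eq_zero_iff)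
  have "(norm q)\<^sup>2 \<le> (norm (q + scaleC c k))\<^sup>2"
    using assms by (simp add: power_mono)
  moreover have "cinner (q + scaleC c k) (q + scaleC c k)
      = cinner q q + cnj c * cinner q k + c * (cinner k q + cnj c * cinner k k)"
    by (simp add: cinner_simps algebra_simps)
  moreover have "cnj c * cinner k k = - cinner k q"
    using kk by (simp add: c_def cinner_self flip: cinner_commute[of k q])
  ultimately have "(norm q)\<^sup>2 \<le> (norm q)\<^sup>2 + Re (cnj c * cinner q k)"
    by (simp add: power2_norm_eq_cinner)
  also have "cnj c * cinner q k = - complex_of_real ((cmod (cinner q k))\<^sup>2 / (norm k)\<^sup>2)"
    unfolding c_def of_real_divide complex_norm_square cinner_self by (simp add: mult.commute)
  finally have "(cmod (cinner q k))\<^sup>2 / (norm k)\<^sup>2 \<le> 0"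
    by simp
  then show ?thesis
    using False by (simp add: divide_le_0_iff)
qed auto

text \<open>The shortest vector \<open>q\<close> of the affine hyperplane on which
  \<open>\<phi>\<close> equals 1 is orthogonal to the kernel. As
  \<open>x - scaleC (\<phi> x) q\<close> lies in the kernel, \<open>\<phi> x\<close> is the quotient
  of \<open>cinner x q\<close> by \<open>cinner q q\<close>.\<close>

theorem Riesz_representation:
  fixes \<phi> :: "'a::chilbert_space \<Rightarrow> complex"
  assumes add: "\<And>x y. \<phi> (x + y) = \<phi> x + \<phi> y" and sc: "\<And>c x. \<phi> (scaleC c x) = c * \<phi> x"
    and bd: "\<And>x. cmod (\<phi> x) \<le> K * norm x"
  obtains q where "\<And>x. \<phi> x = cinner x q"
proof (cases "\<forall>x. \<phi> x = 0")
  case True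
  then show ?thesis using that[of 0] by simp
next
  case False
  then obtain x0 where x0: "\<phi> x0 \<noteq> 0" by blast
  have bl: "bounded_linear \<phi>"
    by (rule bounded_linear_intro[where K = K])
       (auto simp: add sc bd scaleR_scaleC scaleR_conv_of_real mult.commute)
  define M where "M = \<phi> -` {1}"
  have "closed M"
    unfolding M_def by (intro continuous_closed_vimage closed_singleton
        linear_continuous_at bl)
  moreover have "scaleC (1 / \<phi> x0) x0 \<in> M"
    using x0 by (simp add: M_def sc)
  then have "M \<noteq> {}" by blast
  moreover have "scaleR (1/2) (x + y) \<in> M" if "x \<in> M" "y \<in> M" for x y
    using that by (simp add: M_def add sc scaleR_scaleC)
  ultimately obtain q where q: "q \<in> M" "\<And>x. x \<in> M \<Longrightarrow> norm q \<le> norm x"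
    using minimal_norm_exists by metis
  have q1: "\<phi> q = 1" using q(1) by (simp add: M_def)
  then have "q \<noteq> 0" using sc[of 0 0] by auto
  have orth: "cinner q k = 0" if "\<phi> k = 0" for k
    by (rule orthogonal_if_minimal_norm) (use that q1 in \<open>auto intro!: q(2) simp: M_def add sc\<close>)
  have "\<phi> x = cinner x (scaleC (1 / cinner q q) q)" for x
  proof -
    have "\<phi> (x - scaleC (\<phi> x) q) = 0"
      using add[of "x - scaleC (\<phi> x) q" "scaleC (\<phi> x) q"] by (simp add: sc q1)
    then have "cinner (x - scaleC (\<phi> x) q) q = 0"
      using orth cinner_commute by (metis complex_cnj_zero)
    then have "cinner x q = \<phi> x * cinner q q"
      by (simp add: cinner_simps)
    then show ?thesis
      using \<open>q \<noteq> 0\<close> by (simp add: cinner_simps cinner_self)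
  qed
  then show ?thesis by (rule that)
qed

subsection \<open>Bounded operators and their adjoints\<close>

lemma bounded_clinear_add: "bounded_clinear f \<Longrightarrow> f (x + y) = f x + f y"
  and bounded_clinear_scaleC: "bounded_clinear f \<Longrightarrow> f (scaleC c x) = scaleC c (f x)"
  by (auto simp: bounded_clinear_def)

lemma bounded_clinear_imp_bounded_linear:
  assumes "bounded_clinear f"
  shows "bounded_linear f"
proof -
  obtain K where "\<And>x. norm (f x) \<le> norm x * K"
    using assms by (auto simp: bounded_clinear_def)
  then show ?thesis
    using assms by (intro bounded_linear_intro[where K = K])
      (auto simp: bounded_clinear_add bounded_clinear_scaleC scaleR_scaleC)
qed

lemma bounded_clinearI:
  assumes "\<And>x y. f (x + y) = f x + f y" "\<And>c x. f (scaleC c x) = scaleC c (f x)"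
    "\<And>x. norm (f x) \<le> K * norm x"
  shows "bounded_clinear f"
  unfolding bounded_clinear_def using assms by (metis mult.commute)

lemma bounded_clinear_zero: "bounded_clinear f \<Longrightarrow> f 0 = 0"
  and bounded_clinear_diff: "bounded_clinear f \<Longrightarrow> f (x - y) = f x - f y"
  and bounded_clinear_minus: "bounded_clinear f \<Longrightarrow> f (- x) = - f x"
  and bounded_clinear_sum: "bounded_clinear f \<Longrightarrow> f (sum g I) = (\<Sum>i\<in>I. f (g i))"
  by (auto dest!: bounded_clinear_imp_bounded_linear bounded_linear.linear
      simp: linear_0 linear_diff linear_neg linear_sum)

lemma norm_le_onorm: "bounded_clinear f \<Longrightarrow> norm (f x) \<le> onorm f * norm x"
  by (simp add: bounded_clinear_imp_bounded_linear onorm)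

lemma onorm_nonneg: "bounded_clinear f \<Longrightarrow> 0 \<le> onorm f"
  by (simp add: bounded_clinear_imp_bounded_linear onorm_pos_le)

lemma bounded_clinear_0: "bounded_clinear (\<lambda>h. 0)"
  by (rule bounded_clinearI[where K = 0]) auto

lemma bounded_clinear_plus:
  assumes f: "bounded_clinear f" and g: "bounded_clinear g"
  shows "bounded_clinear (\<lambda>h. f h + g h)"
  by (rule bounded_clinearI[where K = "onorm f + onorm g"])
     (auto simp: bounded_clinear_add bounded_clinear_scaleC f g scaleC_add_right algebra_simps
           intro!: norm_triangle_le add_mono norm_le_onorm)

lemma bounded_clinear_scale:
  assumes f: "bounded_clinear f"
  shows "bounded_clinear (\<lambda>h. scaleC c (f h))"
  by (rule bounded_clinearI[where K = "cmod c * onorm f"])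
     (auto simp: bounded_clinear_add bounded_clinear_scaleC f scaleC_add_right scaleC_scaleC
       mult.commute[of c] norm_scaleC mult.assoc intro!: mult_left_mono norm_le_onorm)

lemma bounded_clinear_sub:
  assumes "bounded_clinear f" "bounded_clinear g"
  shows "bounded_clinear (\<lambda>h. f h - g h)"
  using bounded_clinear_plus[OF assms(1) bounded_clinear_scale[OF assms(2), of "-1"]]
  by (simp add: scaleC_minus_one)

lemma bounded_clinear_setsum:
  "(\<And>i. i \<in> I \<Longrightarrow> bounded_clinear (f i)) \<Longrightarrow> bounded_clinear (\<lambda>h. \<Sum>i\<in>I. f i h)"
  by (induction I rule: infinite_finite_induct) (auto intro: bounded_clinear_0 bounded_clinear_plus)

lemma bounded_clinear_compose:
  assumes f: "bounded_clinear f" and g: "bounded_clinear g"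
  shows "bounded_clinear (\<lambda>h. f (g h))"
proof (rule bounded_clinearI[where K = "onorm f * onorm g"])
  fix x
  have "norm (f (g x)) \<le> onorm f * (onorm g * norm x)"
    by (rule order_trans[OF norm_le_onorm[OF f]])
       (intro mult_left_mono norm_le_onorm g onorm_nonneg f)
  then show "norm (f (g x)) \<le> onorm f * onorm g * norm x"
    by (simp add: mult.assoc)
qed (auto simp: bounded_clinear_add bounded_clinear_scaleC f g)

lemma bounded_clinear_rank_one: "bounded_clinear (\<lambda>h. scaleC (cinner h u) v)"
  by (rule bounded_clinearI[where K = "norm u * norm v"])
     (auto simp: cinner_simps scaleC_add_left scaleC_scaleC norm_scaleC
       intro!: order_trans[OF mult_right_mono[OF cinner_Cauchy_Schwarz]])

lemma onorm_le:
  assumes "\<And>x. norm x \<le> 1 \<Longrightarrow> norm (f x) \<le> K" "bounded_clinear f"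
  shows "onorm f \<le> K"
proof (rule onorm_bound)
  show "0 \<le> K" using assms(1)[of 0] norm_ge_zero order_trans by (metis norm_zero zero_le_one)
  fix x
  show "norm (f x) \<le> K * norm x"
  proof (cases "x = 0")
    case False
    have "norm (f (scaleR (inverse (norm x)) x)) \<le> K"
      by (rule assms(1)) (use False in simp)
    then show ?thesis
      using False by (simp add: bounded_clinear_imp_bounded_linear[OF assms(2)] linear_cmul
          bounded_linear.linear field_simps)
  qed (simp add: bounded_clinear_zero assms)
qed

text \<open>\<open>cadjoint\<close> is a definite description: Riesz provides a candidate for each
  \<open>y\<close>, and nondegeneracy of the inner product its uniqueness.\<close>

lemma cadjoint:
  fixes f :: "'a::chilbert_space \<Rightarrow> 'a"
  assumes f: "bounded_clinear f"
  shows "cinner (f x) y = cinner x (cadjoint f y)"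
proof -
  have "\<exists>q. \<forall>x. cinner (f x) y = cinner x q" for y
  proof -
    have "cmod (cinner (f x) y) \<le> onorm f * norm y * norm x" for x
      by (rule order_trans[OF cinner_Cauchy_Schwarz])
         (use mult_right_mono[OF norm_le_onorm[OF f, of x], of "norm y"] in \<open>simp add: mult_ac\<close>)
    then obtain q where "\<And>x. cinner (f x) y = cinner x q"
      by (rule Riesz_representation[of "\<lambda>x. cinner (f x) y", rotated 2])
         (auto simp: bounded_clinear_add[OF f] bounded_clinear_scaleC[OF f] cinner_simps)
    then show ?thesis by blast
  qed
  then obtain g where g: "\<forall>x y. cinner (f x) y = cinner x (g y)"
    by metis
  have "cadjoint f = g"
    unfolding cadjoint_def
  proof (rule the_equality)
    show "\<forall>x y. cinner (f x) y = cinner x (g y)" by (rule g)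
  next
    fix g' assume "\<forall>x y. cinner (f x) y = cinner x (g' y)"
    then have "cinner (g' y) x = cinner (g y) x" for x y
      using g cinner_commute by metis
    then show "g' = g" by (intro ext cinner_eqI)
  qed
  then show ?thesis using g by simp
qed

lemma cadjoint':
  fixes f :: "'a::chilbert_space \<Rightarrow> 'a"
  assumes "bounded_clinear f"
  shows "cinner (cadjoint f x) y = cinner x (f y)"
  using cadjoint[OF assms] cinner_commute by metis

lemma norm_cadjoint_le:
  fixes f :: "'a::chilbert_space \<Rightarrow> 'a"
  assumes f: "bounded_clinear f"
  shows "norm (cadjoint f x) \<le> onorm f * norm x"
proof (rule norm_le_if_cinner_le)
  fix y :: 'a assume y: "norm y \<le> 1"
  have "cmod (cinner (cadjoint f x) y) \<le> norm x * norm (f y)"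
    by (simp add: cadjoint'[OF f] cinner_Cauchy_Schwarz)
  also have "\<dots> \<le> norm x * (onorm f * 1)"
    using y by (intro mult_left_mono order_trans[OF norm_le_onorm[OF f]] onorm_nonneg[OF f]) auto
  finally show "cmod (cinner (cadjoint f x) y) \<le> onorm f * norm x"
    by (simp add: mult.commute)
qed

lemma bounded_clinear_cadjoint:
  fixes f :: "'a::chilbert_space \<Rightarrow> 'a"
  assumes f: "bounded_clinear f"
  shows "bounded_clinear (cadjoint f)"
proof (rule bounded_clinearI)
  show "norm (cadjoint f x) \<le> onorm f * norm x" for x
    by (rule norm_cadjoint_le[OF f])
qed (rule cinner_eqI, simp add: cadjoint'[OF f] cinner_simps)+

lemma cadjoint_cadjoint:
  fixes f :: "'a::chilbert_space \<Rightarrow> 'a"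
  assumes f: "bounded_clinear f"
  shows "cadjoint (cadjoint f) = f"
  by (rule ext, rule cinner_eqI)
     (metis cadjoint'[OF f] cadjoint'[OF bounded_clinear_cadjoint[OF f]] cadjoint[OF f])

section \<open>The Hilbert--Schmidt form\<close>

text \<open>The square of the Hilbert--Schmidt norm of the tensor \<open>\<Sum>i\<in>I. u i \<otimes> cnj (v i)\<close>, that is,
  of the operator \<open>\<lambda>h. \<Sum>i\<in>I. scaleC (cinner h (v i)) (u i)\<close>, and its polarization.\<close>

definition hsip :: "'i set \<Rightarrow> ('i \<Rightarrow> 'a::complex_inner) \<Rightarrow> ('i \<Rightarrow> 'a) \<Rightarrow>
    'j set \<Rightarrow> ('j \<Rightarrow> 'a) \<Rightarrow> ('j \<Rightarrow> 'a) \<Rightarrow> complex" where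
  "hsip I u v J u' v' = (\<Sum>i\<in>I. \<Sum>j\<in>J. cinner (u i) (u' j) * cinner (v' j) (v i))"

lemma hsip_commute: "hsip I u v J u' v' = cnj (hsip J u' v' I u v)"
  unfolding hsip_def cnj_sum complex_cnj_mult cinner_commute[symmetric]
  by (subst sum.swap) (simp add: mult.commute)

text \<open>Splitting off the component along one of the vectors \<open>u k\<close> leaves a sum
  of the same kind with one term less.\<close>

lemma hsip_nonneg:
  assumes "finite I"
  shows "\<exists>r\<ge>0. hsip I u v I u v = complex_of_real r"
  using assms
proof (induction I arbitrary: u rule: finite_induct)
  case (insert k I)
  define e where "e = u k"
  \<comment> \<open>For \<open>e = 0\<close> the quotient is 0, so \<open>u'\<close> is
    \<open>u\<close> and the identity \<open>split\<close> below holds in this case as well.\<close>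
  define u' where "u' i = u i - scaleC (cinner (u i) e / cinner e e) e" for i
  \<comment> \<open>The components along \<open>e\<close> contribute exactly |w|^2 / |e|^2, a
    nonnegative amount.\<close>
  define w where "w = (\<Sum>i\<in>insert k I. scaleC (cinner e (u i)) (v i))"
  have u'k: "u' k = 0"
    by (cases "e = 0") (auto simp: u'_def e_def cinner_self scaleC_one)
  have split: "cinner (u i) (u j) = cinner (u' i) (u' j) + cinner (u i) e * cinner e (u j) / cinner e e"
    for i j
  proof (cases "e = 0")
    case False
    then have "cinner e e \<noteq> 0" "cnj (cinner e e) = cinner e e"
      by (auto simp: cinner_self)
    then show ?thesis
      by (simp add: u'_def cinner_simps field_simps cinner_commute[of e "u j"] cinner_commute[of e "u i"])
  qed (simp add: u'_def)
  have w: "cinner w w = (\<Sum>i\<in>insert k I. \<Sum>j\<in>insert k I.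
      cinner (u i) e * cinner e (u j) * cinner (v j) (v i))"
    unfolding w_def cinner_sum_left cinner_sum_right
    by (simp add: cinner_simps cinner_commute[symmetric] mult_ac del: sum.insert)
  have "hsip (insert k I) u v (insert k I) u v
      = hsip (insert k I) u' v (insert k I) u' v + cinner w w / cinner e e"
    unfolding hsip_def split w by (simp add: algebra_simps sum.distrib sum_divide_distrib add_divide_distrib
        del: sum.insert)
  also have "hsip (insert k I) u' v (insert k I) u' v = hsip I u' v I u' v"
    using insert.hyps by (simp add: hsip_def u'k)
  also obtain r where "r \<ge> 0" "hsip I u' v I u' v = complex_of_real r"
    using insert.IH by blast
  ultimately show ?case
    by (intro exI[of _ "r + (norm w)\<^sup>2 / (norm e)\<^sup>2"]) (auto simp: cinner_self)
qed (auto simp: hsip_def)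

definition hsnorm :: "'i set \<Rightarrow> ('i \<Rightarrow> 'a::complex_inner) \<Rightarrow> ('i \<Rightarrow> 'a) \<Rightarrow> real" where
  "hsnorm I u v = sqrt (Re (hsip I u v I u v))"

lemma hsnorm_ge_0 [simp]: "finite I \<Longrightarrow> 0 \<le> hsnorm I u v"
  using hsip_nonneg[of I u v] by (auto simp: hsnorm_def)

lemma hsip_self: "finite I \<Longrightarrow> hsip I u v I u v = complex_of_real ((hsnorm I u v)\<^sup>2)"
  using hsip_nonneg[of I u v] by (auto simp: hsnorm_def simp flip: of_real_power)

lemma hsip_scaleC: "hsip I (\<lambda>i. scaleC c (u i)) v J u' v' = c * hsip I u v J u' v'"
  by (simp add: hsip_def cinner_simps sum_distrib_left mult_ac)

lemma hsip_scaleC_right: "hsip I u v J (\<lambda>i. scaleC c (u' i)) v' = cnj c * hsip I u v J u' v'"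
  by (simp add: hsip_def cinner_simps sum_distrib_left mult_ac)

lemma hsip_Plus_left:
  assumes "finite I" "finite J"
  shows "hsip (I <+> J) (case_sum u u') (case_sum v v') L x y = hsip I u v L x y + hsip J u' v' L x y"
  using assms by (simp add: hsip_def sum.Plus)

lemma hsip_Plus_right:
  assumes "finite I" "finite J"
  shows "hsip L x y (I <+> J) (case_sum u u') (case_sum v v') = hsip L x y I u v + hsip L x y J u' v'"
  using assms by (simp add: hsip_def sum.Plus sum.distrib)

text \<open>The discriminant inequality behind both Cauchy-Schwarz proofs. The forms may be
  degenerate, so \<open>A = 0\<close> and \<open>C = 0\<close> need their own arguments.\<close>

lemma abs_le_if_quadratic_nonneg:
  fixes A B C :: real
  assumes "\<And>r. 0 \<le> A\<^sup>2 - 2 * r * B + r\<^sup>2 * C\<^sup>2" "0 \<le> A" "0 \<le> C"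
  shows "B \<le> A * C"
proof (rule ccontr)
  assume B: "\<not> B \<le> A * C"
  show False
  proof (cases "C = 0")
    case True
    then have "B > 0" using B by simp
    \<comment> \<open>With \<open>C = 0\<close> the expression is affine in \<open>r\<close>; this
      value of \<open>r\<close> makes it equal to -1.\<close>
    moreover have "2 * ((A\<^sup>2 + 1) / (2 * B)) * B = A\<^sup>2 + 1"
      using \<open>B > 0\<close> by simp
    ultimately show False
      using assms(1)[of "(A\<^sup>2 + 1) / (2 * B)"] True by simp
  next
    case False
    then have "C > 0" using assms by simp
    have "A * C \<ge> 0" using assms by simp
    \<comment> \<open>The value \<open>A / C\<close> rules out \<open>A > 0\<close>; the minimizer
      \<open>B / C\<^sup>2\<close> is inserted once \<open>A = 0\<close> is known.\<close>
    have "0 \<le> A\<^sup>2 - 2 * (A / C) * B + (A / C)\<^sup>2 * C\<^sup>2" by (rule assms(1))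
    then have "2 * (A / C) * B \<le> 2 * A\<^sup>2"
      using \<open>C > 0\<close> by (simp add: power_divide)
    then have "A * B \<le> A * (A * C)"
      using \<open>C > 0\<close> by (simp add: field_simps power2_eq_square)
    then have "A = 0"
      using B assms(2) by (simp add: mult_le_cancel_left)
    then have "B > 0" using B by simp
    have "0 \<le> A\<^sup>2 - 2 * (B / C\<^sup>2) * B + (B / C\<^sup>2)\<^sup>2 * C\<^sup>2" by (rule assms(1))
    also have "\<dots> = - (B\<^sup>2 / C\<^sup>2)"
      using \<open>A = 0\<close> \<open>C > 0\<close> by (simp add: field_simps power2_eq_square)
    finally show False
      using \<open>B > 0\<close> \<open>C > 0\<close> by (simp add: zero_less_divide_iff flip: not_less)
  qed
qed

lemma complex_phase:
  obtains c where "cnj c * h = complex_of_real (cmod h)" "cmod c = 1"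
proof (cases "h = 0")
  case False
  then have "cnj (h / cmod h) * h = complex_of_real (cmod h)"
    using complex_norm_square[of h] by (simp add: field_simps power2_eq_square)
  then show ?thesis
    using that[of "h / cmod h"] False by (simp add: norm_divide)
qed (use that[of 1] in simp)

text \<open>A sum of tensors is the concatenation of their families, so \<open>hsip_nonneg\<close>
  over \<open>I <+> J\<close>, with the second family scaled by \<open>s\<close>, is a nonnegative
  quadratic expression in \<open>r\<close>. The phase \<open>c\<close> makes the cross terms
  real.\<close>

lemma hsip_Cauchy_Schwarz:
  assumes fin: "finite I" "finite J"
  shows "cmod (hsip I u v J u' v') \<le> hsnorm I u v * hsnorm J u' v'"
proof (rule abs_le_if_quadratic_nonneg)
  fix r :: real
  define h where "h = hsip I u v J u' v'"
  obtain c where c: "cnj c * h = complex_of_real (cmod h)" "cmod c = 1"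
    by (rule complex_phase)
  define s where "s = complex_of_real (- r) * c"
  obtain q where q: "q \<ge> 0" and "hsip (I <+> J) (case_sum u (\<lambda>j. scaleC s (u' j))) (case_sum v v')
     (I <+> J) (case_sum u (\<lambda>j. scaleC s (u' j))) (case_sum v v') = complex_of_real q"
    using hsip_nonneg[of "I <+> J"] fin by (metis finite_Plus)
  then have "complex_of_real q = complex_of_real ((hsnorm I u v)\<^sup>2) + cnj s * h + s * cnj h
      + (s * cnj s) * complex_of_real ((hsnorm J u' v')\<^sup>2)"
    unfolding h_def hsip_self[OF fin(1), symmetric] hsip_self[OF fin(2), symmetric]
    using fin hsip_commute[of J u' v' I u v]
    by (simp add: hsip_Plus_left hsip_Plus_right hsip_scaleC hsip_scaleC_right algebra_simps)
  also have "cnj s * h = complex_of_real (- r * cmod h)"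
    using c by (simp add: s_def mult.assoc)
  also have "s * cnj h = complex_of_real (- r * cmod h)"
    using arg_cong[OF c(1), of cnj] by (simp add: s_def mult.assoc)
  also have "s * cnj s = complex_of_real ((cmod s)\<^sup>2)"
    by (rule complex_norm_square[symmetric])
  finally have "q = (hsnorm I u v)\<^sup>2 - 2 * r * cmod h + (cmod s)\<^sup>2 * (hsnorm J u' v')\<^sup>2"
    unfolding of_real_add[symmetric] of_real_mult[symmetric] of_real_eq_iff by simp
  moreover have "(cmod s)\<^sup>2 = r\<^sup>2"
    using c(2) by (simp add: s_def norm_mult)
  ultimately show "0 \<le> (hsnorm I u v)\<^sup>2 - 2 * r * cmod (hsip I u v J u' v') + r\<^sup>2 * (hsnorm J u' v')\<^sup>2"
    using q by (auto simp: h_def)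
qed (use fin in auto)

definition tensor_op :: "'i set \<Rightarrow> ('i \<Rightarrow> 'a::complex_inner) \<Rightarrow> ('i \<Rightarrow> 'a) \<Rightarrow> 'a \<Rightarrow> 'a" where
  "tensor_op I u v = (\<lambda>h. \<Sum>i\<in>I. scaleC (cinner h (v i)) (u i))"

lemma bounded_clinear_tensor_op: "bounded_clinear (tensor_op I u v)"
  unfolding tensor_op_def by (intro bounded_clinear_setsum bounded_clinear_rank_one)

lemma sum_cinner_tensor_op:
  "(\<Sum>j\<in>J. cinner (tensor_op I u v (v' j)) (u' j)) = hsip I u v J u' v'"
  unfolding hsip_def tensor_op_def cinner_sum_left
  by (subst sum.swap) (simp add: cinner_simps mult.commute)

lemma hsnorm_single: "hsnorm {k} u v = norm (u k) * norm (v k)"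
  by (simp add: hsnorm_def hsip_def cinner_self real_sqrt_mult flip: of_real_mult)

text \<open>The Hilbert-Schmidt norm dominates the operator norm: a matrix coefficient of
  \<open>tensor_op\<close> is the pairing with a one-term tensor, indexed here by the unit
  type.\<close>

lemma norm_tensor_op_le:
  fixes u v :: "'i \<Rightarrow> 'a::complex_inner"
  assumes "finite I"
  shows "norm (tensor_op I u v h) \<le> hsnorm I u v * norm h"
proof (rule norm_le_if_cinner_le)
  fix y :: 'a assume y: "norm y \<le> 1"
  have "cmod (cinner (tensor_op I u v h) y) = cmod (hsip I u v {()} (\<lambda>_. y) (\<lambda>_. h))"
    using sum_cinner_tensor_op[where J = "{()}" and I = I and u = u and v = v
        and v' = "\<lambda>_. h" and u' = "\<lambda>_. y"] by simp
  also have "\<dots> \<le> hsnorm I u v * (norm y * norm h)"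
    using hsip_Cauchy_Schwarz[OF assms, of "{()}" u v "\<lambda>_. y" "\<lambda>_. h"] by (simp add: hsnorm_single)
  also have "\<dots> \<le> hsnorm I u v * (1 * norm h)"
    using y assms by (intro mult_left_mono mult_right_mono) auto
  finally show "cmod (cinner (tensor_op I u v h) y) \<le> hsnorm I u v * norm h" by simp
qed

lemma cadjoint_tensor_op: "cadjoint (tensor_op I u v) = tensor_op I v (u :: _ \<Rightarrow> 'a::chilbert_space)"
proof -
  have "cinner (cadjoint (tensor_op I u v) x) y = cinner (tensor_op I v u x) y" for x y
    unfolding cadjoint'[OF bounded_clinear_tensor_op]
    by (simp add: tensor_op_def cinner_sum_left cinner_sum_right cinner_simps cinner_commute[symmetric]
        mult.commute)
  then show ?thesis by (intro ext cinner_eqI)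
qed

text \<open>The unit ball of the Hilbert--Schmidt operators, described by duality so that no
  orthonormal basis is needed.\<close>

definition HS_ball :: "('a::complex_inner \<Rightarrow> 'a) set" where
  "HS_ball = {x. bounded_clinear x \<and> (\<forall>n u v. cmod (\<Sum>j<n. cinner (x (v j)) (u j)) \<le> hsnorm {..<n::nat} u v)}"

lemma HS_ballD:
  fixes n :: nat
  assumes "x \<in> HS_ball"
  shows "bounded_clinear x" "cmod (\<Sum>j<n. cinner (x (v j)) (u j)) \<le> hsnorm {..<n} u v"
  using assms by (auto simp: HS_ball_def)

lemma norm_HS_ball_le:
  fixes x :: "'a::complex_inner \<Rightarrow> 'a"
  assumes "x \<in> HS_ball"
  shows "norm (x h) \<le> norm h"
proof (rule norm_le_if_cinner_le)
  fix y :: 'a assume y: "norm y \<le> 1"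
  have "cmod (cinner (x h) y) \<le> norm y * norm h"
    using HS_ballD(2)[OF assms, of "\<lambda>_. h" "\<lambda>_. y" "Suc 0"] hsnorm_single[of "0::nat" "\<lambda>_. y" "\<lambda>_. h"]
    by (simp add: lessThan_Suc)
  also have "\<dots> \<le> 1 * norm h"
    using y by (intro mult_right_mono) auto
  finally show "cmod (cinner (x h) y) \<le> norm h" by simp
qed

lemma hsnorm_le_if_HS_ball:
  fixes u v :: "nat \<Rightarrow> 'a::complex_inner"
  assumes "\<And>x. x \<in> HS_ball \<Longrightarrow> cmod (\<Sum>j<n. cinner (x (v j)) (u j)) \<le> K" "0 \<le> K"
  shows "hsnorm {..<n} u v \<le> K"
proof (cases "hsnorm {..<n} u v = 0")
  case False
  define r where "r = hsnorm {..<n} u v"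
  have r: "r > 0" using False hsnorm_ge_0[OF finite_lessThan, of n u v] unfolding r_def by linarith
  \<comment> \<open>The extremal element of the ball is the normalized operator of the tensor
    itself: Cauchy-Schwarz puts it into \<open>HS_ball\<close>, and pairing it with the tensor
    returns \<open>r\<close>.\<close>
  define x where "x = (\<lambda>h. scaleC (complex_of_real (1 / r)) (tensor_op {..<n} u v h))"
  have "(\<Sum>j<m. cinner (x (v' j)) (u' j)) = complex_of_real (1 / r) * hsip {..<n} u v {..<m} u' v'"
    for m :: nat and u' v'
    by (simp add: x_def cinner_simps sum_cinner_tensor_op flip: sum_divide_distrib)
  note sm = this
  have "cmod (hsip {..<n} u v {..<m} u' v') / r \<le> hsnorm {..<m} u' v'" for m :: nat and u' v'
    using hsip_Cauchy_Schwarz[of "{..<n}" "{..<m}" u v u' v'] r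
    by (simp add: r_def divide_le_eq mult.commute)
  then have "x \<in> HS_ball"
    unfolding HS_ball_def mem_Collect_eq sm
    using r by (auto simp: norm_mult norm_divide x_def intro!: bounded_clinear_scale bounded_clinear_tensor_op)
  from assms(1)[OF this] have "cmod (complex_of_real (1 / r) * complex_of_real (r\<^sup>2)) \<le> K"
    unfolding sm by (simp add: hsip_self r_def)
  then show ?thesis
    using r unfolding of_real_mult[symmetric] norm_of_real by (simp add: r_def power2_eq_square)
qed (use assms in simp)

section \<open>Weak neighbourhoods of zero in the unit ball\<close>

definition wball :: "'a::complex_inner set \<Rightarrow> real \<Rightarrow> 'a set" where
  "wball Z \<delta> = {\<xi>. norm \<xi> \<le> 1 \<and> (\<forall>z\<in>Z. cmod (cinner \<xi> z) < \<delta>)}"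

text \<open>The neighbourhood filter of 0 for the weak topology on the unit ball, given by a
  concrete base so that the rules for limits and product filters apply. It is not punctured: 0 lies
  in every set of the base.\<close>

definition wnhds :: "'a::complex_inner filter" where
  "wnhds = (INF (Z, \<delta>)\<in>{Z. finite Z} \<times> {0<..}. principal (wball Z \<delta>))"

lemma eventually_wnhds:
  "eventually P wnhds \<longleftrightarrow> (\<exists>Z \<delta>. finite Z \<and> 0 < \<delta> \<and> (\<forall>\<xi>\<in>wball Z \<delta>. P \<xi>))"
proof -
  have "eventually P wnhds \<longleftrightarrow> (\<exists>b\<in>{Z::'a set. finite Z} \<times> {0<..}. eventually P
      (case b of (Z, \<delta>) \<Rightarrow> principal (wball Z \<delta>)))"
    unfolding wnhds_def
  proof (rule eventually_INF_base)
    show "{Z::'a set. finite Z} \<times> {0::real<..} \<noteq> {}"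
      by (auto intro!: exI[of _ "{}"] exI[of _ 1])
    fix p q :: "'a set \<times> real"
    assume "p \<in> {Z. finite Z} \<times> {0<..}" "q \<in> {Z. finite Z} \<times> {0<..}"
    then show "\<exists>x\<in>{Z. finite Z} \<times> {0<..}. (case x of (Z, \<delta>) \<Rightarrow> principal (wball Z \<delta>))
        \<le> inf (case p of (Z, \<delta>) \<Rightarrow> principal (wball Z \<delta>)) (case q of (Z, \<delta>) \<Rightarrow> principal (wball Z \<delta>))"
      by (intro bexI[of _ "(fst p \<union> fst q, min (snd p) (snd q))"])
         (auto simp: wball_def split: prod.splits)
  qed
  also have "\<dots> \<longleftrightarrow> (\<exists>Z \<delta>. finite Z \<and> 0 < \<delta> \<and> (\<forall>\<xi>\<in>wball Z \<delta>. P \<xi>))"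
    unfolding eventually_principal bex_simps by (simp add: eventually_principal Bex_def)
  finally show ?thesis .
qed

lemma eventually_wnhdsI:
  "finite Z \<Longrightarrow> 0 < \<delta> \<Longrightarrow> (\<And>\<xi>. \<xi> \<in> wball Z \<delta> \<Longrightarrow> P \<xi>) \<Longrightarrow> eventually P wnhds"
  unfolding eventually_wnhds by blast

lemma eventually_wnhds_norm_le: "eventually (\<lambda>\<xi>. norm \<xi> \<le> 1) wnhds"
  by (rule eventually_wnhdsI[of "{}" 1]) (auto simp: wball_def)

lemma zero_in_wball: "0 < \<delta> \<Longrightarrow> 0 \<in> wball Z \<delta>"
  by (simp add: wball_def)

lemma tendsto_wnhds_iff:
  "(f \<longlongrightarrow> (0::'b::real_normed_vector)) wnhds \<longleftrightarrow>
    (\<forall>\<epsilon>>0. \<exists>Z \<delta>. finite Z \<and> 0 < \<delta> \<and> (\<forall>\<xi>\<in>wball Z \<delta>. norm (f \<xi>) < \<epsilon>))"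
  by (simp add: tendsto_iff eventually_wnhds)

lemma eventually_wnhds_cinner: "0 < \<delta> \<Longrightarrow> eventually (\<lambda>\<xi>. cmod (cinner \<xi> z) < \<delta>) wnhds"
  by (rule eventually_wnhdsI[of "{z}" \<delta>]) (auto simp: wball_def)

lemma tendsto_cinner_wnhds: "((\<lambda>\<xi>. cinner \<xi> z) \<longlongrightarrow> 0) wnhds"
  by (simp add: tendsto_iff eventually_wnhds_cinner)

section \<open>Compact operators\<close>

lemma compact_op_finite_net:
  assumes "compact_op c" "0 < \<epsilon>"
  obtains Y where "finite Y" "\<And>\<xi>. norm \<xi> \<le> 1 \<Longrightarrow> \<exists>y\<in>Y. norm (c \<xi> - y) < \<epsilon>"
proof -
  from assms obtain Y where "finite Y" "closure (c ` cball 0 1) \<subseteq> (\<Union>y\<in>Y. ball y \<epsilon>)"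
    by (auto simp: compact_op_def compact_eq_totally_bounded)
  moreover have "c \<xi> \<in> closure (c ` cball 0 1)" if "norm \<xi> \<le> 1" for \<xi>
    using that closure_subset[of "c ` cball 0 1"] by auto
  ultimately have "\<exists>y\<in>Y. norm (c \<xi> - y) < \<epsilon>" if "norm \<xi> \<le> 1" for \<xi>
    using that by (fastforce simp: dist_norm norm_minus_commute)
  with \<open>finite Y\<close> show ?thesis by (rule that)
qed

text \<open>For \<open>y\<close> in a finite net of the image of the ball, |c xi|^2 is the sum of
  \<open>cinner \<xi> (cadjoint c y)\<close> and \<open>cinner (c \<xi>) (c \<xi> - y)\<close>.
  Hence finitely many test vectors \<open>cadjoint c y\<close> suffice.\<close>

lemma compact_op_tendsto_wnhds:
  fixes c :: "'a::chilbert_space \<Rightarrow> 'a"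
  assumes c: "compact_op c"
  shows "(c \<longlongrightarrow> 0) wnhds"
proof (rule tendstoI)
  have bc: "bounded_clinear c" using c by (simp add: compact_op_def)
  fix \<epsilon> :: real assume \<epsilon>: "0 < \<epsilon>"
  define K where "K = onorm c + 1"
  have K: "0 < K" using onorm_nonneg[OF bc] by (simp add: K_def)
  \<comment> \<open>With this radius the second summand, bounded by \<open>K\<close> times it, is at
    most half of \<open>\<epsilon>\<^sup>2\<close>; the 1 in \<open>K\<close> keeps the divisor
    positive.\<close>
  obtain Y where Y: "finite Y" "\<And>\<xi>. norm \<xi> \<le> 1 \<Longrightarrow> \<exists>y\<in>Y. norm (c \<xi> - y) < \<epsilon>\<^sup>2 / (2 * K)"
    using compact_op_finite_net[OF c] K \<epsilon> by (metis divide_pos_pos mult_pos_pos zero_less_numeral zero_less_power)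
  show "eventually (\<lambda>\<xi>. dist (c \<xi>) 0 < \<epsilon>) wnhds"
  proof (rule eventually_wnhdsI)
    show "finite (cadjoint c ` Y)" using Y by simp
    show "0 < \<epsilon>\<^sup>2 / 2" using \<epsilon> by simp
    fix \<xi> assume \<xi>: "\<xi> \<in> wball (cadjoint c ` Y) (\<epsilon>\<^sup>2 / 2)"
    then have n1: "norm \<xi> \<le> 1" by (simp add: wball_def)
    have ncK: "norm (c \<xi>) \<le> K"
      using norm_le_onorm[OF bc, of \<xi>] mult_left_mono[OF n1 onorm_nonneg[OF bc]] by (simp add: K_def)
    obtain y where y: "y \<in> Y" "norm (c \<xi> - y) < \<epsilon>\<^sup>2 / (2 * K)"
      using Y(2)[OF n1] by blast
    have "(norm (c \<xi>))\<^sup>2 = cmod (cinner (c \<xi>) (c \<xi>))"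
      by (simp add: cinner_self norm_power)
    also have "cinner (c \<xi>) (c \<xi>) = cinner \<xi> (cadjoint c y) + cinner (c \<xi>) (c \<xi> - y)"
      by (simp add: cinner_simps flip: cadjoint[OF bc])
    also have "cmod \<dots> \<le> cmod (cinner \<xi> (cadjoint c y)) + norm (c \<xi>) * norm (c \<xi> - y)"
      by (intro norm_triangle_le add_mono cinner_Cauchy_Schwarz order_refl)
    also have "\<dots> < \<epsilon>\<^sup>2 / 2 + K * (\<epsilon>\<^sup>2 / (2 * K))"
      using \<xi> y ncK K by (intro add_less_le_mono mult_mono) (auto simp: wball_def)
    also have "\<dots> = \<epsilon>\<^sup>2" using K by simp
    finally show "dist (c \<xi>) 0 < \<epsilon>"
      using \<epsilon> by (simp add: power_less_imp_less_base)
  qed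
qed

text \<open>The inner product of \<open>cadjoint c \<xi>\<close> with \<open>h\<close> in the ball
  is that of \<open>\<xi>\<close> with \<open>c h\<close>; replacing \<open>c h\<close> by a point
  of the net makes the estimate uniform in \<open>h\<close>. The net itself now serves as the set of
  test vectors.\<close>

lemma compact_op_cadjoint_tendsto_wnhds:
  fixes c :: "'a::chilbert_space \<Rightarrow> 'a"
  assumes c: "compact_op c"
  shows "(cadjoint c \<longlongrightarrow> 0) wnhds"
proof (rule tendstoI)
  have bc: "bounded_clinear c" using c by (simp add: compact_op_def)
  fix \<epsilon> :: real assume \<epsilon>: "0 < \<epsilon>"
  obtain Y where Y: "finite Y" "\<And>\<xi>. norm \<xi> \<le> 1 \<Longrightarrow> \<exists>y\<in>Y. norm (c \<xi> - y) < \<epsilon> / 3"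
    using compact_op_finite_net[OF c divide_pos_pos[OF \<epsilon> zero_less_numeral]] by blast
  show "eventually (\<lambda>\<xi>. dist (cadjoint c \<xi>) 0 < \<epsilon>) wnhds"
  proof (rule eventually_wnhdsI)
    show "finite Y" "0 < \<epsilon> / 3" using Y(1) \<epsilon> by auto
    fix \<xi> assume \<xi>: "\<xi> \<in> wball Y (\<epsilon> / 3)"
    have "norm (cadjoint c \<xi>) \<le> 2 * \<epsilon> / 3"
    proof (rule norm_le_if_cinner_le)
      fix h :: 'a assume "norm h \<le> 1"
      from Y(2)[OF this] obtain y where y: "y \<in> Y" "norm (c h - y) < \<epsilon> / 3" by blast
      have "cinner (cadjoint c \<xi>) h = cinner \<xi> y + cinner \<xi> (c h - y)"
        by (simp add: cinner_simps cadjoint'[OF bc])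
      also have "cmod \<dots> \<le> cmod (cinner \<xi> y) + norm \<xi> * norm (c h - y)"
        by (intro norm_triangle_le add_mono cinner_Cauchy_Schwarz order_refl)
      also have "\<dots> \<le> \<epsilon> / 3 + 1 * (\<epsilon> / 3)"
        using \<xi> y by (intro add_mono mult_mono) (auto simp: wball_def intro: less_imp_le)
      finally show "cmod (cinner (cadjoint c \<xi>) h) \<le> 2 * \<epsilon> / 3" by simp
    qed
    then show "dist (cadjoint c \<xi>) 0 < \<epsilon>" using \<epsilon> by simp
  qed
qed

text \<open>Weak total boundedness of the ball: each coordinate \<open>cinner \<xi> z\<close> ranges
  over a compact disc, and finitely many small discs per coordinate cut the ball into finitely many
  pieces.\<close>

lemma finite_cover_ball_wball:
  fixes Z :: "'a::complex_inner set"
  assumes "finite Z" "0 < \<delta>"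
  shows "\<exists>F. finite F \<and> cball 0 1 \<subseteq> \<Union>F \<and> (\<forall>A\<in>F. \<forall>\<xi>\<in>A. \<forall>\<xi>'\<in>A. \<forall>z\<in>Z. cmod (cinner (\<xi> - \<xi>') z) < \<delta>)"
  using assms(1)
proof (induction rule: finite_induct)
  case empty
  show ?case by (rule exI[of _ "{UNIV}"]) auto
next
  case (insert z Z)
  then obtain F where F: "finite F" "cball 0 1 \<subseteq> \<Union>F"
    "\<forall>A\<in>F. \<forall>\<xi>\<in>A. \<forall>\<xi>'\<in>A. \<forall>z\<in>Z. cmod (cinner (\<xi> - \<xi>') z) < \<delta>" by blast
  obtain W where W: "finite W" "cball (0::complex) (norm z) \<subseteq> (\<Union>w\<in>W. ball w (\<delta> / 2))"
    using compact_cball[of "0::complex" "norm z"] assms(2)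
    unfolding compact_eq_totally_bounded by (meson half_gt_zero)
  define G where "G = (\<lambda>(A, w). A \<inter> {\<xi>. cinner \<xi> z \<in> ball w (\<delta> / 2)}) ` (F \<times> W)"
  have "cball 0 1 \<subseteq> \<Union>G"
  proof
    fix \<xi> :: 'a assume \<xi>: "\<xi> \<in> cball 0 1"
    have "cmod (cinner \<xi> z) \<le> norm z"
      using cinner_Cauchy_Schwarz[of \<xi> z] mult_right_mono[of "norm \<xi>" 1 "norm z"] \<xi> by simp
    then have "cinner \<xi> z \<in> cball 0 (norm z)" by simp
    then obtain w where "w \<in> W" "cinner \<xi> z \<in> ball w (\<delta> / 2)" using W by blast
    moreover obtain A where "A \<in> F" "\<xi> \<in> A" using F(2) \<xi> by blast
    ultimately show "\<xi> \<in> \<Union>G" by (force simp: G_def)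
  qed
  moreover have "cmod (cinner (\<xi> - \<xi>') z) < \<delta>"
    if "cinner \<xi> z \<in> ball w (\<delta> / 2)" "cinner \<xi>' z \<in> ball w (\<delta> / 2)" for \<xi> \<xi>' w
    using that dist_triangle_half_r[of w "cinner \<xi> z" \<delta> "cinner \<xi>' z"] by (simp add: dist_norm cinner_simps)
  then have "\<forall>A\<in>G. \<forall>\<xi>\<in>A. \<forall>\<xi>'\<in>A. \<forall>z\<in>insert z Z. cmod (cinner (\<xi> - \<xi>') z) < \<delta>"
    using F(3) by (auto simp: G_def)
  moreover have "finite G" using F(1) W(1) by (simp add: G_def)
  ultimately show ?case by blast
qed

lemma compact_closure_if_totally_bounded:
  fixes S :: "'a::complete_space set"
  assumes "\<And>e. 0 < e \<Longrightarrow> \<exists>k. finite k \<and> S \<subseteq> (\<Union>x\<in>k. ball x e)"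
  shows "compact (closure S)"
  unfolding compact_eq_totally_bounded
proof (intro conjI allI impI)
  show "complete (closure S)" by (simp add: complete_eq_closed)
  fix e :: real assume "0 < e"
  then obtain k where k: "finite k" "S \<subseteq> (\<Union>x\<in>k. ball x (e / 2))"
    using assms[of "e / 2"] by auto
  have "S \<subseteq> (\<Union>x\<in>k. cball x (e / 2))"
    using k(2) ball_subset_cball by blast
  moreover have "closed (\<Union>x\<in>k. cball x (e / 2))"
    using k(1) by (intro closed_UN) auto
  ultimately have "closure S \<subseteq> (\<Union>x\<in>k. cball x (e / 2))"
    by (rule closure_minimal)
  also have "\<dots> \<subseteq> (\<Union>x\<in>k. ball x e)"
    using \<open>0 < e\<close> by force
  finally show "\<exists>k. finite k \<and> closure S \<subseteq> (\<Union>x\<in>k. ball x e)" using k(1) by blast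
qed

lemma compact_op_if_tendsto_wnhds:
  fixes c :: "'a::chilbert_space \<Rightarrow> 'a"
  assumes bc: "bounded_clinear c" and lim: "(c \<longlongrightarrow> 0) wnhds"
  shows "compact_op c"
  unfolding compact_op_def
proof (intro conjI bc compact_closure_if_totally_bounded)
  fix e :: real assume e: "0 < e"
  then obtain Z \<delta> where Z: "finite Z" "0 < \<delta>" "\<And>\<xi>. \<xi> \<in> wball Z \<delta> \<Longrightarrow> norm (c \<xi>) < e / 2"
    using lim unfolding tendsto_wnhds_iff by (meson half_gt_zero)
  obtain F where F: "finite F" "cball 0 1 \<subseteq> \<Union>F"
    "\<forall>A\<in>F. \<forall>\<xi>\<in>A. \<forall>\<xi>'\<in>A. \<forall>z\<in>Z. cmod (cinner (\<xi> - \<xi>') z) < \<delta>"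
    using finite_cover_ball_wball[OF Z(1,2)] by blast
  \<comment> \<open>A representative of each piece inside the ball; it is arbitrary on pieces that
    miss the ball.\<close>
  define p where "p A = (SOME \<xi>. \<xi> \<in> A \<inter> cball 0 1)" for A :: "'a set"
  have p: "p A \<in> A \<inter> cball 0 1" if "\<xi> \<in> A \<inter> cball 0 1" for A \<xi>
    unfolding p_def using that by (rule someI)
  have "c ` cball 0 1 \<subseteq> (\<Union>x\<in>(c \<circ> p) ` F. ball x e)"
  proof
    fix y assume "y \<in> c ` cball 0 1"
    then obtain \<xi> where \<xi>: "\<xi> \<in> cball 0 1" "y = c \<xi>" by blast
    then obtain A where A: "A \<in> F" "\<xi> \<in> A" using F(2) by blast
    have pA: "p A \<in> A" "norm (p A) \<le> 1" using p[of \<xi> A] A \<xi> by auto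
    \<comment> \<open>The difference of two points of the ball has norm at most 2. Halving brings it
      back into \<open>wball\<close>, which accounts for \<open>e / 2\<close> above.\<close>
    define h where "h = scaleC (1/2) (p A - \<xi>)"
    have "norm (p A - \<xi>) \<le> 1 + 1"
      using pA \<xi> norm_triangle_ineq4[of "p A" \<xi>] by simp
    moreover have "cmod (cinner (p A - \<xi>) z) < 2 * \<delta>" if "z \<in> Z" for z
    proof -
      have "cmod (cinner (p A - \<xi>) z) < \<delta>" using F(3) A pA(1) that by blast
      then show ?thesis using Z(2) by linarith
    qed
    ultimately have "h \<in> wball Z \<delta>"
      by (auto simp: wball_def h_def norm_scaleC cinner_simps norm_mult mult.commute)
    then have "norm (c h) < e / 2" by (rule Z(3))
    moreover have "c h = scaleC (1/2) (c (p A) - c \<xi>)"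
      by (simp add: h_def bounded_clinear_scaleC[OF bc] bounded_clinear_diff[OF bc])
    ultimately have "dist (c (p A)) y < e"
      by (simp add: norm_scaleC dist_norm \<xi>(2))
    then show "y \<in> (\<Union>x\<in>(c \<circ> p) ` F. ball x e)"
      using A(1) by auto
  qed
  then show "\<exists>k. finite k \<and> c ` cball 0 1 \<subseteq> (\<Union>x\<in>k. ball x e)"
    using F(1) by blast
qed

text \<open>In this form sums, scalings and left multiples of compact operators reduce to limit
  rules, and compactness of the adjoint is immediate from
  \<open>compact_op_cadjoint_tendsto_wnhds\<close>.\<close>

lemma compact_op_iff_tendsto_wnhds:
  fixes c :: "'a::chilbert_space \<Rightarrow> 'a"
  shows "compact_op c \<longleftrightarrow> bounded_clinear c \<and> (c \<longlongrightarrow> 0) wnhds"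
  using compact_op_if_tendsto_wnhds compact_op_tendsto_wnhds by (auto simp: compact_op_def)

lemma compact_op_bounded_clinear: "compact_op c \<Longrightarrow> bounded_clinear c"
  by (simp add: compact_op_def)

lemma compact_op_cadjoint:
  fixes c :: "'a::chilbert_space \<Rightarrow> 'a"
  assumes "compact_op c"
  shows "compact_op (cadjoint c)"
  using assms by (simp add: compact_op_iff_tendsto_wnhds bounded_clinear_cadjoint
      compact_op_cadjoint_tendsto_wnhds)

lemma tendsto_bounded_clinear:
  assumes f: "bounded_clinear f" and g: "(g \<longlongrightarrow> 0) F"
  shows "((\<lambda>x. f (g x)) \<longlongrightarrow> 0) F"
  using bounded_linear.tendsto[OF bounded_clinear_imp_bounded_linear[OF f] g]
  by (simp add: bounded_clinear_zero f)

lemma tendsto_scaleC_zero: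
  assumes "(g \<longlongrightarrow> (0::'a::complex_inner)) F"
  shows "((\<lambda>x. scaleC c (g x)) \<longlongrightarrow> 0) F"
  by (rule tendsto_bounded_clinear[OF bounded_clinear_scale assms])
     (rule bounded_clinearI[where K = 1], auto)

lemma compact_op_compose_left:
  fixes c f :: "'a::chilbert_space \<Rightarrow> 'a"
  assumes "compact_op c" "bounded_clinear f"
  shows "compact_op (\<lambda>h. f (c h))"
  using assms by (simp add: compact_op_iff_tendsto_wnhds bounded_clinear_compose tendsto_bounded_clinear)

lemma cadjoint_compose:
  fixes f g :: "'a::chilbert_space \<Rightarrow> 'a"
  assumes f: "bounded_clinear f" and g: "bounded_clinear g"
  shows "cadjoint (\<lambda>h. f (g h)) = (\<lambda>h. cadjoint g (cadjoint f h))"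
proof
  fix x
  show "cadjoint (\<lambda>h. f (g h)) x = cadjoint g (cadjoint f x)"
    by (rule cinner_eqI)
       (simp add: cadjoint'[OF bounded_clinear_compose[OF f g]] cadjoint'[OF f] cadjoint'[OF g])
qed

text \<open>Adjoints reverse products, so this is \<open>compact_op_compose_left\<close> for the
  adjoints, read back by taking adjoints once more.\<close>

lemma compact_op_compose_right:
  fixes c f :: "'a::chilbert_space \<Rightarrow> 'a"
  assumes c: "compact_op c" and f: "bounded_clinear f"
  shows "compact_op (\<lambda>h. c (f h))"
proof -
  have bc: "bounded_clinear c" using c by (rule compact_op_bounded_clinear)
  have "compact_op (\<lambda>h. cadjoint f (cadjoint c h))"
    by (rule compact_op_compose_left[OF compact_op_cadjoint[OF c] bounded_clinear_cadjoint[OF f]])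
  then have "compact_op (cadjoint (\<lambda>h. c (f h)))"
    by (simp add: cadjoint_compose[OF bc f])
  from compact_op_cadjoint[OF this] show ?thesis
    unfolding cadjoint_cadjoint[OF bounded_clinear_compose[OF bc f]] .
qed

lemma compact_op_sum:
  fixes c :: "'i \<Rightarrow> 'a::chilbert_space \<Rightarrow> 'a"
  assumes "\<And>i. i \<in> I \<Longrightarrow> compact_op (c i)"
  shows "compact_op (\<lambda>h. \<Sum>i\<in>I. c i h)"
  using assms unfolding compact_op_iff_tendsto_wnhds
  by (intro conjI bounded_clinear_setsum tendsto_null_sum) blast+

lemma compact_op_add:
  fixes c d :: "'a::chilbert_space \<Rightarrow> 'a"
  assumes "compact_op c" "compact_op d"
  shows "compact_op (\<lambda>h. c h + d h)"
  using assms unfolding compact_op_iff_tendsto_wnhds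
  by (intro conjI bounded_clinear_plus tendsto_add_zero) blast+

lemma compact_op_scaleC:
  fixes c :: "'a::chilbert_space \<Rightarrow> 'a"
  assumes "compact_op c"
  shows "compact_op (\<lambda>h. scaleC s (c h))"
  using assms unfolding compact_op_iff_tendsto_wnhds
  by (intro conjI bounded_clinear_scale tendsto_scaleC_zero) blast+

lemma compact_op_tensor_op:
  fixes u v :: "'i \<Rightarrow> 'a::chilbert_space"
  shows "compact_op (tensor_op I u v)"
  unfolding compact_op_iff_tendsto_wnhds
proof (intro conjI bounded_clinear_tensor_op)
  have "((\<lambda>\<xi>. scaleC (cinner \<xi> (v i)) (u i)) \<longlongrightarrow> 0) wnhds" for i
  proof (rule tendsto_norm_zero_cancel)
    show "((\<lambda>\<xi>. norm (scaleC (cinner \<xi> (v i)) (u i))) \<longlongrightarrow> 0) wnhds"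
      using tendsto_mult_left_zero[OF tendsto_norm_zero[OF tendsto_cinner_wnhds], of "v i" "norm (u i)"]
      by (simp add: norm_scaleC)
  qed
  then show "(tensor_op I u v \<longlongrightarrow> 0) wnhds"
    unfolding tensor_op_def by (intro tendsto_null_sum)
qed

subsection \<open>Orthonormal families and finite rank approximation\<close>

definition orthonormal_set :: "'a::complex_inner set \<Rightarrow> bool" where
  "orthonormal_set E \<longleftrightarrow> finite E \<and> (\<forall>e\<in>E. norm e = 1) \<and> (\<forall>e\<in>E. \<forall>f\<in>E. e \<noteq> f \<longrightarrow> cinner e f = 0)"

abbreviation proj :: "'a::complex_inner set \<Rightarrow> 'a \<Rightarrow> 'a" where
  "proj E \<equiv> tensor_op E (\<lambda>e. e) (\<lambda>e. e)"

lemma cinner_proj: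
  assumes "orthonormal_set E" "e \<in> E"
  shows "cinner (proj E h) e = cinner h e"
proof -
  have "cinner (proj E h) e = (\<Sum>f\<in>E. cinner h f * cinner f e)"
    by (simp add: tensor_op_def cinner_sum_left cinner_simps)
  also have "\<dots> = (\<Sum>f\<in>E. if f = e then cinner h e else 0)"
    using assms by (intro sum.cong) (auto simp: orthonormal_set_def cinner_self)
  finally show ?thesis using assms by (simp add: orthonormal_set_def)
qed

lemma norm_proj_le:
  assumes "orthonormal_set E"
  shows "norm (proj E h) \<le> norm h"
proof (cases "proj E h = 0")
  case False
  have "cinner (proj E h) (proj E h) = cinner h (proj E h)"
  proof -
    have "cinner g (proj E h) = (\<Sum>e\<in>E. cnj (cinner h e) * cinner g e)" for g
      by (simp add: tensor_op_def cinner_sum_right cinner_simps)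
    then show ?thesis by (simp add: cinner_proj[OF assms])
  qed
  moreover have "(norm (proj E h))\<^sup>2 = cmod (cinner (proj E h) (proj E h))"
    by (simp add: cinner_self norm_power)
  ultimately have "(norm (proj E h))\<^sup>2 \<le> norm h * norm (proj E h)"
    using cinner_Cauchy_Schwarz[of h "proj E h"] by simp
  then show ?thesis using False by (simp add: power2_eq_square)
qed simp

text \<open>Gram-Schmidt, one vector at a time; a vector already in the span (\<open>w = 0\<close>)
  adds nothing.\<close>

lemma orthonormal_set_spanning:
  fixes Y :: "'a::complex_inner set"
  assumes "finite Y"
  shows "\<exists>E. orthonormal_set E \<and> (\<forall>y\<in>Y. proj E y = y)"
  using assms
proof (induction rule: finite_induct)
  case empty
  show ?case by (rule exI[of _ "{}"]) (simp add: orthonormal_set_def)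
next
  case (insert y Y)
  then obtain E where E: "orthonormal_set E" "\<forall>y\<in>Y. proj E y = y" by blast
  define w where "w = y - proj E y"
  have orth: "cinner w e = 0" if "e \<in> E" for e
    by (simp add: w_def cinner_simps cinner_proj[OF E(1) that])
  show ?case
  proof (cases "w = 0")
    case True
    then show ?thesis using E by (intro exI[of _ E]) (auto simp: w_def)
  next
    case False
    define f where "f = scaleC (complex_of_real (1 / norm w)) w"
    have nf: "norm f = 1" using False by (simp add: f_def norm_scaleC norm_divide)
    have fo: "cinner f e = 0" "cinner e f = 0" if "e \<in> E" for e
      using orth[OF that] cinner_commute[of e f] by (auto simp: f_def cinner_simps)
    have fE: "f \<notin> E"
      using fo(1)[of f] nf by (auto simp: cinner_self)
    have fin: "finite E" using E by (simp add: orthonormal_set_def)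
    have P: "proj (insert f E) h = scaleC (cinner h f) f + proj E h" for h
      using fin fE by (simp add: tensor_op_def)
    have on: "orthonormal_set (insert f E)"
      using E nf fo fin by (auto simp: orthonormal_set_def)
    have "cinner (proj E h) f = 0" for h
      using fo by (simp add: tensor_op_def cinner_sum_left cinner_simps)
    note Pf = this
    have "cinner y f = cinner w f"
      by (simp add: w_def cinner_simps Pf)
    also have "\<dots> = complex_of_real (norm w)"
      by (simp add: f_def cinner_simps cinner_self power2_eq_square)
    finally have "scaleC (cinner y f) f = w"
      using False by (simp add: f_def scaleC_scaleC scaleC_one)
    then have "proj (insert f E) y = y"
      by (simp add: P w_def)
    moreover have "proj (insert f E) z = z" if "z \<in> Y" for z
      using E(2) that Pf[of z] by (simp add: P)
    ultimately show ?thesis using on by blast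
  qed
qed

text \<open>Let \<open>proj E\<close> fix a net of mesh \<epsilon>/2. For \<open>y\<close> in the
  net, \<open>c h - proj E (c h)\<close> equals \<open>(c h - y) - proj E (c h - y)\<close>, and
  each part is at most \<epsilon>/2 because projections do not increase norms.\<close>

lemma compact_op_proj_approx:
  fixes c :: "'a::chilbert_space \<Rightarrow> 'a"
  assumes c: "compact_op c" and \<epsilon>: "0 < \<epsilon>"
  obtains E where "orthonormal_set E" "\<And>h. norm (c h - proj E (c h)) \<le> \<epsilon> * norm h"
proof -
  have bc: "bounded_clinear c" using c by (rule compact_op_bounded_clinear)
  obtain Y where Y: "finite Y" "\<And>\<xi>. norm \<xi> \<le> 1 \<Longrightarrow> \<exists>y\<in>Y. norm (c \<xi> - y) < \<epsilon> / 2"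
    using compact_op_finite_net[OF c divide_pos_pos[OF \<epsilon> zero_less_numeral]] by blast
  obtain E where E: "orthonormal_set E" "\<forall>y\<in>Y. proj E y = y"
    using orthonormal_set_spanning[OF Y(1)] by blast
  have bP: "bounded_clinear (\<lambda>h. c h - proj E (c h))"
    by (rule bounded_clinear_sub[OF bc bounded_clinear_compose[OF bounded_clinear_tensor_op bc]])
  have "onorm (\<lambda>h. c h - proj E (c h)) \<le> \<epsilon>"
  proof (rule onorm_le[OF _ bP])
    fix h :: 'a assume "norm h \<le> 1"
    then obtain y where y: "y \<in> Y" "norm (c h - y) < \<epsilon> / 2" using Y by blast
    have "c h - proj E (c h) = (c h - y) - proj E (c h - y)"
      using E(2) y(1) by (simp add: bounded_clinear_diff[OF bounded_clinear_tensor_op])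
    then have "norm (c h - proj E (c h)) \<le> norm (c h - y) + norm (proj E (c h - y))"
      using norm_triangle_ineq4 by metis
    then show "norm (c h - proj E (c h)) \<le> \<epsilon>"
      using norm_proj_le[OF E(1), of "c h - y"] y(2) by linarith
  qed
  then have "norm (c h - proj E (c h)) \<le> \<epsilon> * norm h" for h
    using norm_le_onorm[OF bP, of h] by (meson mult_right_mono norm_ge_zero order_trans)
  with E(1) show ?thesis by (rule that)
qed

section \<open>Positive semidefinite matrices\<close>

definition mv :: "nat \<Rightarrow> (nat \<Rightarrow> nat \<Rightarrow> complex) \<Rightarrow> (nat \<Rightarrow> complex) \<Rightarrow> nat \<Rightarrow> complex" where
  "mv l A v = (\<lambda>i. if i < l then \<Sum>j<l. A i j * v j else 0)"

definition vip :: "nat \<Rightarrow> (nat \<Rightarrow> complex) \<Rightarrow> (nat \<Rightarrow> complex) \<Rightarrow> complex" where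
  "vip l u v = (\<Sum>i<l. u i * cnj (v i))"

definition vnorm :: "nat \<Rightarrow> (nat \<Rightarrow> complex) \<Rightarrow> real" where
  "vnorm l v = L2_set (\<lambda>i. cmod (v i)) {..<l}"

lemma vnorm_nonneg [simp]: "0 \<le> vnorm l v"
  by (simp add: vnorm_def L2_set_nonneg)

lemma vip_self: "vip l v v = complex_of_real ((vnorm l v)\<^sup>2)"
  by (simp add: vip_def vnorm_def L2_set_def sum_nonneg complex_norm_square del: of_real_power)

lemma vnorm_triangle: "vnorm l (\<lambda>i. u i + v i) \<le> vnorm l u + vnorm l v"
proof -
  have "vnorm l (\<lambda>i. u i + v i) \<le> L2_set (\<lambda>i. cmod (u i) + cmod (v i)) {..<l}"
    unfolding vnorm_def by (intro L2_set_mono norm_triangle_ineq norm_ge_zero)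
  also have "\<dots> \<le> vnorm l u + vnorm l v"
    unfolding vnorm_def by (rule L2_set_triangle_ineq)
  finally show ?thesis .
qed

lemma vnorm_scale: "vnorm l (\<lambda>i. c * v i) = cmod c * vnorm l v"
  by (simp add: vnorm_def L2_set_right_distrib norm_mult)

lemma vip_Cauchy_Schwarz: "cmod (vip l u v) \<le> vnorm l u * vnorm l v"
proof -
  have "cmod (vip l u v) \<le> (\<Sum>i<l. \<bar>cmod (u i)\<bar> * \<bar>cmod (v i)\<bar>)"
    unfolding vip_def by (rule order_trans[OF norm_sum]) (simp add: norm_mult)
  also have "\<dots> \<le> vnorm l u * vnorm l v"
    unfolding vnorm_def by (rule L2_set_mult_ineq)
  finally show ?thesis .
qed

lemma vip_commute: "vip l v u = cnj (vip l u v)"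
  by (simp add: vip_def mult.commute)

lemma vip_add_scale: "vip l (\<lambda>i. u i + c * w i) v = vip l u v + c * vip l w v"
  by (simp add: vip_def algebra_simps sum.distrib sum_distrib_left)

lemma vip_add_scale_right: "vip l v (\<lambda>i. u i + c * w i) = vip l v u + cnj c * vip l v w"
  by (simp add: vip_def algebra_simps sum.distrib sum_distrib_left)

lemma mv_add_scale: "mv l A (\<lambda>i. u i + c * w i) = (\<lambda>i. mv l A u i + c * mv l A w i)"
  by (auto simp: mv_def algebra_simps sum.distrib sum_distrib_left)

lemma mv_mmult: "mv l (mmult l A B) v = mv l A (mv l B v)"
proof
  fix i
  show "mv l (mmult l A B) v i = mv l A (mv l B v) i"
  proof (cases "i < l")
    case True
    then have "mv l (mmult l A B) v i = (\<Sum>j<l. \<Sum>k<l. A i k * B k j * v j)"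
      by (simp add: mv_def mmult_def sum_distrib_right)
    also have "\<dots> = (\<Sum>k<l. \<Sum>j<l. A i k * B k j * v j)" by (rule sum.swap)
    finally show ?thesis using True by (simp add: mv_def sum_distrib_left mult.assoc)
  qed (simp add: mv_def)
qed

lemma mv_unit: "j < l \<Longrightarrow> mv l A (\<lambda>k. if k = j then 1 else 0) i = (if i < l then A i j else 0)"
  by (simp add: mv_def if_distrib[of "\<lambda>x. _ * x"] cong: if_cong)

lemma vnorm_unit: "j < l \<Longrightarrow> vnorm l (\<lambda>k. if k = j then 1 else 0) = 1"
  by (simp add: vnorm_def L2_set_def if_distrib[of "\<lambda>x. (cmod x)\<^sup>2"] cong: if_cong)

lemma norm_le_vnorm: "i < l \<Longrightarrow> cmod (v i) \<le> vnorm l v"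
  unfolding vnorm_def using member_le_L2_set[of "{..<l}" i "\<lambda>i. cmod (v i)"] by simp

lemma vip_mv: "vip l (mv l A u) v = (\<Sum>i<l. \<Sum>j<l. cnj (v i) * A i j * u j)"
  unfolding vip_def by (intro sum.cong) (auto simp: mv_def sum_distrib_left mult_ac)

definition mherm :: "nat \<Rightarrow> (nat \<Rightarrow> nat \<Rightarrow> complex) \<Rightarrow> bool" where
  "mherm l A \<longleftrightarrow> (\<forall>i<l. \<forall>j<l. A j i = cnj (A i j))"

lemma mpsd_iff: "mpsd l A \<longleftrightarrow> mherm l A \<and> (\<forall>v. 0 \<le> Re (vip l (mv l A v) v))"
  by (simp add: mpsd_def mherm_def vip_mv)

lemma mherm_cnj: "mherm l A \<Longrightarrow> i < l \<Longrightarrow> j < l \<Longrightarrow> cnj (A i j) = A j i"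
  unfolding mherm_def by metis

lemma vip_mv_herm:
  assumes "mherm l A"
  shows "vip l (mv l A u) v = vip l u (mv l A v)"
proof -
  have "vip l u (mv l A v) = (\<Sum>i<l. \<Sum>j<l. u i * (cnj (A i j) * cnj (v j)))"
    by (simp add: vip_def mv_def sum_distrib_left)
  also have "\<dots> = (\<Sum>i<l. \<Sum>j<l. cnj (v j) * A j i * u i)"
    by (intro sum.cong) (auto simp: mherm_cnj[OF assms] mult_ac)
  also have "\<dots> = (\<Sum>j<l. \<Sum>i<l. cnj (v j) * A j i * u i)" by (rule sum.swap)
  finally show ?thesis by (simp add: vip_mv)
qed

text \<open>Expand the nonnegative value of the form of \<open>A\<close> at \<open>u\<close> plus
  \<open>s\<close> times \<open>v\<close>, where the phase in \<open>s\<close> makes the mixed terms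
  real.\<close>

lemma mpsd_Cauchy_Schwarz:
  assumes A: "mpsd l A"
  shows "cmod (vip l (mv l A u) v) \<le> sqrt (Re (vip l (mv l A u) u)) * sqrt (Re (vip l (mv l A v) v))"
proof (rule abs_le_if_quadratic_nonneg)
  fix r :: real
  define h where "h = vip l (mv l A u) v"
  obtain c where c: "cnj c * h = complex_of_real (cmod h)" "cmod c = 1"
    by (rule complex_phase)
  define s where "s = complex_of_real (- r) * c"
  have pos: "0 \<le> Re (vip l (mv l A w) w)" for w using A by (simp add: mpsd_iff)
  have vu: "vip l (mv l A v) u = cnj h"
    unfolding h_def vip_commute[of l v "mv l A u", symmetric]
    by (rule vip_mv_herm) (use A in \<open>simp add: mpsd_iff\<close>)
  have s1: "cnj s * h = complex_of_real (- r * cmod h)"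
    using c by (simp add: s_def mult.assoc)
  have s2: "s * cnj h = complex_of_real (- r * cmod h)"
    using arg_cong[OF c(1), of cnj] by (simp add: s_def mult.assoc)
  have s3: "s * cnj s = complex_of_real (r\<^sup>2)"
    unfolding complex_norm_square[symmetric] by (simp add: s_def norm_mult c)
  have "vip l (mv l A (\<lambda>i. u i + s * v i)) (\<lambda>i. u i + s * v i)
      = vip l (mv l A u) u + cnj s * h + s * cnj h + (s * cnj s) * vip l (mv l A v) v"
    by (simp add: mv_add_scale vip_add_scale vip_add_scale_right h_def[symmetric] vu algebra_simps)
  then have "Re (vip l (mv l A (\<lambda>i. u i + s * v i)) (\<lambda>i. u i + s * v i))
      = Re (vip l (mv l A u) u) - 2 * r * cmod h + r\<^sup>2 * Re (vip l (mv l A v) v)"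
    unfolding s1 s2 s3 by simp
  then show "0 \<le> (sqrt (Re (vip l (mv l A u) u)))\<^sup>2 - 2 * r * cmod (vip l (mv l A u) v)
       + r\<^sup>2 * (sqrt (Re (vip l (mv l A v) v)))\<^sup>2"
    using pos[of "\<lambda>i. u i + s * v i"] by (simp add: real_sqrt_pow2[OF pos] h_def)
qed (use A in \<open>simp_all add: mpsd_iff\<close>)

text \<open>An upper bound for the operator norm on C^l. Such bounds add and multiply exactly as the
  scalar majorant of the square root iteration does.\<close>

definition mbound :: "nat \<Rightarrow> (nat \<Rightarrow> nat \<Rightarrow> complex) \<Rightarrow> real \<Rightarrow> bool" where
  "mbound l A r \<longleftrightarrow> (\<forall>v. vnorm l (mv l A v) \<le> r * vnorm l v)"

lemma mbound_add:
  assumes "mbound l A r" "mbound l B s"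
  shows "mbound l (\<lambda>i j. A i j + B i j) (r + s)"
  unfolding mbound_def
proof
  fix v
  have "mv l (\<lambda>i j. A i j + B i j) v = (\<lambda>i. mv l A v i + mv l B v i)"
    by (auto simp: mv_def algebra_simps sum.distrib)
  then have "vnorm l (mv l (\<lambda>i j. A i j + B i j) v) \<le> vnorm l (mv l A v) + vnorm l (mv l B v)"
    by (simp add: vnorm_triangle)
  also have "\<dots> \<le> (r + s) * vnorm l v"
    using assms by (simp add: mbound_def algebra_simps add_mono)
  finally show "vnorm l (mv l (\<lambda>i j. A i j + B i j) v) \<le> (r + s) * vnorm l v" .
qed

lemma mbound_scale:
  assumes "mbound l A r"
  shows "mbound l (\<lambda>i j. c * A i j) (cmod c * r)"
proof -
  have "mv l (\<lambda>i j. c * A i j) v = (\<lambda>i. c * mv l A v i)" for v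
    by (auto simp: mv_def algebra_simps sum_distrib_left)
  then show ?thesis
    using assms by (auto simp: mbound_def vnorm_scale mult.assoc intro!: mult_left_mono)
qed

lemma mbound_mmult:
  assumes "mbound l A r" "mbound l B s" "0 \<le> r"
  shows "mbound l (mmult l A B) (r * s)"
  unfolding mbound_def
proof
  fix v
  have "vnorm l (mv l (mmult l A B) v) \<le> r * vnorm l (mv l B v)"
    using assms(1) by (simp add: mv_mmult mbound_def)
  also have "\<dots> \<le> r * (s * vnorm l v)"
    using assms by (intro mult_left_mono) (auto simp: mbound_def)
  finally show "vnorm l (mv l (mmult l A B) v) \<le> r * s * vnorm l v" by (simp add: mult.assoc)
qed

lemma mbound_entry:
  assumes "mbound l A r" "i < l" "j < l"
  shows "cmod (A i j) \<le> r"
proof -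
  have "cmod (A i j) \<le> vnorm l (mv l A (\<lambda>k. if k = j then 1 else 0))"
    using norm_le_vnorm[OF assms(2), of "mv l A (\<lambda>k. if k = j then 1 else 0)"] assms
    by (simp add: mv_unit)
  also have "\<dots> \<le> r * vnorm l (\<lambda>k. if k = j then 1 else 0)"
    using assms(1) unfolding mbound_def by blast
  finally show ?thesis using assms(3) by (simp add: vnorm_unit)
qed

lemma mbound_sum_entries: "mbound l A (\<Sum>i<l. \<Sum>j<l. cmod (A i j))"
  unfolding mbound_def
proof
  fix v
  have "vnorm l (mv l A v) \<le> (\<Sum>i<l. cmod (mv l A v i))"
    unfolding vnorm_def by (rule L2_set_le_sum) simp
  also have "\<dots> \<le> (\<Sum>i<l. \<Sum>j<l. cmod (A i j) * vnorm l v)"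
  proof (rule sum_mono)
    fix i assume "i \<in> {..<l}"
    then have "cmod (mv l A v i) \<le> (\<Sum>j<l. cmod (A i j * v j))"
      by (simp add: mv_def norm_sum)
    also have "\<dots> \<le> (\<Sum>j<l. cmod (A i j) * vnorm l v)"
      by (intro sum_mono) (auto simp: norm_mult intro!: mult_left_mono norm_le_vnorm)
    finally show "cmod (mv l A v i) \<le> (\<Sum>j<l. cmod (A i j) * vnorm l v)" .
  qed
  finally show "vnorm l (mv l A v) \<le> (\<Sum>i<l. \<Sum>j<l. cmod (A i j)) * vnorm l v"
    by (simp add: sum_distrib_right)
qed

definition mone :: "nat \<Rightarrow> nat \<Rightarrow> nat \<Rightarrow> complex" where
  "mone l = (\<lambda>i j. if i < l \<and> i = j then 1 else 0)"

lemma mv_mone_minus: "mv l (\<lambda>i j. mone l i j - A i j) v = (\<lambda>i. mv l (mone l) v i + (-1) * mv l A v i)"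
  by (auto simp: mv_def algebra_simps sum_subtractf)

lemma mv_mone: "i < l \<Longrightarrow> mv l (mone l) v i = v i"
proof -
  assume "i < l"
  moreover have "(\<Sum>j<l. mone l i j * v j) = (\<Sum>j<l. if j = i then v j else 0)"
    using \<open>i < l\<close> by (intro sum.cong) (auto simp: mone_def)
  ultimately show ?thesis by (simp add: mv_def)
qed

lemma vip_mv_mone: "vip l (mv l (mone l) v) w = vip l v w"
  by (simp add: vip_def mv_mone)

lemma vip_mv_mone_right: "vip l w (mv l (mone l) v) = vip l w v"
  by (simp add: vip_def mv_mone)

text \<open>From 0 <= A <= 1 one gets A^2 <= A, that is \<open>n\<^sup>2 \<le> q\<close>, by
  Cauchy-Schwarz for the form of \<open>A\<close> at \<open>v\<close> and its image. Then |(1 - A)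
  v|^2 = |v|^2 - 2 q + n^2 <= |v|^2.\<close>

lemma mbound_mone_minus:
  assumes A: "mpsd l A" "mbound l A 1"
  shows "mbound l (\<lambda>i j. mone l i j - A i j) 1"
  unfolding mbound_def
proof
  fix v
  define q where "q = Re (vip l (mv l A v) v)"
  define n where "n = vnorm l (mv l A v)"
  have q0: "0 \<le> q" using A by (simp add: mpsd_iff q_def)
  have "n\<^sup>2 \<le> q"
  proof (cases "n = 0")
    case False
    have "n\<^sup>2 = cmod (vip l (mv l A v) (mv l A v))"
      by (simp add: vip_self n_def norm_power)
    also have "\<dots> \<le> sqrt q * sqrt (Re (vip l (mv l A (mv l A v)) (mv l A v)))"
      unfolding q_def by (rule mpsd_Cauchy_Schwarz[OF A(1)])
    also have "\<dots> \<le> sqrt q * sqrt (n * n)"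
    proof (intro mult_left_mono real_sqrt_le_mono)
      have "Re (vip l (mv l A (mv l A v)) (mv l A v)) \<le> vnorm l (mv l A (mv l A v)) * n"
        unfolding n_def by (rule order_trans[OF complex_Re_le_cmod vip_Cauchy_Schwarz])
      also have "\<dots> \<le> n * n"
        using A(2) by (intro mult_right_mono) (auto simp: mbound_def n_def)
      finally show "Re (vip l (mv l A (mv l A v)) (mv l A v)) \<le> n * n" .
    qed (use q0 in simp)
    also have "\<dots> = sqrt q * n" by (simp add: n_def)
    finally have "n * n \<le> sqrt q * n"
      by (simp add: power2_eq_square)
    moreover have "0 < n"
      using False vnorm_nonneg[of l "mv l A v"] unfolding n_def by linarith
    ultimately have "n \<le> sqrt q"
      by (rule mult_right_le_imp_le)
    then have "n\<^sup>2 \<le> (sqrt q)\<^sup>2" by (intro power_mono) (simp_all add: n_def)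
    then show ?thesis using q0 by simp
  qed (use q0 in simp)
  define w where "w = mv l (\<lambda>i j. mone l i j - A i j) v"
  have "vip l w w = vip l v v - vip l (mv l A v) v - cnj (vip l (mv l A v) v) + vip l (mv l A v) (mv l A v)"
    unfolding w_def mv_mone_minus vip_add_scale vip_add_scale_right vip_mv_mone vip_mv_mone_right
    by (simp add: vip_commute[of l v "mv l A v"])
  then have "Re (complex_of_real ((vnorm l w)\<^sup>2)) = (vnorm l v)\<^sup>2 - 2 * q + n\<^sup>2"
    unfolding vip_self[of l w] vip_self[of l v] vip_self[of l "mv l A v"] q_def n_def by simp
  then have "(vnorm l w)\<^sup>2 \<le> (vnorm l v)\<^sup>2"
    using \<open>n\<^sup>2 \<le> q\<close> q0 by simp
  then show "vnorm l (mv l (\<lambda>i j. mone l i j - A i j) v) \<le> 1 * vnorm l v"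
    unfolding w_def mult_1 by (rule power2_le_imp_le) simp
qed

lemma mherm_mmult_self:
  assumes "mherm l A"
  shows "mherm l (mmult l A A)"
  unfolding mherm_def
proof (intro allI impI)
  fix i j assume ij: "i < l" "j < l"
  then have "cnj (mmult l A A i j) = (\<Sum>k<l. cnj (A i k) * cnj (A k j))"
    by (simp add: mmult_def)
  also have "\<dots> = (\<Sum>k<l. A j k * A k i)"
    using ij by (intro sum.cong) (auto simp: mherm_cnj[OF assms])
  finally show "mmult l A A j i = cnj (mmult l A A i j)" using ij by (simp add: mmult_def)
qed

subsection \<open>The square root\<close>

text \<open>With \<open>B = 1 - A\<close>, the iteration \<open>Y \<mapsto> (B + Y\<^sup>2) / 2\<close> converges to \<open>1 - sqrt A\<close>; its increments
  are dominated in norm by those of the scalar iteration for \<open>B = 1\<close>.\<close>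

primrec sqrt_iter :: "nat \<Rightarrow> (nat \<Rightarrow> nat \<Rightarrow> complex) \<Rightarrow> nat \<Rightarrow> nat \<Rightarrow> nat \<Rightarrow> complex" where
  "sqrt_iter l B 0 = (\<lambda>i j. 0)"
| "sqrt_iter l B (Suc n) = (\<lambda>i j. (1/2) * (B i j + mmult l (sqrt_iter l B n) (sqrt_iter l B n) i j))"

primrec sqrt_bound :: "nat \<Rightarrow> real" where
  "sqrt_bound 0 = 0"
| "sqrt_bound (Suc n) = (1/2) * (1 + sqrt_bound n * sqrt_bound n)"

lemma sqrt_bound_range: "0 \<le> sqrt_bound n \<and> sqrt_bound n \<le> 1"
proof (induction n)
  case (Suc n)
  then have "sqrt_bound n * sqrt_bound n \<le> 1 * 1" by (intro mult_mono) auto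
  moreover have "0 \<le> sqrt_bound n * sqrt_bound n" by simp
  ultimately show ?case by simp
qed simp

lemma incseq_sqrt_bound: "incseq sqrt_bound"
proof (rule incseq_SucI)
  fix n
  have "0 \<le> (1 - sqrt_bound n) * (1 - sqrt_bound n)" by simp
  then show "sqrt_bound n \<le> sqrt_bound (Suc n)" by (simp add: algebra_simps)
qed

lemma Cauchy_sqrt_bound: "Cauchy sqrt_bound"
proof -
  have "\<forall>i. sqrt_bound i \<le> 1" using sqrt_bound_range by blast
  then obtain L where "sqrt_bound \<longlonglongrightarrow> L"
    by (rule incseq_convergent[OF incseq_sqrt_bound])
  then show ?thesis by (rule LIMSEQ_imp_Cauchy)
qed

lemma mbound_sqrt_iter:
  assumes "mbound l B 1"
  shows "mbound l (sqrt_iter l B n) (sqrt_bound n)"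
proof (induction n)
  case 0
  show ?case by (simp add: mbound_def mv_def vnorm_def L2_set_def)
next
  case (Suc n)
  have "mbound l (\<lambda>i j. B i j + mmult l (sqrt_iter l B n) (sqrt_iter l B n) i j)
      (1 + sqrt_bound n * sqrt_bound n)"
    using sqrt_bound_range by (intro mbound_add assms mbound_mmult Suc) auto
  from mbound_scale[OF this, of "1/2"] show ?case by simp
qed

lemma mmult_square_diff:
  "mmult l A A i j - mmult l B B i j
    = mmult l A (\<lambda>i j. A i j - B i j) i j + mmult l (\<lambda>i j. A i j - B i j) B i j"
  by (simp add: mmult_def algebra_simps sum.distrib sum_subtractf)

text \<open>The difference of squares splits as Y_m (Y_m - Y_n) + (Y_m - Y_n) Y_n, respecting the
  order of the factors, and its bound is the same splitting of the scalar squares.\<close>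

lemma mbound_sqrt_iter_diff:
  assumes B: "mbound l B 1" and "n \<le> m"
  shows "mbound l (\<lambda>i j. sqrt_iter l B m i j - sqrt_iter l B n i j) (sqrt_bound m - sqrt_bound n)"
  using assms(2)
proof (induction n arbitrary: m)
  case 0
  show ?case using mbound_sqrt_iter[OF B, of m] by simp
next
  case (Suc n)
  then obtain m' where m: "m = Suc m'" "n \<le> m'" by (cases m) auto
  define D where "D = (\<lambda>i j. sqrt_iter l B m' i j - sqrt_iter l B n i j)"
  have D: "mbound l D (sqrt_bound m' - sqrt_bound n)"
    unfolding D_def by (rule Suc.IH[OF m(2)])
  have "mbound l (mmult l (sqrt_iter l B m') D) (sqrt_bound m' * (sqrt_bound m' - sqrt_bound n))"
    using sqrt_bound_range[of m'] by (intro mbound_mmult mbound_sqrt_iter B D) auto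
  moreover have "mbound l (mmult l D (sqrt_iter l B n)) ((sqrt_bound m' - sqrt_bound n) * sqrt_bound n)"
    using incseqD[OF incseq_sqrt_bound m(2)] by (intro mbound_mmult mbound_sqrt_iter B D) auto
  ultimately have "mbound l (\<lambda>i j. mmult l (sqrt_iter l B m') D i j + mmult l D (sqrt_iter l B n) i j)
     (sqrt_bound m' * (sqrt_bound m' - sqrt_bound n) + (sqrt_bound m' - sqrt_bound n) * sqrt_bound n)"
    by (rule mbound_add)
  from mbound_scale[OF this, of "1/2"]
  have "mbound l (\<lambda>i j. (1/2) * (mmult l (sqrt_iter l B m') D i j + mmult l D (sqrt_iter l B n) i j))
     (sqrt_bound (Suc m') - sqrt_bound (Suc n))"
    by (simp add: algebra_simps)
  also have "(\<lambda>i j. (1/2) * (mmult l (sqrt_iter l B m') D i j + mmult l D (sqrt_iter l B n) i j))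
     = (\<lambda>i j. sqrt_iter l B (Suc m') i j - sqrt_iter l B (Suc n) i j)"
    unfolding D_def mmult_square_diff[symmetric] by (simp add: algebra_simps)
  finally show ?case unfolding m .
qed

lemma mherm_sqrt_iter:
  assumes "mherm l B"
  shows "mherm l (sqrt_iter l B n)"
proof (induction n)
  case (Suc n)
  show ?case
    unfolding mherm_def
  proof (intro allI impI)
    fix i j assume ij: "i < l" "j < l"
    show "sqrt_iter l B (Suc n) j i = cnj (sqrt_iter l B (Suc n) i j)"
      by (simp add: mherm_cnj[OF assms ij] mherm_cnj[OF mherm_mmult_self[OF Suc] ij])
  qed
qed (simp add: mherm_def)

lemma sqrt_iter_limit:
  assumes B: "mbound l B 1" "mherm l B"
  obtains Y where "mherm l Y" "mbound l Y 1" "mtrunc l Y = Y"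
    "\<And>i j. i < l \<Longrightarrow> j < l \<Longrightarrow> 2 * Y i j = B i j + mmult l Y Y i j"
proof -
  have "Cauchy (\<lambda>n. sqrt_iter l B n i j)" if ij: "i < l" "j < l" for i j
  proof (rule metric_CauchyI)
    fix e :: real assume "0 < e"
    then obtain N where N: "\<And>m n. m \<ge> N \<Longrightarrow> n \<ge> N \<Longrightarrow> dist (sqrt_bound m) (sqrt_bound n) < e"
      using Cauchy_sqrt_bound unfolding Cauchy_def by blast
    have le: "dist (sqrt_iter l B m i j) (sqrt_iter l B n i j) < e" if "n \<le> m" "N \<le> n" for m n
      using mbound_entry[OF mbound_sqrt_iter_diff[OF B(1) that(1)] ij] N[of m n] that
      unfolding dist_norm by simp
    show "\<exists>N. \<forall>m\<ge>N. \<forall>n\<ge>N. dist (sqrt_iter l B m i j) (sqrt_iter l B n i j) < e"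
    proof (intro exI allI impI)
      fix m n assume "N \<le> m" "N \<le> n"
      then show "dist (sqrt_iter l B m i j) (sqrt_iter l B n i j) < e"
        using le[of n m] le[of m n] by (cases "n \<le> m") (auto simp: dist_commute)
    qed
  qed
  then have "\<exists>L. i < l \<longrightarrow> j < l \<longrightarrow> (\<lambda>n. sqrt_iter l B n i j) \<longlonglongrightarrow> L" for i j
    by (metis Cauchy_convergent_iff convergent_def)
  then obtain Y0 where Y0: "\<And>i j. i < l \<Longrightarrow> j < l \<Longrightarrow> (\<lambda>n. sqrt_iter l B n i j) \<longlonglongrightarrow> Y0 i j"
    by metis
  \<comment> \<open>Entries outside the \<open>l\<close> by \<open>l\<close> block are set to 0,
    since matrices are compared as functions on all indices.\<close>
  define Y where "Y = mtrunc l Y0"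
  have lim: "(\<lambda>n. sqrt_iter l B n i j) \<longlonglongrightarrow> Y i j" if "i < l" "j < l" for i j
    using Y0[OF that] that by (simp add: Y_def mtrunc_def)
  show ?thesis
  proof (rule that)
    show "mtrunc l Y = Y" by (intro ext) (simp add: Y_def mtrunc_def)
    show "mherm l Y"
      unfolding mherm_def
    proof (intro allI impI)
      fix i j assume ij: "i < l" "j < l"
      have "(\<lambda>n. sqrt_iter l B n j i) \<longlonglongrightarrow> cnj (Y i j)"
        using tendsto_cnj[OF lim[OF ij]] mherm_cnj[OF mherm_sqrt_iter[OF B(2)] ij] by simp
      then show "Y j i = cnj (Y i j)"
        using lim[OF ij(2,1)] LIMSEQ_unique by blast
    qed
    show "mbound l Y 1"
      unfolding mbound_def
    proof
      fix v
      have "(\<lambda>n. mv l (sqrt_iter l B n) v i) \<longlonglongrightarrow> mv l Y v i" if "i < l" for i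
        using that by (auto simp: mv_def intro!: tendsto_sum tendsto_mult lim)
      then have "(\<lambda>n. vnorm l (mv l (sqrt_iter l B n) v)) \<longlonglongrightarrow> vnorm l (mv l Y v)"
        unfolding vnorm_def L2_set_def
        by (intro tendsto_real_sqrt tendsto_sum tendsto_power tendsto_norm) auto
      moreover have "vnorm l (mv l (sqrt_iter l B n) v) \<le> 1 * vnorm l v" for n
      proof -
        have "vnorm l (mv l (sqrt_iter l B n) v) \<le> sqrt_bound n * vnorm l v"
          using mbound_sqrt_iter[OF B(1), of n] unfolding mbound_def by blast
        also have "\<dots> \<le> 1 * vnorm l v"
          using sqrt_bound_range[of n] by (intro mult_right_mono) auto
        finally show ?thesis .
      qed
      ultimately show "vnorm l (mv l Y v) \<le> 1 * vnorm l v"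
        by (intro LIMSEQ_le_const2) auto
    qed
    fix i j assume ij: "i < l" "j < l"
    have "(\<lambda>n. mmult l (sqrt_iter l B n) (sqrt_iter l B n) i j) \<longlonglongrightarrow> mmult l Y Y i j"
      using ij by (auto simp: mmult_def intro!: tendsto_sum tendsto_mult lim)
    then have "(\<lambda>n. sqrt_iter l B (Suc n) i j) \<longlonglongrightarrow> (1/2) * (B i j + mmult l Y Y i j)"
      unfolding sqrt_iter.simps by (intro tendsto_mult tendsto_add tendsto_const)
    moreover have "(\<lambda>n. sqrt_iter l B (Suc n) i j) \<longlonglongrightarrow> Y i j"
      using lim[OF ij] by (rule LIMSEQ_Suc)
    ultimately have "Y i j = (1/2) * (B i j + mmult l Y Y i j)"
      using LIMSEQ_unique by blast
    then show "2 * Y i j = B i j + mmult l Y Y i j" by (simp add: mult.commute)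
  qed
qed

definition is_msqrt :: "nat \<Rightarrow> (nat \<Rightarrow> nat \<Rightarrow> complex) \<Rightarrow> (nat \<Rightarrow> nat \<Rightarrow> complex) \<Rightarrow> bool" where
  "is_msqrt l A S \<longleftrightarrow> mtrunc l S = S \<and> mpsd l S \<and> mmult l S S = mtrunc l A"

lemma mmult_mone_minus_square:
  assumes "i < l" "j < l"
  shows "mmult l (\<lambda>i j. mone l i j - Y i j) (\<lambda>i j. mone l i j - Y i j) i j
    = mone l i j - 2 * Y i j + mmult l Y Y i j"
proof -
  have "(\<Sum>k<l. mone l i k * Z k) = Z i" for Z
    using mv_mone[OF assms(1), of Z] assms(1) by (simp add: mv_def)
  moreover have "(\<Sum>k<l. Z k * mone l k j) = Z j" for Z
  proof -
    have "(\<Sum>k<l. Z k * mone l k j) = (\<Sum>k<l. mone l j k * Z k)"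
      by (intro sum.cong) (auto simp: mone_def)
    also have "\<dots> = Z j"
      using mv_mone[OF assms(2), of Z] assms(2) by (simp add: mv_def)
    finally show ?thesis .
  qed
  ultimately show ?thesis
    using assms by (simp add: mmult_def algebra_simps sum.distrib sum_subtractf)
qed

text \<open>For the limit \<open>Y\<close> of the iteration started from 1 - A, the fixed point
  equation says (1 - Y)^2 = 1 - 2 Y + Y^2 = A, and 1 - Y is positive because \<open>Y\<close> is a
  contraction.\<close>

lemma is_msqrt_exists_contraction:
  assumes A: "mpsd l A" "mbound l A 1"
  shows "\<exists>S. is_msqrt l A S"
proof -
  have hA: "mherm l A" using A by (simp add: mpsd_iff)
  have h1: "mherm l (\<lambda>i j. mone l i j - A i j)"
    unfolding mherm_def
  proof (intro allI impI)
    fix i j assume ij: "i < l" "j < l"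
    show "mone l j i - A j i = cnj (mone l i j - A i j)"
      using mherm_cnj[OF hA ij] ij by (auto simp: mone_def)
  qed
  obtain Y where Y: "mherm l Y" "mbound l Y 1" "mtrunc l Y = Y"
    "\<And>i j. i < l \<Longrightarrow> j < l \<Longrightarrow> 2 * Y i j = mone l i j - A i j + mmult l Y Y i j"
    using sqrt_iter_limit[OF mbound_mone_minus[OF A] h1] by blast
  define S where "S = (\<lambda>i j. mone l i j - Y i j)"
  have Y0: "Y i j = 0" if "\<not> (i < l \<and> j < l)" for i j
    using fun_cong[OF fun_cong[OF Y(3), of i], of j] that by (simp add: mtrunc_def split: if_splits)
  have "mtrunc l S = S"
    by (intro ext) (auto simp: mtrunc_def S_def mone_def Y0)
  moreover have "mherm l S"
    unfolding mherm_def
  proof (intro allI impI)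
    fix i j assume ij: "i < l" "j < l"
    show "S j i = cnj (S i j)"
      using mherm_cnj[OF Y(1) ij] ij by (auto simp: mone_def S_def)
  qed
  moreover have "0 \<le> Re (vip l (mv l S v) v)" for v
  proof -
    have "Re (vip l (mv l Y v) v) \<le> vnorm l (mv l Y v) * vnorm l v"
      by (rule order_trans[OF complex_Re_le_cmod vip_Cauchy_Schwarz])
    also have "\<dots> \<le> vnorm l v * vnorm l v"
      using Y(2) by (intro mult_right_mono) (auto simp: mbound_def)
    finally have "Re (vip l (mv l Y v) v) \<le> Re (vip l v v)"
      by (simp add: vip_self power2_eq_square)
    moreover have "vip l (mv l S v) v = vip l v v - vip l (mv l Y v) v"
      unfolding S_def mv_mone_minus vip_add_scale vip_mv_mone by simp
    ultimately show ?thesis by simp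
  qed
  moreover have "mmult l S S i j = mtrunc l A i j" for i j
  proof (cases "i < l \<and> j < l")
    case True
    then show ?thesis
      using mmult_mone_minus_square[of i l j Y] Y(4)[of i j] by (simp add: S_def mtrunc_def)
  next
    case False
    then show ?thesis by (auto simp: mmult_def mtrunc_def)
  qed
  ultimately show ?thesis
    unfolding is_msqrt_def mpsd_iff by (intro exI[of _ S]) (simp add: fun_eq_iff)
qed

lemma vip_mv_scale: "vip l (mv l (\<lambda>i j. c * A i j) v) w = c * vip l (mv l A v) w"
  by (simp add: vip_mv sum_distrib_left mult_ac)

lemma mpsd_scale:
  assumes "mpsd l A" "0 \<le> r"
  shows "mpsd l (\<lambda>i j. complex_of_real r * A i j)"
proof -
  have "mherm l (\<lambda>i j. complex_of_real r * A i j)"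
    unfolding mherm_def
  proof (intro allI impI)
    fix i j assume "i < l" "j < l"
    then show "complex_of_real r * A j i = cnj (complex_of_real r * A i j)"
      using assms(1) mherm_cnj[of l A i j] by (simp add: mpsd_iff)
  qed
  then show ?thesis
    using assms by (simp add: mpsd_iff vip_mv_scale)
qed

lemma is_msqrt_exists:
  assumes A: "mpsd l A"
  shows "\<exists>S. is_msqrt l A S"
proof -
  \<comment> \<open>The sum of the moduli of all entries bounds the operator norm, so A / K is a
    contraction; the 1 excludes division by zero.\<close>
  define K where "K = 1 + (\<Sum>i<l. \<Sum>j<l. cmod (A i j))"
  have K: "0 < K" unfolding K_def by (intro add_pos_nonneg sum_nonneg) auto
  define A' where "A' = (\<lambda>i j. complex_of_real (1 / K) * A i j)"
  have "mbound l A' (cmod (complex_of_real (1 / K)) * (\<Sum>i<l. \<Sum>j<l. cmod (A i j)))"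
    unfolding A'_def by (rule mbound_scale[OF mbound_sum_entries])
  moreover have "cmod (complex_of_real (1 / K)) * (\<Sum>i<l. \<Sum>j<l. cmod (A i j)) \<le> 1"
    using K by (simp add: norm_divide) (simp add: K_def)
  ultimately have "mbound l A' 1"
    unfolding mbound_def by (meson mult_right_mono order_trans vnorm_nonneg)
  moreover have "mpsd l A'"
    unfolding A'_def using K by (intro mpsd_scale A) simp
  ultimately obtain S where S: "mtrunc l S = S" "mpsd l S" "mmult l S S = mtrunc l A'"
    using is_msqrt_exists_contraction[of l A'] unfolding is_msqrt_def by blast
  define S' where "S' = (\<lambda>i j. complex_of_real (sqrt K) * S i j)"
  have S0: "S i j = 0" if "\<not> (i < l \<and> j < l)" for i j
    using fun_cong[OF fun_cong[OF S(1), of i], of j] that by (simp add: mtrunc_def split: if_splits)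
  have "mtrunc l S' = S'"
    by (intro ext) (auto simp: mtrunc_def S'_def S0)
  moreover have "mpsd l S'"
    unfolding S'_def using K by (intro mpsd_scale S) simp
  moreover have "mmult l S' S' = mtrunc l A"
  proof (intro ext)
    fix i j
    have "mmult l S' S' i j = complex_of_real (sqrt K * sqrt K) * mmult l S S i j"
      unfolding of_real_mult by (simp add: mmult_def S'_def sum_distrib_left mult_ac)
    also have "\<dots> = mtrunc l A i j"
      using K unfolding S(3) by (simp add: mtrunc_def A'_def)
    finally show "mmult l S' S' i j = mtrunc l A i j" .
  qed
  ultimately show ?thesis unfolding is_msqrt_def by blast
qed

lemma mmult_assoc: "mmult l (mmult l A B) C = mmult l A (mmult l B C)"
proof (intro ext)
  fix i j
  show "mmult l (mmult l A B) C i j = mmult l A (mmult l B C) i j"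
  proof (cases "i < l \<and> j < l")
    case True
    then have "mmult l (mmult l A B) C i j = (\<Sum>k<l. \<Sum>m<l. A i m * B m k * C k j)"
      by (simp add: mmult_def sum_distrib_right)
    also have "\<dots> = (\<Sum>m<l. \<Sum>k<l. A i m * B m k * C k j)" by (rule sum.swap)
    finally show ?thesis using True by (simp add: mmult_def sum_distrib_left mult.assoc)
  qed (auto simp: mmult_def)
qed

lemma mtrace_mmult: "mtrace l (mmult l A B) = (\<Sum>i<l. \<Sum>k<l. A i k * B k i)"
  by (simp add: mtrace_def mmult_def)

lemma mtrace_mmult_commute: "mtrace l (mmult l A B) = mtrace l (mmult l B A)"
  unfolding mtrace_mmult by (subst sum.swap) (simp add: mult.commute)

abbreviation munit :: "nat \<Rightarrow> nat \<Rightarrow> complex" where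
  "munit j \<equiv> (\<lambda>k. if k = j then 1 else 0)"

lemma vip_munit: "i < l \<Longrightarrow> vip l u (munit i) = u i"
  by (simp add: vip_def if_distrib[of "\<lambda>x. _ * x"] if_distrib[of cnj] cong: if_cong)

lemma vip_mv_munit: "i < l \<Longrightarrow> j < l \<Longrightarrow> vip l (mv l A (munit j)) (munit i) = A i j"
  by (simp add: vip_munit mv_unit)

lemma mherm_if_vip:
  assumes "\<And>u v. vip l (mv l A u) v = vip l u (mv l A v)"
  shows "mherm l A"
  unfolding mherm_def
proof (intro allI impI)
  fix i j assume ij: "i < l" "j < l"
  have "A j i = vip l (munit i) (mv l A (munit j))"
    using ij by (simp add: vip_mv_munit flip: assms)
  also have "\<dots> = cnj (A i j)"
    using ij by (subst vip_commute) (simp add: vip_mv_munit)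
  finally show "A j i = cnj (A i j)" .
qed

lemma mpsd_null:
  assumes S: "mpsd l S" and u: "Re (vip l (mv l S u) u) = 0" and i: "i < l"
  shows "mv l S u i = 0"
proof -
  have "cmod (vip l (mv l S u) (mv l S u)) \<le> 0"
    using mpsd_Cauchy_Schwarz[OF S, of u "mv l S u"] u by simp
  then have "vnorm l (mv l S u) = 0"
    by (simp add: vip_self norm_power)
  then show ?thesis
    using norm_le_vnorm[OF i, of "mv l S u"] by simp
qed

text \<open>For two square roots \<open>S\<close>, \<open>R\<close> and \<open>D = S - R\<close> one has \<open>S D + D R = 0\<close>, hence
  \<open>tr (D S D) + tr (D R D) = 0\<close>; both summands are nonnegative, so \<open>S D = R D = 0\<close> and \<open>D\<^sup>2 = 0\<close>.\<close>

lemma is_msqrt_unique: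
  assumes S: "is_msqrt l A S" and R: "is_msqrt l A R"
  shows "S = R"
proof -
  have pS: "mpsd l S" and pR: "mpsd l R" and eq: "mmult l S S = mmult l R R"
    using assms by (auto simp: is_msqrt_def)
  define D where "D = (\<lambda>i j. S i j - R i j)"
  \<comment> \<open>The columns of \<open>D\<close>; the traces below become sums of quadratic forms
    at these columns.\<close>
  define f where "f j = mv l D (munit j)" for j
  have hD: "mherm l D"
  proof -
    have hS: "mherm l S" and hR: "mherm l R" using pS pR by (simp_all add: mpsd_iff)
    show ?thesis
      unfolding mherm_def
    proof (intro allI impI)
      fix i j assume ij: "i < l" "j < l"
      show "D j i = cnj (D i j)"
        by (simp add: D_def mherm_cnj[OF hS ij] mherm_cnj[OF hR ij])
    qed
  qed
  have Dij: "cnj (D i j) = D j i" if "i < l" "j < l" for i j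
    using mherm_cnj[OF hD that] .
  have tr: "mtrace l (mmult l D (mmult l X D)) = (\<Sum>j<l. vip l (mv l X (f j)) (f j))" for X
  proof -
    have "vip l (mv l X (f j)) (f j) = (\<Sum>i<l. D j i * mmult l X D i j)" if "j < l" for j
      unfolding vip_def f_def mv_mmult[symmetric]
      using that by (intro sum.cong) (auto simp: mv_unit Dij)
    then show ?thesis by (simp add: mtrace_mmult)
  qed
  have SD: "mmult l S D i j + mmult l D R i j = 0" for i j
  proof -
    have "mmult l S D i j + mmult l D R i j = mmult l S S i j - mmult l R R i j"
      unfolding D_def by (rule mmult_square_diff[symmetric])
    then show ?thesis by (simp add: eq)
  qed
  have "mtrace l (mmult l D (mmult l S D)) + mtrace l (mmult l D (mmult l D R)) = 0"
    unfolding mtrace_mmult using SD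
    by (simp add: sum.distrib[symmetric] distrib_left[symmetric])
  \<comment> \<open>Cyclicity of the trace moves \<open>R\<close> between the two factors
    \<open>D\<close>, which makes this summand nonnegative too.\<close>
  also have "mtrace l (mmult l D (mmult l D R)) = mtrace l (mmult l D (mmult l R D))"
    by (subst mtrace_mmult_commute) (simp add: mmult_assoc)
  finally have "(\<Sum>j<l. Re (vip l (mv l S (f j)) (f j)) + Re (vip l (mv l R (f j)) (f j))) = 0"
    unfolding tr by (simp add: sum.distrib flip: Re_sum plus_complex.sel)
  then have z: "Re (vip l (mv l S (f j)) (f j)) + Re (vip l (mv l R (f j)) (f j)) = 0" if "j < l" for j
    using pS pR that by (subst (asm) sum_nonneg_eq_0_iff) (auto simp: mpsd_iff)
  have fz: "f j i = 0" if ij: "i < l" "j < l" for i j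
  proof -
    have "0 \<le> Re (vip l (mv l S (f j)) (f j))" "0 \<le> Re (vip l (mv l R (f j)) (f j))"
      using pS pR by (auto simp: mpsd_iff)
    with z[OF ij(2)] have "Re (vip l (mv l S (f j)) (f j)) = 0" "Re (vip l (mv l R (f j)) (f j)) = 0"
      by linarith+
    then have "mv l S (f j) k = 0" "mv l R (f j) k = 0" if "k < l" for k
      using mpsd_null that pS pR by blast+
    moreover have "mv l D (f j) k = mv l S (f j) k - mv l R (f j) k" for k
      by (simp add: mv_def D_def algebra_simps sum_subtractf)
    ultimately have Df: "mv l D (f j) k = 0" if "k < l" for k
      using that by simp
    \<comment> \<open>\<open>D\<close> kills its own columns. As \<open>D\<close> is Hermitian, |D
      e_j|^2 = <D D e_j, e_j> = 0, so the columns vanish.\<close>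
    have "vip l (f j) (f j) = vip l (mv l D (f j)) (munit j)"
      unfolding vip_mv_herm[OF hD] by (simp add: f_def)
    then have "vnorm l (f j) = 0"
      using Df[OF ij(2)] ij by (simp add: vip_munit vip_self)
    then show ?thesis using norm_le_vnorm[OF ij(1), of "f j"] by simp
  qed
  show "S = R"
  proof (intro ext)
    fix i j
    have tS: "S i j = mtrunc l S i j" and tR: "R i j = mtrunc l R i j"
      using assms by (simp_all add: is_msqrt_def)
    show "S i j = R i j"
    proof (cases "i < l \<and> j < l")
      case True
      then show ?thesis using fz[of i j] by (simp add: f_def mv_unit D_def)
    next
      case False
      then show ?thesis unfolding tS tR by (auto simp: mtrunc_def)
    qed
  qed
qed

lemma is_msqrt_msqrt:
  assumes "mpsd l A"
  shows "is_msqrt l A (msqrt l A)"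
proof -
  obtain S where S: "is_msqrt l A S" using is_msqrt_exists[OF assms] by blast
  have "msqrt l A = S"
    unfolding msqrt_def is_msqrt_def[symmetric]
  proof (rule the_equality)
    show "is_msqrt l A S" by (rule S)
    show "R = S" if "is_msqrt l A R" for R using is_msqrt_unique[OF that S] .
  qed
  then show ?thesis using S by simp
qed

section \<open>Trace and Hilbert-Schmidt norm of positive semidefinite matrices\<close>

lemma mpsd_diag:
  assumes R: "mpsd l R" and i: "i < l"
  shows "R i i = complex_of_real (Re (R i i))" "0 \<le> Re (R i i)"
proof -
  have "mherm l R" using R by (simp add: mpsd_iff)
  from mherm_cnj[OF this i i] have "cnj (R i i) = R i i" .
  then show "R i i = complex_of_real (Re (R i i))"
    by (simp add: complex_eq_iff)
  show "0 \<le> Re (R i i)"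
    using R vip_mv_munit[OF i i, of R] unfolding mpsd_iff by (metis (no_types))
qed

text \<open>The trace of R^2 is the sum of all |R_ik|^2. It is at most (tr R)^2 because |R_ik|^2 <=
  R_ii R_kk, and (tr R)^2 is at most \<open>l\<close> times its diagonal part. This is the origin of
  the factor \<open>sqrt l\<close>.\<close>

lemma mtrace_psd_bounds:
  assumes R: "mpsd l R"
  shows "Re (mtrace l (mmult l R R)) \<le> (cmod (mtrace l R))\<^sup>2"
    and "(cmod (mtrace l R))\<^sup>2 \<le> real l * Re (mtrace l (mmult l R R))"
proof -
  have hR: "mherm l R" using R by (simp add: mpsd_iff)
  have "R i k * R k i = complex_of_real ((cmod (R i k))\<^sup>2)" if "i < l" "k < l" for i k
    unfolding complex_norm_square mherm_cnj[OF hR that] ..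
  then have "mtrace l (mmult l R R) = (\<Sum>i<l. \<Sum>k<l. complex_of_real ((cmod (R i k))\<^sup>2))"
    unfolding mtrace_mmult by (intro sum.cong) auto
  then have t: "Re (mtrace l (mmult l R R)) = (\<Sum>i<l. \<Sum>k<l. (cmod (R i k))\<^sup>2)"
    by simp
  have "mtrace l R = (\<Sum>i<l. complex_of_real (Re (R i i)))"
    unfolding mtrace_def by (intro sum.cong refl mpsd_diag(1)[OF R]) auto
  then have "mtrace l R = complex_of_real (\<Sum>i<l. Re (R i i))" by simp
  then have m: "(cmod (mtrace l R))\<^sup>2 = (\<Sum>i<l. Re (R i i))\<^sup>2"
    by (metis norm_of_real power2_abs)
  have "(\<Sum>i<l. \<Sum>k<l. (cmod (R i k))\<^sup>2) \<le> (\<Sum>i<l. \<Sum>k<l. Re (R i i) * Re (R k k))"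
  proof (intro sum_mono)
    fix i k assume "i \<in> {..<l}" "k \<in> {..<l}"
    then have ik: "i < l" "k < l" by auto
    have "cmod (R i k) \<le> sqrt (Re (R k k)) * sqrt (Re (R i i))"
      using mpsd_Cauchy_Schwarz[OF R, of "munit k" "munit i"] ik by (simp add: vip_mv_munit)
    then have "(cmod (R i k))\<^sup>2 \<le> (sqrt (Re (R k k)) * sqrt (Re (R i i)))\<^sup>2"
      by (rule power_mono) simp
    then show "(cmod (R i k))\<^sup>2 \<le> Re (R i i) * Re (R k k)"
      using mpsd_diag(2)[OF R] ik by (simp add: power_mult_distrib mult.commute)
  qed
  also have "\<dots> = (\<Sum>i<l. Re (R i i))\<^sup>2"
    by (simp add: power2_eq_square sum_product)
  finally show "Re (mtrace l (mmult l R R)) \<le> (cmod (mtrace l R))\<^sup>2"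
    unfolding t m .
  have "(\<Sum>i<l. Re (R i i))\<^sup>2 \<le> (\<Sum>i<l. (Re (R i i))\<^sup>2) * real (card {..<l})"
    by (rule sum_squared_le_sum_of_squares)
  also have "\<dots> \<le> (\<Sum>i<l. \<Sum>k<l. (cmod (R i k))\<^sup>2) * real l"
    unfolding card_lessThan
  proof (intro mult_right_mono sum_mono)
    fix i assume i: "i \<in> {..<l}"
    have "(Re (R i i))\<^sup>2 \<le> (cmod (R i i))\<^sup>2"
      by (simp add: cmod_power2)
    also have "\<dots> \<le> (\<Sum>k<l. (cmod (R i k))\<^sup>2)"
      using i by (intro member_le_sum) auto
    finally show "(Re (R i i))\<^sup>2 \<le> (\<Sum>k<l. (cmod (R i k))\<^sup>2)" .
  qed simp
  finally show "(cmod (mtrace l R))\<^sup>2 \<le> real l * Re (mtrace l (mmult l R R))"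
    unfolding t m by (simp add: mult.commute)
qed

lemma mtrace_mtrunc: "mtrace l (mtrunc l A) = mtrace l A"
  by (simp add: mtrace_def mtrunc_def)

text \<open>Apply the trace bounds to the root of \<open>M\<close>, the product S Y S with
  \<open>S = msqrt l X\<close>. The square of that root has trace tr(S Y S) = tr(X Y), in which all
  square roots have disappeared.\<close>

lemma tgm_bounds:
  assumes X: "mpsd l X" and Y: "mpsd l Y"
  shows "Re (mtrace l (mmult l X Y)) \<le> (cmod (tgm l X Y))\<^sup>2"
    and "(cmod (tgm l X Y))\<^sup>2 \<le> real l * Re (mtrace l (mmult l X Y))"
proof -
  define S where "S = msqrt l X"
  have S: "mpsd l S" "mmult l S S = mtrunc l X"
    using is_msqrt_msqrt[OF X] by (auto simp: is_msqrt_def S_def)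
  define M where "M = mmult l (mmult l S Y) S"
  have mvM: "mv l M v = mv l S (mv l Y (mv l S v))" for v
    by (simp add: M_def mv_mmult)
  have hS: "mherm l S" and hY: "mherm l Y" using S Y by (auto simp: mpsd_iff)
  have "mpsd l M"
    unfolding mpsd_iff
  proof (intro conjI allI)
    show "mherm l M"
      by (rule mherm_if_vip) (simp add: mvM vip_mv_herm[OF hS] vip_mv_herm[OF hY])
    show "0 \<le> Re (vip l (mv l M v) v)" for v
      using Y by (simp add: mvM vip_mv_herm[OF hS] mpsd_iff)
  qed
  then have R: "mpsd l (msqrt l M)" "mmult l (msqrt l M) (msqrt l M) = mtrunc l M"
    using is_msqrt_msqrt[of l M] by (auto simp: is_msqrt_def)
  have "mtrace l M = mtrace l (mmult l (mmult l S S) Y)"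
    unfolding M_def mtrace_mmult_commute[of l "mmult l S Y" S] by (simp add: mmult_assoc)
  also have "\<dots> = mtrace l (mmult l X Y)"
    unfolding S(2) by (simp add: mtrace_mmult mtrunc_def)
  finally have "mtrace l (mmult l (msqrt l M) (msqrt l M)) = mtrace l (mmult l X Y)"
    by (simp add: R mtrace_mtrunc)
  then show "Re (mtrace l (mmult l X Y)) \<le> (cmod (tgm l X Y))\<^sup>2"
    "(cmod (tgm l X Y))\<^sup>2 \<le> real l * Re (mtrace l (mmult l X Y))"
    using mtrace_psd_bounds[OF R(1)] by (simp_all add: tgm_def M_def S_def)
qed

lemma mpsd_Qmat: "mpsd l (Qmat c \<eta>)"
  unfolding mpsd_def
proof (intro conjI allI impI)
  fix i j
  show "Qmat c \<eta> j i = cnj (Qmat c \<eta> i j)"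
    unfolding Qmat_def by (rule cinner_commute)
next
  fix v :: "nat \<Rightarrow> complex"
  define w where "w = (\<Sum>j<l. scaleC (v j) (c j \<eta>))"
  have "cinner w w = (\<Sum>j<l. \<Sum>i<l. cnj (v i) * Qmat c \<eta> i j * v j)"
    unfolding w_def cinner_sum_left unfolding cinner_sum_right
    by (simp add: cinner_simps Qmat_def mult_ac)
  also have "\<dots> = (\<Sum>i<l. \<Sum>j<l. cnj (v i) * Qmat c \<eta> i j * v j)"
    by (rule sum.swap)
  finally show "0 \<le> Re (\<Sum>i<l. \<Sum>j<l. cnj (v i) * Qmat c \<eta> i j * v j)"
    using cinner_ge_zero[of w] by simp
qed

lemma mtrace_Qmat:
  "mtrace l (mmult l (Qmat c \<xi>) (Qmat d \<eta>))
    = complex_of_real ((hsnorm {..<l} (\<lambda>j. c j \<xi>) (\<lambda>j. d j \<eta>))\<^sup>2)"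
  unfolding hsip_self[OF finite_lessThan, symmetric] mtrace_mmult hsip_def Qmat_def
  by (rule sum.swap)

lemma fT_bounds:
  fixes \<xi> \<eta> :: "'a::complex_inner"
  shows "hsnorm {..<l} (\<lambda>j. cadjoint (a j) \<xi>) (\<lambda>j. b j \<eta>) \<le> cmod (fT l a b (\<xi>, \<eta>))"
    and "cmod (fT l a b (\<xi>, \<eta>)) \<le> sqrt (real l) * hsnorm {..<l} (\<lambda>j. cadjoint (a j) \<xi>) (\<lambda>j. b j \<eta>)"
proof -
  define n where "n = hsnorm {..<l} (\<lambda>j. cadjoint (a j) \<xi>) (\<lambda>j. b j \<eta>)"
  have n0: "0 \<le> n" by (simp add: n_def)
  note tgm = tgm_bounds[OF mpsd_Qmat[of l "\<lambda>j. cadjoint (a j)" \<xi>] mpsd_Qmat[of l b \<eta>],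
      unfolded mtrace_Qmat Re_complex_of_real, folded n_def]
  have "n\<^sup>2 \<le> (cmod (fT l a b (\<xi>, \<eta>)))\<^sup>2"
    using tgm(1) by (simp add: fT_def)
  then show "n \<le> cmod (fT l a b (\<xi>, \<eta>))"
    by (rule power2_le_imp_le) simp
  have "(cmod (fT l a b (\<xi>, \<eta>)))\<^sup>2 \<le> (sqrt (real l) * n)\<^sup>2"
    using tgm(2) by (simp add: fT_def power_mult_distrib)
  then show "cmod (fT l a b (\<xi>, \<eta>)) \<le> sqrt (real l) * n"
    by (rule power2_le_imp_le) (simp add: n0)
qed

section \<open>Weak continuity at zero\<close>

lemma cdual_UNIV_eq_cinner:
  fixes \<phi> :: "'a::chilbert_space \<Rightarrow> complex"
  assumes "\<phi> \<in> cdual UNIV (+) scaleC norm"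
  obtains q where "\<phi> = (\<lambda>x. cinner x q)"
proof -
  from assms obtain C where C: "\<And>x y. \<phi> (x + y) = \<phi> x + \<phi> y" "\<And>c x. \<phi> (scaleC c x) = c * \<phi> x"
    "\<And>x. cmod (\<phi> x) \<le> C * norm x"
    unfolding cdual_def by auto
  from Riesz_representation[of \<phi>, OF C] obtain q where "\<And>x. \<phi> x = cinner x q" by blast
  then show ?thesis using that[of q] by blast
qed

lemma cinner_in_cdual: "(\<lambda>x. cinner x q) \<in> cdual UNIV (+) scaleC (norm :: 'a::complex_inner \<Rightarrow> real)"
  unfolding cdual_def using cinner_Cauchy_Schwarz[of _ q]
  by (auto simp: cinner_simps mult.commute intro!: exI[of _ "norm q"])

lemma openin_weak_topology_basic:
  assumes "\<phi> \<in> cdual X add sc nrm" "open U"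
  shows "openin (weak_topology X add sc nrm) {x\<in>X. \<phi> x \<in> U}"
  unfolding weak_topology_def by (rule topology_generated_by_Basis) (use assms in blast)

text \<open>A single functional, with \<open>U = UNIV\<close>, already makes the subbasic sets cover
  \<open>X\<close>.\<close>

lemma topspace_weak_topology: "topspace (weak_topology X add sc nrm) = X \<or> cdual X add sc nrm = {}"
proof (cases "cdual X add sc nrm = {}")
  case False
  then obtain \<phi> where "\<phi> \<in> cdual X add sc nrm" by blast
  then have "X \<subseteq> topspace (weak_topology X add sc nrm)"
    using openin_subset[OF openin_weak_topology_basic[of \<phi> X add sc nrm UNIV]] by auto
  moreover have "topspace (weak_topology X add sc nrm) \<subseteq> X"
    unfolding weak_topology_def topology_generated_by_topspace by blast
  ultimately show ?thesis by blast
qed simp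

lemma topspace_weak_ball: "topspace (weak_ball_topology :: 'a::complex_inner topology) = cball 0 1"
proof -
  have "cdual UNIV (+) scaleC (norm :: 'a \<Rightarrow> real) \<noteq> {}"
    using cinner_in_cdual[of 0] by blast
  then have "topspace (weak_topology UNIV (+) scaleC (norm :: 'a \<Rightarrow> real)) = UNIV"
    using topspace_weak_topology[of "UNIV :: 'a set" "(+)" scaleC norm] by simp
  then show ?thesis by (simp add: weak_ball_topology_def)
qed

lemma openin_wball:
  assumes "finite Z"
  shows "openin weak_ball_topology (wball Z \<delta>)"
proof -
  have "openin weak_ball_topology {\<xi>\<in>cball 0 1. cinner \<xi> z \<in> ball 0 \<delta>}" for z :: 'a
  proof -
    have "{\<xi>\<in>cball 0 1. cinner \<xi> z \<in> ball 0 \<delta>} = {\<xi>\<in>UNIV. cinner \<xi> z \<in> ball 0 \<delta>} \<inter> cball 0 1"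
      by auto
    then show ?thesis
      unfolding weak_ball_topology_def
      by (simp only: openin_subtopology_Int[OF openin_weak_topology_basic[OF cinner_in_cdual[of z] open_ball]])
  qed
  note * = this
  have "wball Z \<delta> = topspace weak_ball_topology \<inter> (\<Inter>z\<in>Z. {\<xi>\<in>cball 0 1. cinner \<xi> z \<in> ball 0 \<delta>})"
    by (auto simp: wball_def topspace_weak_ball)
  also have "openin weak_ball_topology \<dots>"
    using assms
  proof (induction rule: finite_induct)
    case (insert z Z)
    have "topspace weak_ball_topology \<inter> (\<Inter>z\<in>insert z Z. {\<xi>\<in>cball 0 1. cinner \<xi> z \<in> ball 0 \<delta>})
      = {\<xi>\<in>cball 0 1. cinner \<xi> z \<in> ball 0 \<delta>} \<inter>
        (topspace weak_ball_topology \<inter> (\<Inter>z\<in>Z. {\<xi>\<in>cball 0 1. cinner \<xi> z \<in> ball 0 \<delta>}))"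
      by blast
    then show ?case using openin_Int[OF *[of z] insert.IH] by simp
  qed simp
  finally show ?thesis .
qed

text \<open>By Riesz each subbasic weakly open set is a condition on one inner product, so
  \<open>wnhds\<close> is the neighbourhood filter of the topology generated by all bounded
  functionals. The induction runs over the generation of the open set \<open>V\<close>.\<close>

lemma eventually_wnhds_openin:
  fixes P :: "'a::chilbert_space \<Rightarrow> bool"
  shows "eventually P wnhds \<longleftrightarrow> (\<exists>U. openin weak_ball_topology U \<and> 0 \<in> U \<and> (\<forall>x\<in>U. P x))"
proof
  assume "eventually P wnhds"
  then obtain Z \<delta> where Z: "finite Z" "0 < \<delta>" "\<forall>\<xi>\<in>wball Z \<delta>. P \<xi>"
    unfolding eventually_wnhds by blast
  then show "\<exists>U. openin weak_ball_topology U \<and> 0 \<in> U \<and> (\<forall>x\<in>U. P x)"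
    using openin_wball[OF Z(1), of \<delta>] zero_in_wball by blast
next
  assume "\<exists>U. openin weak_ball_topology U \<and> 0 \<in> U \<and> (\<forall>x\<in>U. P x)"
  then obtain U where U: "openin weak_ball_topology U" "0 \<in> U" "\<forall>x\<in>U. P x" by blast
  then obtain V where V: "openin (weak_topology UNIV (+) scaleC norm) V" "U = V \<inter> cball 0 1"
    unfolding weak_ball_topology_def openin_subtopology by blast
  have "generate_topology_on
      {{x\<in>UNIV. \<phi> x \<in> U} | \<phi> U. \<phi> \<in> cdual UNIV (+) scaleC norm \<and> open U} V"
    using V(1) unfolding weak_topology_def openin_topology_generated_by_iff .
  then have "0 \<in> V \<longrightarrow> eventually (\<lambda>\<xi>. \<xi> \<in> V) wnhds"
  proof (induction rule: generate_topology_on.induct)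
    case (Int A B)
    then show ?case by (simp add: eventually_conj_iff)
  next
    case (UN K)
    show ?case
    proof
      assume "0 \<in> \<Union>K"
      then obtain k where k: "k \<in> K" "0 \<in> k" by blast
      with UN have "eventually (\<lambda>\<xi>. \<xi> \<in> k) wnhds" by blast
      then show "eventually (\<lambda>\<xi>. \<xi> \<in> \<Union>K) wnhds"
        by (rule eventually_mono) (use k in blast)
    qed
  next
    case (Basis s)
    then obtain \<phi> W where s: "s = {x. \<phi> x \<in> W}" and \<phi>: "\<phi> \<in> cdual UNIV (+) scaleC norm"
      and W: "open W"
      by auto
    from \<phi> obtain q where q: "\<phi> = (\<lambda>x. cinner x q)"
      by (rule cdual_UNIV_eq_cinner)
    show ?case
    proof
      assume "0 \<in> s"
      then have "0 \<in> W" by (simp add: s q)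
      then obtain \<delta> where "0 < \<delta>" "ball 0 \<delta> \<subseteq> W" using W openE by blast
      then have sub: "\<xi> \<in> s" if "cmod (cinner \<xi> q) < \<delta>" for \<xi>
        using that by (auto simp: s q)
      show "eventually (\<lambda>\<xi>. \<xi> \<in> s) wnhds"
        using eventually_wnhds_cinner[OF \<open>0 < \<delta>\<close>, of q] by (rule eventually_mono) (rule sub)
    qed
  qed simp
  then have "eventually (\<lambda>\<xi>. \<xi> \<in> V) wnhds"
    using U(2) V(2) by blast
  from eventually_conj[OF this eventually_wnhds_norm_le] show "eventually P wnhds"
    by (rule eventually_mono) (use U(3) V(2) in auto)
qed

text \<open>\<open>atin\<close> leaves out the point 0 while \<open>wnhds\<close> contains it;
  \<open>f 0 = 0\<close> closes the gap.\<close>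

lemma limitin_weak_ball_iff:
  fixes f :: "'a::chilbert_space \<Rightarrow> complex"
  assumes "f 0 = 0"
  shows "limitin euclidean f 0 (atin weak_ball_topology 0) \<longleftrightarrow> (f \<longlongrightarrow> 0) wnhds"
proof -
  have "eventually P (atin weak_ball_topology 0) \<longleftrightarrow> eventually P wnhds" if "P 0" for P :: "'a \<Rightarrow> bool"
    unfolding eventually_atin eventually_wnhds_openin using that by (auto simp: topspace_weak_ball)
  then show ?thesis
    unfolding limitin_def tendsto_def using assms by auto
qed

lemma limitin_weak_ball_prod_iff:
  fixes f :: "'a::chilbert_space \<times> 'a \<Rightarrow> complex"
  assumes f0: "f (0, 0) = 0"
  shows "limitin euclidean f 0 (atin (prod_topology weak_ball_topology weak_ball_topology) (0, 0))
    \<longleftrightarrow> (f \<longlongrightarrow> 0) (wnhds \<times>\<^sub>F wnhds)"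
proof -
  let ?X = "prod_topology weak_ball_topology weak_ball_topology :: ('a \<times> 'a) topology"
  have "eventually P (atin ?X (0, 0)) \<longleftrightarrow> eventually P (wnhds \<times>\<^sub>F wnhds)" if P0: "P (0, 0)" for P
  proof -
    have "eventually P (atin ?X (0, 0)) \<longleftrightarrow> (\<exists>U. openin ?X U \<and> (0, 0) \<in> U \<and> (\<forall>x\<in>U. P x))"
    proof -
      have "(0, 0) \<in> topspace ?X" by (simp add: topspace_weak_ball)
      moreover have "(\<forall>x\<in>U - {(0, 0)}. P x) \<longleftrightarrow> (\<forall>x\<in>U. P x)" for U using P0 by blast
      ultimately show ?thesis by (simp add: eventually_atin)
    qed
    also have "\<dots> \<longleftrightarrow> (\<exists>U V. openin weak_ball_topology U \<and> openin weak_ball_topology V \<and>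
        0 \<in> U \<and> 0 \<in> V \<and> (\<forall>x\<in>U \<times> V. P x))" (is "?L \<longleftrightarrow> ?R")
    proof
      assume ?L
      then obtain W where W: "openin ?X W" "(0, 0) \<in> W" "\<forall>x\<in>W. P x" by blast
      from W(1)[unfolded openin_prod_topology_alt, rule_format, OF W(2)]
      obtain U V where UV: "openin weak_ball_topology U" "openin weak_ball_topology V"
        "0 \<in> U" "0 \<in> V" "U \<times> V \<subseteq> W"
        by (elim exE conjE)
      moreover have "\<forall>x\<in>U \<times> V. P x" using W(3) UV(5) by (meson subsetD)
      ultimately show ?R by (intro exI[of _ U] exI[of _ V] conjI)
    next
      assume ?R
      then obtain U V where UV: "openin weak_ball_topology U" "openin weak_ball_topology V"
        "0 \<in> U" "0 \<in> V" "\<forall>x\<in>U \<times> V. P x" by blast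
      have "openin ?X (U \<times> V)" using UV(1,2) by (simp add: openin_prod_Times_iff)
      then show ?L using UV(3-5) by (intro exI[of _ "U \<times> V"] conjI) simp_all
    qed
    also have "\<dots> \<longleftrightarrow> eventually P (wnhds \<times>\<^sub>F wnhds)"
    proof
      assume "\<exists>U V. openin weak_ball_topology U \<and> openin weak_ball_topology V \<and>
        0 \<in> U \<and> 0 \<in> V \<and> (\<forall>x\<in>U \<times> V. P x)"
      then obtain U V where UV: "openin weak_ball_topology U" "openin weak_ball_topology V"
        "0 \<in> U" "0 \<in> V" "\<forall>x\<in>U \<times> V. P x" by blast
      have "eventually (\<lambda>x. x \<in> U) wnhds" "eventually (\<lambda>x. x \<in> V) wnhds"
        unfolding eventually_wnhds_openin using UV by blast+
      then show "eventually P (wnhds \<times>\<^sub>F wnhds)"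
        unfolding eventually_prod_filter using UV(5)
        by (intro exI[of _ "\<lambda>x. x \<in> U"] exI[of _ "\<lambda>x. x \<in> V"] conjI) auto
    next
      assume "eventually P (wnhds \<times>\<^sub>F wnhds)"
      then obtain Pf Pg where fg: "eventually Pf wnhds" "eventually Pg wnhds"
        "\<And>x y. Pf x \<Longrightarrow> Pg y \<Longrightarrow> P (x, y)"
        unfolding eventually_prod_filter by blast
      obtain U where "openin weak_ball_topology U" "0 \<in> U" "\<forall>x\<in>U. Pf x"
        using fg(1) unfolding eventually_wnhds_openin by blast
      moreover obtain V where "openin weak_ball_topology V" "0 \<in> V" "\<forall>x\<in>V. Pg x"
        using fg(2) unfolding eventually_wnhds_openin by blast
      ultimately show "\<exists>U V. openin weak_ball_topology U \<and> openin weak_ball_topology V \<and>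
        0 \<in> U \<and> 0 \<in> V \<and> (\<forall>x\<in>U \<times> V. P x)"
        using fg(3) by (intro exI[of _ U] exI[of _ V] conjI) auto
    qed
    finally show ?thesis .
  qed
  then show ?thesis
    unfolding limitin_def tendsto_def using f0 by auto
qed

section \<open>Smallness of an elementary operator\<close>

text \<open>The quantifier over \<open>HS_ball\<close> stands inside the eventuality, so the bound
  is uniform in \<open>x\<close>. Being stated for the map and not for its coefficients, smallness
  passes between different representations of the same map.\<close>

definition small_op :: "(('a::complex_inner \<Rightarrow> 'a) \<Rightarrow> 'a \<Rightarrow> 'a) \<Rightarrow> bool" where
  "small_op T \<longleftrightarrow> (\<forall>\<epsilon>>0. \<forall>\<^sub>F p in wnhds \<times>\<^sub>F wnhds. \<forall>x\<in>HS_ball. cmod (cinner (T x (snd p)) (fst p)) \<le> \<epsilon>)"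

lemma cinner_elem_op:
  fixes a b :: "nat \<Rightarrow> 'a::chilbert_space \<Rightarrow> 'a"
  assumes "\<forall>j<l. bounded_clinear (a j)"
  shows "cinner (elem_op l a b x \<eta>) \<xi> = (\<Sum>j<l. cinner (x (b j \<eta>)) (cadjoint (a j) \<xi>))"
  unfolding elem_op_def cinner_sum_left using assms by (intro sum.cong) (auto simp: cadjoint)

lemma bounded_clinear_elem_op:
  assumes "\<forall>j<l. bounded_clinear (a j)" "\<forall>j<l. bounded_clinear (b j)" "bounded_clinear x"
  shows "bounded_clinear (elem_op l a b x)"
  unfolding elem_op_def
proof (rule bounded_clinear_setsum)
  fix j assume "j \<in> {..<l}"
  then have j: "bounded_clinear (a j)" "bounded_clinear (b j)" using assms by auto
  show "bounded_clinear (\<lambda>h. a j (x (b j h)))"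
    by (rule bounded_clinear_compose[OF j(1) bounded_clinear_compose[OF assms(3) j(2)]])
qed

abbreviation hsT :: "nat \<Rightarrow> (nat \<Rightarrow> 'a \<Rightarrow> 'a) \<Rightarrow> (nat \<Rightarrow> 'a \<Rightarrow> 'a) \<Rightarrow> 'a::complex_inner \<Rightarrow> 'a \<Rightarrow> real" where
  "hsT l a b \<xi> \<eta> \<equiv> hsnorm {..<l} (\<lambda>j. cadjoint (a j) \<xi>) (\<lambda>j. b j \<eta>)"

lemma HS_ball_elem_op_le:
  fixes a b :: "nat \<Rightarrow> 'a::chilbert_space \<Rightarrow> 'a"
  assumes "\<forall>j<l. bounded_clinear (a j)" "x \<in> HS_ball"
  shows "cmod (cinner (elem_op l a b x \<eta>) \<xi>) \<le> hsT l a b \<xi> \<eta>"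
  unfolding cinner_elem_op[OF assms(1)] by (rule HS_ballD(2)[OF assms(2)])

lemma hsT_le_if_HS_ball:
  fixes a b :: "nat \<Rightarrow> 'a::chilbert_space \<Rightarrow> 'a"
  assumes a: "\<forall>j<l. bounded_clinear (a j)" and "0 \<le> K"
    and "\<And>x. x \<in> HS_ball \<Longrightarrow> cmod (cinner (elem_op l a b x \<eta>) \<xi>) \<le> K"
  shows "hsT l a b \<xi> \<eta> \<le> K"
  by (rule hsnorm_le_if_HS_ball) (use assms(2,3) in \<open>auto simp: cinner_elem_op[OF a]\<close>)

text \<open>Hilbert-Schmidt duality: \<open>hsT\<close> is the least bound of the coefficients
  \<open>cinner (elem_op l a b x \<eta>) \<xi>\<close> for \<open>x\<close> in
  \<open>HS_ball\<close>, so uniform smallness over the ball is convergence of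
  \<open>hsT\<close>.\<close>

lemma small_op_iff_hsT:
  fixes a b :: "nat \<Rightarrow> 'a::chilbert_space \<Rightarrow> 'a"
  assumes a: "\<forall>j<l. bounded_clinear (a j)"
  shows "small_op (elem_op l a b) \<longleftrightarrow> ((\<lambda>p. hsT l a b (fst p) (snd p)) \<longlongrightarrow> 0) (wnhds \<times>\<^sub>F wnhds)"
proof
  assume small: "small_op (elem_op l a b)"
  show "((\<lambda>p. hsT l a b (fst p) (snd p)) \<longlongrightarrow> 0) (wnhds \<times>\<^sub>F wnhds)"
  proof (rule tendstoI)
    fix e :: real assume e: "0 < e"
    then have "\<forall>\<^sub>F p in wnhds \<times>\<^sub>F wnhds. \<forall>x\<in>HS_ball. cmod (cinner (elem_op l a b x (snd p)) (fst p)) \<le> e / 2"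
      using small unfolding small_op_def by (meson half_gt_zero)
    then show "\<forall>\<^sub>F p in wnhds \<times>\<^sub>F wnhds. dist (hsT l a b (fst p) (snd p)) 0 < e"
    proof (rule eventually_mono)
      fix p :: "'a \<times> 'a"
      assume p: "\<forall>x\<in>HS_ball. cmod (cinner (elem_op l a b x (snd p)) (fst p)) \<le> e / 2"
      have "hsT l a b (fst p) (snd p) \<le> e / 2"
        by (rule hsT_le_if_HS_ball[OF a]) (use p e in auto)
      then show "dist (hsT l a b (fst p) (snd p)) 0 < e" using e by simp
    qed
  qed
next
  assume lim: "((\<lambda>p. hsT l a b (fst p) (snd p)) \<longlongrightarrow> 0) (wnhds \<times>\<^sub>F wnhds)"
  show "small_op (elem_op l a b)"
    unfolding small_op_def
  proof (intro allI impI)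
    fix e :: real assume "0 < e"
    from tendstoD[OF lim this]
    show "\<forall>\<^sub>F p in wnhds \<times>\<^sub>F wnhds. \<forall>x\<in>HS_ball. cmod (cinner (elem_op l a b x (snd p)) (fst p)) \<le> e"
    proof (rule eventually_mono, intro ballI)
      fix p :: "'a \<times> 'a" and x :: "'a \<Rightarrow> 'a"
      assume "dist (hsT l a b (fst p) (snd p)) 0 < e" "x \<in> HS_ball"
      then show "cmod (cinner (elem_op l a b x (snd p)) (fst p)) \<le> e"
        using HS_ball_elem_op_le[OF a, of x b "snd p" "fst p"] by simp
    qed
  qed
qed

lemma fT_zero:
  fixes a b :: "nat \<Rightarrow> 'a::chilbert_space \<Rightarrow> 'a"
  assumes b: "\<forall>j<l. bounded_clinear (b j)"
  shows "fT l a b (0, 0) = 0"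
proof -
  have "hsT l a b 0 0 = 0"
    using b by (simp add: hsnorm_def hsip_def bounded_clinear_zero)
  then show ?thesis using fT_bounds(2)[of l a b 0 0] by simp
qed

lemma fT_tendsto_iff_hsT:
  fixes a b :: "nat \<Rightarrow> 'a::chilbert_space \<Rightarrow> 'a"
  shows "((\<lambda>x. fT l a b (f x, g x)) \<longlongrightarrow> 0) F \<longleftrightarrow> ((\<lambda>x. hsT l a b (f x) (g x)) \<longlongrightarrow> 0) F"
proof
  assume "((\<lambda>x. fT l a b (f x, g x)) \<longlongrightarrow> 0) F"
  from tendsto_norm_zero[OF this] show "((\<lambda>x. hsT l a b (f x) (g x)) \<longlongrightarrow> 0) F"
    by (rule Lim_null_comparison[rotated]) (simp add: fT_bounds)
next
  assume "((\<lambda>x. hsT l a b (f x) (g x)) \<longlongrightarrow> 0) F"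
  from tendsto_mult_right_zero[OF this, of "sqrt (real l)"]
  show "((\<lambda>x. fT l a b (f x, g x)) \<longlongrightarrow> 0) F"
    by (rule Lim_null_comparison[rotated]) (simp add: fT_bounds)
qed

section \<open>Polarization from the diagonal to pairs of vectors\<close>

lemma sum_fourth_roots:
  "(\<Sum>c\<in>{1, -1, \<i>, -\<i>}. F c) = F 1 + F (-1) + F \<i> + (F (-\<i>) :: 'b::comm_monoid_add)"
proof -
  have "1 \<notin> {-1, \<i>, -\<i>}" "-1 \<notin> {\<i>, -\<i>}" "\<i> \<notin> {-\<i>}"
    by (auto simp: complex_eq_iff)
  then show ?thesis by (simp add: add.assoc)
qed

text \<open>Summed over the fourth roots of unity, \<open>c\<close> and \<open>c * c\<close> cancel
  and only one mixed term survives. The factor 1/2 keeps the test vectors in the unit ball and takes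
  the place of the usual 1/4 in front.\<close>

lemma cinner_polarization:
  fixes A :: "'a::complex_inner \<Rightarrow> 'a"
  assumes A: "bounded_clinear A"
  shows "cinner (A \<eta>) \<xi> = (\<Sum>c\<in>{1, -1, \<i>, -\<i>}.
     c * cinner (A (scaleC (1/2) (\<eta> + scaleC c \<xi>))) (scaleC (1/2) (\<eta> + scaleC c \<xi>)))"
proof -
  have "c * cinner (A (scaleC (1/2) (\<eta> + scaleC c \<xi>))) (scaleC (1/2) (\<eta> + scaleC c \<xi>))
     = (c * cinner (A \<eta>) \<eta> + c * cnj c * cinner (A \<eta>) \<xi> + c * c * cinner (A \<xi>) \<eta>
        + c * (c * cnj c) * cinner (A \<xi>) \<xi>) / 4" for c
    by (simp add: bounded_clinear_scaleC[OF A] bounded_clinear_add[OF A] cinner_simps algebra_simps)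
  note * = this
  show ?thesis unfolding * sum_fourth_roots by simp (simp add: field_simps)
qed

text \<open>\<open>hsT\<close> is not sesquilinear, so polarization is applied to the form of
  \<open>elem_op l a b x\<close> for each \<open>x\<close>. The bound of its diagonal values by
  \<open>hsT\<close> is uniform in \<open>x\<close>, and each of the four values gets
  \<open>e / 4\<close>.\<close>

lemma hsT_tendsto_if_diagonal:
  fixes a b :: "nat \<Rightarrow> 'a::chilbert_space \<Rightarrow> 'a"
  assumes a: "\<forall>j<l. bounded_clinear (a j)" and b: "\<forall>j<l. bounded_clinear (b j)"
    and lim: "((\<lambda>\<xi>. hsT l a b \<xi> \<xi>) \<longlongrightarrow> 0) wnhds"
  shows "small_op (elem_op l a b)"
  unfolding small_op_def
proof (intro allI impI)
  fix e :: real assume "0 < e"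
  then have "0 < e / 4" by simp
  from lim[unfolded tendsto_wnhds_iff, rule_format, OF this]
  obtain Z \<delta> where Z: "finite Z" "0 < \<delta>" "\<And>\<xi>. \<xi> \<in> wball Z \<delta> \<Longrightarrow> norm (hsT l a b \<xi> \<xi>) < e / 4"
    by blast
  have ev: "\<forall>\<^sub>F \<xi> in wnhds. \<xi> \<in> wball Z \<delta>"
    by (rule eventually_wnhdsI[OF Z(1,2)])
  show "\<forall>\<^sub>F p in wnhds \<times>\<^sub>F wnhds. \<forall>x\<in>HS_ball. cmod (cinner (elem_op l a b x (snd p)) (fst p)) \<le> e"
    unfolding eventually_prod_filter
  proof (rule exI[of _ "\<lambda>\<xi>. \<xi> \<in> wball Z \<delta>"], rule exI[of _ "\<lambda>\<xi>. \<xi> \<in> wball Z \<delta>"],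
      intro conjI allI impI ballI, rule ev, rule ev)
    fix \<xi> \<eta> and x :: "'a \<Rightarrow> 'a"
    assume \<xi>: "\<xi> \<in> wball Z \<delta>" and \<eta>: "\<eta> \<in> wball Z \<delta>" and x: "x \<in> HS_ball"
    define A where "A = elem_op l a b x"
    define \<zeta> where "\<zeta> c = scaleC (1/2) (\<eta> + scaleC c \<xi>)" for c
    have A: "bounded_clinear A"
      unfolding A_def by (rule bounded_clinear_elem_op[OF a b HS_ballD(1)[OF x]])
    have *: "cmod (c * cinner (A (\<zeta> c)) (\<zeta> c)) \<le> e / 4" if c: "cmod c = 1" for c
    proof -
      have "norm (\<eta> + scaleC c \<xi>) \<le> 1 + 1"
        using \<xi> \<eta> c by (intro norm_triangle_mono) (auto simp: wball_def norm_scaleC)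
      moreover have "cmod (cinner \<eta> z + c * cinner \<xi> z) < \<delta> * 2" if "z \<in> Z" for z
      proof -
        have "cmod (cinner \<eta> z) < \<delta>" "cmod (cinner \<xi> z) < \<delta>"
          using \<xi> \<eta> that by (auto simp: wball_def)
        then show ?thesis
          using norm_triangle_ineq[of "cinner \<eta> z" "c * cinner \<xi> z"] c by (simp add: norm_mult)
      qed
      then have "cmod (cinner (\<zeta> c) z) < \<delta>" if "z \<in> Z" for z
        using that by (simp add: \<zeta>_def cinner_simps norm_mult norm_divide)
      ultimately have "\<zeta> c \<in> wball Z \<delta>"
        unfolding wball_def mem_Collect_eq by (intro conjI ballI) (simp add: \<zeta>_def norm_scaleC, blast)
      from Z(3)[OF this] have "hsT l a b (\<zeta> c) (\<zeta> c) < e / 4"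
        unfolding real_norm_def abs_of_nonneg[OF hsnorm_ge_0[OF finite_lessThan]] .
      then show ?thesis
        using HS_ball_elem_op_le[OF a x, of b "\<zeta> c" "\<zeta> c"] by (simp add: A_def norm_mult c)
    qed
    have "cmod (cinner (A \<eta>) \<xi>) \<le> (\<Sum>c\<in>{1, -1, \<i>, -\<i>}. cmod (c * cinner (A (\<zeta> c)) (\<zeta> c)))"
      unfolding cinner_polarization[OF A, of \<eta> \<xi>] \<zeta>_def by (rule norm_sum)
    also have "\<dots> \<le> (\<Sum>c\<in>{1, -1, \<i>, -\<i>}. e / 4)"
      by (intro sum_mono *) auto
    also have "\<dots> = e"
      unfolding sum_fourth_roots by simp
    finally show "cmod (cinner (elem_op l a b x (snd (\<xi>, \<eta>))) (fst (\<xi>, \<eta>))) \<le> e"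
      by (simp add: A_def)
  qed
qed

lemma hsT_diagonal_if_tendsto:
  assumes "((\<lambda>p. hsT l a b (fst p) (snd p)) \<longlongrightarrow> 0) (wnhds \<times>\<^sub>F wnhds)"
  shows "((\<lambda>\<xi>. hsT l a b \<xi> \<xi>) \<longlongrightarrow> 0) wnhds"
proof -
  have "filterlim (\<lambda>\<xi>. (\<xi>, \<xi>)) (wnhds \<times>\<^sub>F wnhds) wnhds"
    by (intro filterlim_Pair filterlim_ident)
  from filterlim_compose[OF assms this] show ?thesis by simp
qed

lemma continuity_iff_small_op:
  fixes a b :: "nat \<Rightarrow> 'a::chilbert_space \<Rightarrow> 'a"
  assumes a: "\<forall>j<l. bounded_clinear (a j)" and b: "\<forall>j<l. bounded_clinear (b j)"
  shows "limitin euclidean (fT l a b) (fT l a b (0, 0))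
      (atin (prod_topology weak_ball_topology weak_ball_topology) (0, 0)) \<longleftrightarrow> small_op (elem_op l a b)"
    and "limitin euclidean (\<lambda>\<xi>. fT l a b (\<xi>, \<xi>)) (fT l a b (0, 0)) (atin weak_ball_topology 0)
      \<longleftrightarrow> small_op (elem_op l a b)"
proof -
  note z = fT_zero[OF b, of a]
  show "limitin euclidean (fT l a b) (fT l a b (0, 0))
      (atin (prod_topology weak_ball_topology weak_ball_topology) (0, 0)) \<longleftrightarrow> small_op (elem_op l a b)"
    unfolding z limitin_weak_ball_prod_iff[of "fT l a b", OF z] small_op_iff_hsT[OF a]
    using fT_tendsto_iff_hsT[of l a b fst snd "wnhds \<times>\<^sub>F wnhds"] by simp
  show "limitin euclidean (\<lambda>\<xi>. fT l a b (\<xi>, \<xi>)) (fT l a b (0, 0)) (atin weak_ball_topology 0)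
      \<longleftrightarrow> small_op (elem_op l a b)"
    unfolding z limitin_weak_ball_iff[of "\<lambda>\<xi>. fT l a b (\<xi>, \<xi>)", OF z] fT_tendsto_iff_hsT
  proof
    show "small_op (elem_op l a b)" if "((\<lambda>\<xi>. hsT l a b \<xi> \<xi>) \<longlongrightarrow> 0) wnhds"
      by (rule hsT_tendsto_if_diagonal[OF a b that])
    show "((\<lambda>\<xi>. hsT l a b \<xi> \<xi>) \<longlongrightarrow> 0) wnhds" if "small_op (elem_op l a b)"
      by (rule hsT_diagonal_if_tendsto) (use that small_op_iff_hsT[OF a, of b] in simp)
  qed
qed

section \<open>Smallness and compact coefficients\<close>

text \<open>Tychonoff. This provides the compactness for coefficient vectors, for sesquilinear forms
  and for functionals.\<close>

lemma compact_Pi_cball: "compact {f :: 'i \<Rightarrow> complex. \<forall>i. cmod (f i) \<le> r i}"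
proof -
  have "compactin (product_topology (\<lambda>i. euclidean) UNIV) (\<Pi>\<^sub>E i\<in>UNIV. cball (0::complex) (r i))"
    unfolding compactin_PiE by (intro disjI2 ballI) simp
  moreover have "(\<Pi>\<^sub>E i\<in>UNIV. cball (0::complex) (r i)) = {f. \<forall>i. cmod (f i) \<le> r i}"
    by (auto simp: PiE_def Pi_def)
  ultimately show ?thesis
    unfolding euclidean_product_topology by simp
qed

text \<open>Products of discs need not be sequentially compact, so cluster points take the role of
  limits of subsequences.\<close>

lemma cluster_point_exists:
  fixes f :: "nat \<Rightarrow> 'b::topological_space"
  assumes "compact S" "\<And>n. f n \<in> S"
  obtains p where "p \<in> S" "\<forall>U N. open U \<longrightarrow> p \<in> U \<longrightarrow> (\<exists>n\<ge>N. f n \<in> U)"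
proof -
  have "filtermap f sequentially \<noteq> bot" "eventually (\<lambda>x. x \<in> S) (filtermap f sequentially)"
    using assms(2) by (auto simp: filtermap_bot_iff eventually_filtermap)
  with assms(1) obtain p where p: "p \<in> S" "inf (nhds p) (filtermap f sequentially) \<noteq> bot"
    unfolding compact_filter by blast
  have "\<exists>n\<ge>N. f n \<in> U" if U: "open U" "p \<in> U" for U N
  proof (rule ccontr)
    assume "\<not> (\<exists>n\<ge>N. f n \<in> U)"
    then have "eventually (\<lambda>x. x \<notin> U) (filtermap f sequentially)"
      by (auto simp: eventually_filtermap eventually_sequentially)
    moreover have "eventually (\<lambda>x. x \<in> U) (nhds p)"
      using U by (rule eventually_nhds_in_open)
    ultimately have "eventually (\<lambda>x. False) (inf (nhds p) (filtermap f sequentially))"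
      unfolding eventually_inf by blast
    then show False using p(2) by (simp add: trivial_limit_def)
  qed
  with p(1) show ?thesis using that by blast
qed

lemma open_coord:
  fixes U :: "'b::topological_space set"
  shows "open U \<Longrightarrow> open {f :: 'i \<Rightarrow> 'b. f i \<in> U}"
  using open_vimage[of U "\<lambda>f. f i"] continuous_on_product_coordinates[of i] by (simp add: vimage_def)

lemma hsnorm_swap: "hsnorm I v u = hsnorm I u v"
  unfolding hsnorm_def hsip_def by (subst sum.swap) (simp add: mult.commute)

definition compact_rep :: "nat \<Rightarrow> (('a::complex_inner \<Rightarrow> 'a) \<Rightarrow> 'a \<Rightarrow> 'a) \<Rightarrow> bool" where
  "compact_rep l T \<longleftrightarrow> (\<exists>c d m. m \<le> l \<and> (\<forall>j<l. compact_op (c j)) \<and> (\<forall>j<l. bounded_clinear (d j)) \<and>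
     (\<forall>x. bounded_clinear x \<longrightarrow>
        T x = (\<lambda>h. (\<Sum>j<m. c j (x (d j h))) + (\<Sum>j\<in>{m..<l}. d j (x (c j h))))))"

lemma HS_ball_left_compact_le:
  fixes c d x :: "'a::chilbert_space \<Rightarrow> 'a"
  assumes c: "bounded_clinear c" and d: "bounded_clinear d" and x: "x \<in> HS_ball" and "norm \<eta> \<le> 1"
  shows "cmod (cinner (c (x (d \<eta>))) \<xi>) \<le> onorm d * norm (cadjoint c \<xi>)"
proof -
  have "cmod (cinner (c (x (d \<eta>))) \<xi>) \<le> norm (x (d \<eta>)) * norm (cadjoint c \<xi>)"
    unfolding cadjoint[OF c] by (rule cinner_Cauchy_Schwarz)
  also have "\<dots> \<le> (onorm d * 1) * norm (cadjoint c \<xi>)"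
    using assms(4) onorm_nonneg[OF d]
    by (intro mult_right_mono order_trans[OF norm_HS_ball_le[OF x]] order_trans[OF norm_le_onorm[OF d]]
        mult_left_mono) auto
  finally show ?thesis by simp
qed

lemma HS_ball_right_compact_le:
  fixes c d x :: "'a::chilbert_space \<Rightarrow> 'a"
  assumes d: "bounded_clinear d" and x: "x \<in> HS_ball" and "norm \<xi> \<le> 1"
  shows "cmod (cinner (d (x (c \<eta>))) \<xi>) \<le> onorm d * norm (c \<eta>)"
proof -
  have "cmod (cinner (d (x (c \<eta>))) \<xi>) \<le> norm (d (x (c \<eta>))) * norm \<xi>"
    by (rule cinner_Cauchy_Schwarz)
  also have "\<dots> \<le> norm (d (x (c \<eta>))) * 1"
    using assms(3) by (intro mult_left_mono) auto
  also have "\<dots> \<le> onorm d * norm (x (c \<eta>))"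
    using norm_le_onorm[OF d] by simp
  also have "\<dots> \<le> onorm d * norm (c \<eta>)"
    by (intro mult_left_mono norm_HS_ball_le[OF x] onorm_nonneg[OF d])
  finally show ?thesis .
qed

lemma filterlim_fst_snd_wnhds:
  assumes "(f \<longlongrightarrow> L) wnhds"
  shows "((\<lambda>p. f (fst p)) \<longlongrightarrow> L) (wnhds \<times>\<^sub>F wnhds)" "((\<lambda>p. f (snd p)) \<longlongrightarrow> L) (wnhds \<times>\<^sub>F wnhds)"
  using filterlim_compose[OF assms filterlim_fst] filterlim_compose[OF assms filterlim_snd] by auto

lemma eventually_prod_wnhds_norm_le:
  "\<forall>\<^sub>F p in wnhds \<times>\<^sub>F wnhds. norm (fst p) \<le> 1 \<and> norm (snd p) \<le> 1"
  unfolding eventually_prod_filter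
  by (rule exI[of _ "\<lambda>\<xi>. norm \<xi> \<le> 1"], rule exI[of _ "\<lambda>\<xi>. norm \<xi> \<le> 1"])
     (simp add: eventually_wnhds_norm_le)

lemma small_op_if_dominated:
  fixes T :: "('a::chilbert_space \<Rightarrow> 'a) \<Rightarrow> 'a \<Rightarrow> 'a"
  assumes lim: "(g \<longlongrightarrow> 0) (wnhds \<times>\<^sub>F wnhds)"
    and le: "\<And>\<xi> \<eta> x. norm \<xi> \<le> 1 \<Longrightarrow> norm \<eta> \<le> 1 \<Longrightarrow> x \<in> HS_ball \<Longrightarrow> cmod (cinner (T x \<eta>) \<xi>) \<le> g (\<xi>, \<eta>)"
  shows "small_op T"
  unfolding small_op_def
proof (intro allI impI)
  fix e :: real assume "0 < e"
  from eventually_conj[OF tendstoD[OF lim this] eventually_prod_wnhds_norm_le]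
  show "\<forall>\<^sub>F p in wnhds \<times>\<^sub>F wnhds. \<forall>x\<in>HS_ball. cmod (cinner (T x (snd p)) (fst p)) \<le> e"
  proof (rule eventually_mono, intro ballI)
    fix p :: "'a \<times> 'a" and x :: "'a \<Rightarrow> 'a"
    assume p: "dist (g p) 0 < e \<and> norm (fst p) \<le> 1 \<and> norm (snd p) \<le> 1" and x: "x \<in> HS_ball"
    have "cmod (cinner (T x (snd p)) (fst p)) \<le> g (fst p, snd p)"
      by (rule le) (use p x in auto)
    also have "\<dots> \<le> e" using p by auto
    finally show "cmod (cinner (T x (snd p)) (fst p)) \<le> e" .
  qed
qed

lemma small_op_diff:
  assumes "small_op S" "small_op T" "\<And>x h. x \<in> HS_ball \<Longrightarrow> R x h = S x h - T x h"
  shows "small_op R"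
  unfolding small_op_def
proof (intro allI impI)
  fix e :: real assume "0 < e"
  then have "0 < e / 2" by simp
  with assms(1,2) have
    "\<forall>\<^sub>F p in wnhds \<times>\<^sub>F wnhds. \<forall>x\<in>HS_ball. cmod (cinner (S x (snd p)) (fst p)) \<le> e / 2"
    "\<forall>\<^sub>F p in wnhds \<times>\<^sub>F wnhds. \<forall>x\<in>HS_ball. cmod (cinner (T x (snd p)) (fst p)) \<le> e / 2"
    unfolding small_op_def by blast+
  from eventually_conj[OF this]
  show "\<forall>\<^sub>F p in wnhds \<times>\<^sub>F wnhds. \<forall>x\<in>HS_ball. cmod (cinner (R x (snd p)) (fst p)) \<le> e"
  proof (rule eventually_mono, intro ballI)
    fix p :: "'a \<times> 'a" and x :: "'a \<Rightarrow> 'a"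
    assume p: "(\<forall>x\<in>HS_ball. cmod (cinner (S x (snd p)) (fst p)) \<le> e / 2) \<and>
      (\<forall>x\<in>HS_ball. cmod (cinner (T x (snd p)) (fst p)) \<le> e / 2)" and x: "x \<in> HS_ball"
    have "cmod (cinner (S x (snd p)) (fst p)) \<le> e / 2" "cmod (cinner (T x (snd p)) (fst p)) \<le> e / 2"
      using p x by blast+
    then show "cmod (cinner (R x (snd p)) (fst p)) \<le> e"
      using norm_triangle_ineq4[of "cinner (S x (snd p)) (fst p)" "cinner (T x (snd p)) (fst p)"]
      by (simp add: assms(3)[OF x] cinner_diff_left)
  qed
qed

lemma small_op_right_compact:
  fixes c d :: "'a::chilbert_space \<Rightarrow> 'a"
  assumes c: "compact_op c" and d: "bounded_clinear d"
  shows "small_op (\<lambda>x h. d (x (c h)))"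
proof (rule small_op_if_dominated)
  show "((\<lambda>p. onorm d * norm (c (snd p))) \<longlongrightarrow> 0) (wnhds \<times>\<^sub>F wnhds)"
    by (intro tendsto_mult_right_zero tendsto_norm_zero
        filterlim_fst_snd_wnhds(2)[OF compact_op_tendsto_wnhds[OF c]])
qed (simp add: HS_ball_right_compact_le[OF d])

text \<open>A compact left factor is controlled by its adjoint at \<open>\<xi>\<close>, a compact
  right factor by its value at \<open>\<eta>\<close>; both tend to 0 in norm.\<close>

lemma small_op_if_compact_rep:
  fixes T :: "('a::chilbert_space \<Rightarrow> 'a) \<Rightarrow> 'a \<Rightarrow> 'a"
  assumes "compact_rep l T"
  shows "small_op T"
proof -
  obtain c d m where m: "m \<le> l" and c: "\<And>j. j < l \<Longrightarrow> compact_op (c j)"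
    and d: "\<And>j. j < l \<Longrightarrow> bounded_clinear (d j)"
    and T: "\<And>x. bounded_clinear x \<Longrightarrow>
       T x = (\<lambda>h. (\<Sum>j<m. c j (x (d j h))) + (\<Sum>j\<in>{m..<l}. d j (x (c j h))))"
    using assms unfolding compact_rep_def by blast
  define g where "g p = (\<Sum>j<m. onorm (d j) * norm (cadjoint (c j) (fst p)))
     + (\<Sum>j\<in>{m..<l}. onorm (d j) * norm (c j (snd p)))" for p
  show ?thesis
  proof (rule small_op_if_dominated[of g])
    have c1: "((\<lambda>p. cadjoint (c j) (fst p)) \<longlongrightarrow> 0) (wnhds \<times>\<^sub>F wnhds)" if "j < l" for j
      by (rule filterlim_fst_snd_wnhds(1)[OF compact_op_cadjoint_tendsto_wnhds[OF c[OF that]]])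
    have c2: "((\<lambda>p. c j (snd p)) \<longlongrightarrow> 0) (wnhds \<times>\<^sub>F wnhds)" if "j < l" for j
      by (rule filterlim_fst_snd_wnhds(2)[OF compact_op_tendsto_wnhds[OF c[OF that]]])
    show "(g \<longlongrightarrow> 0) (wnhds \<times>\<^sub>F wnhds)"
      unfolding g_def using m
      by (intro tendsto_add_zero tendsto_null_sum tendsto_mult_right_zero tendsto_norm_zero c1 c2) auto
  next
    fix \<xi> \<eta> :: 'a and x :: "'a \<Rightarrow> 'a"
    assume \<xi>: "norm \<xi> \<le> 1" and \<eta>: "norm \<eta> \<le> 1" and x: "x \<in> HS_ball"
    have "cinner (T x \<eta>) \<xi> = (\<Sum>j<m. cinner (c j (x (d j \<eta>))) \<xi>) + (\<Sum>j\<in>{m..<l}. cinner (d j (x (c j \<eta>))) \<xi>)"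
      by (simp add: T[OF HS_ballD(1)[OF x]] cinner_add_left cinner_sum_left)
    also have "cmod \<dots> \<le> g (\<xi>, \<eta>)"
      unfolding g_def fst_conv snd_conv
    proof (intro norm_triangle_mono sum_norm_le)
      fix j assume "j \<in> {..<m}"
      then have "j < l" using m by auto
      then show "cmod (cinner (c j (x (d j \<eta>))) \<xi>) \<le> onorm (d j) * norm (cadjoint (c j) \<xi>)"
        by (intro HS_ball_left_compact_le x \<eta> d compact_op_bounded_clinear c)
    next
      fix j assume "j \<in> {m..<l}"
      then show "cmod (cinner (d j (x (c j \<eta>))) \<xi>) \<le> onorm (d j) * norm (c j \<eta>)"
        by (intro HS_ball_right_compact_le x \<xi> d) auto
    qed
    finally show "cmod (cinner (T x \<eta>) \<xi>) \<le> g (\<xi>, \<eta>)" .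
  qed
qed

section \<open>Compact linear combinations of the right coefficients\<close>

lemma finite_common_bound:
  fixes n :: nat
  assumes "\<forall>j<n. bounded_clinear (f j)"
  obtains C where "0 < C" "\<And>j h. j < n \<Longrightarrow> norm (f j h) \<le> C * norm h"
proof -
  define C where "C = 1 + (\<Sum>j<n. onorm (f j))"
  have nn: "0 \<le> onorm (f j)" if "j < n" for j using assms that onorm_nonneg by blast
  then have "0 < C" unfolding C_def by (intro add_pos_nonneg sum_nonneg) auto
  moreover have "norm (f j h) \<le> C * norm h" if j: "j < n" for j h
  proof -
    have "onorm (f j) \<le> (\<Sum>j<n. onorm (f j))"
      using j nn by (intro member_le_sum) auto
    then have "onorm (f j) * norm h \<le> C * norm h"
      unfolding C_def by (intro mult_right_mono) auto
    moreover have "norm (f j h) \<le> onorm (f j) * norm h" using assms j norm_le_onorm by blast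
    ultimately show ?thesis by linarith
  qed
  ultimately show ?thesis by (rule that)
qed

text \<open>Take \<open>\<xi>\<close> weakly small with \<open>h = cadjoint (a k) \<xi>\<close>
  bounded away from 0. The operator of the transposed tensor maps \<open>h\<close> to a combination
  of the \<open>b i \<eta>\<close>, which is as small as the tensor, while its coefficient at
  \<open>k\<close> is |h|^2. The coefficients stay in a compact set, and at a cluster point the
  combination tends to 0, hence is compact.\<close>

lemma compact_combination_exists:
  fixes a b :: "nat \<Rightarrow> 'a::chilbert_space \<Rightarrow> 'a"
  assumes a: "\<forall>j<n. bounded_clinear (a j)" and b: "\<forall>j<n. bounded_clinear (b j)"
    and small: "small_op (elem_op n a b)" and k: "k < n" "\<not> compact_op (a k)"
  obtains s where "s k \<noteq> 0" "compact_op (\<lambda>h. \<Sum>i<n. scaleC (s i) (b i h))"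
proof -
  have lim: "((\<lambda>p. hsT n a b (fst p) (snd p)) \<longlongrightarrow> 0) (wnhds \<times>\<^sub>F wnhds)"
    using small small_op_iff_hsT[OF a] by blast
  have ak: "bounded_clinear (a k)" using a k by blast
  have "\<not> (cadjoint (a k) \<longlongrightarrow> 0) wnhds"
  proof
    assume "(cadjoint (a k) \<longlongrightarrow> 0) wnhds"
    then have "compact_op (cadjoint (a k))"
      by (simp add: compact_op_iff_tendsto_wnhds bounded_clinear_cadjoint[OF ak])
    from compact_op_cadjoint[OF this] k(2) show False
      by (simp add: cadjoint_cadjoint[OF ak])
  qed
  then obtain r where r: "0 < r"
    and nr: "\<not> (\<exists>Z \<delta>. finite Z \<and> 0 < \<delta> \<and> (\<forall>\<xi>\<in>wball Z \<delta>. norm (cadjoint (a k) \<xi>) < r))"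
    unfolding tendsto_wnhds_iff by blast
  \<comment> \<open>Since \<open>a k\<close> is not compact, neither is its adjoint, so every weak
    neighbourhood of 0 contains such a vector.\<close>
  have big: "\<exists>\<xi>\<in>wball Z \<delta>. r \<le> norm (cadjoint (a k) \<xi>)" if "finite Z" "0 < \<delta>" for Z \<delta>
  proof (rule ccontr)
    assume "\<not> (\<exists>\<xi>\<in>wball Z \<delta>. r \<le> norm (cadjoint (a k) \<xi>))"
    then have "\<forall>\<xi>\<in>wball Z \<delta>. norm (cadjoint (a k) \<xi>) < r" by (simp add: not_le)
    with that nr show False by blast
  qed
  have aadj: "\<forall>j<n. bounded_clinear (cadjoint (a j))"
    using a bounded_clinear_cadjoint by blast
  obtain A where A: "0 < A" "\<And>j h. j < n \<Longrightarrow> norm (cadjoint (a j) h) \<le> A * norm h"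
    using finite_common_bound[OF aadj] by blast
  obtain B where B: "0 < B" "\<And>j h. j < n \<Longrightarrow> norm (b j h) \<le> B * norm h"
    using finite_common_bound[OF b] by blast
  have "\<forall>N. \<exists>s. (\<forall>i. cmod (s i) \<le> A * A) \<and> r\<^sup>2 \<le> Re (s k) \<and>
      (\<forall>\<^sub>F \<eta> in wnhds. norm (\<Sum>i<n. scaleC (s i) (b i \<eta>)) \<le> A / real (Suc N))"
  proof
    fix N
    have "0 < 1 / real (Suc N)" by simp
    from tendstoD[OF lim this] obtain Pf Pg where P: "eventually Pf wnhds" "eventually Pg wnhds"
      "\<And>\<xi> \<eta>. Pf \<xi> \<Longrightarrow> Pg \<eta> \<Longrightarrow> hsT n a b \<xi> \<eta> < 1 / real (Suc N)"
      unfolding eventually_prod_filter by auto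
    from P(1) obtain Z \<delta> where "finite Z" "0 < \<delta>" "\<forall>\<xi>\<in>wball Z \<delta>. Pf \<xi>"
      unfolding eventually_wnhds by blast
    with big obtain \<xi> where \<xi>: "\<xi> \<in> wball Z \<delta>" "Pf \<xi>" "r \<le> norm (cadjoint (a k) \<xi>)" by blast
    define h where "h = cadjoint (a k) \<xi>"
    \<comment> \<open>The value 0 from index \<open>n\<close> on lets the whole function
      \<open>s\<close> obey the bound \<open>A * A\<close>.\<close>
    define s where "s i = (if i < n then cinner h (cadjoint (a i) \<xi>) else 0)" for i
    have nA: "norm (cadjoint (a i) \<xi>) \<le> A" if "i < n" for i
    proof -
      have "A * norm \<xi> \<le> A * 1" using A(1) \<xi>(1) by (intro mult_left_mono) (auto simp: wball_def)
      then show ?thesis using A(2)[OF that, of \<xi>] by simp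
    qed
    have nh: "norm h \<le> A" unfolding h_def by (rule nA[OF k(1)])
    have "cmod (s i) \<le> A * A" for i
    proof (cases "i < n")
      case True
      have "cmod (s i) \<le> norm h * norm (cadjoint (a i) \<xi>)"
        using True by (simp add: s_def cinner_Cauchy_Schwarz)
      also have "\<dots> \<le> A * A" using nh nA[OF True] A(1) by (intro mult_mono) auto
      finally show ?thesis .
    qed (use A(1) in \<open>simp add: s_def\<close>)
    moreover have "r\<^sup>2 \<le> Re (s k)"
      using k(1) \<xi>(3) r by (simp add: s_def cinner_self flip: h_def)
    moreover have "\<forall>\<^sub>F \<eta> in wnhds. norm (\<Sum>i<n. scaleC (s i) (b i \<eta>)) \<le> A / real (Suc N)"
      using P(2)
    proof (rule eventually_mono)
      fix \<eta> assume "Pg \<eta>"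
      have "(\<Sum>i<n. scaleC (s i) (b i \<eta>)) = tensor_op {..<n} (\<lambda>j. b j \<eta>) (\<lambda>j. cadjoint (a j) \<xi>) h"
        by (simp add: tensor_op_def s_def)
      then have "norm (\<Sum>i<n. scaleC (s i) (b i \<eta>)) \<le> hsnorm {..<n} (\<lambda>j. b j \<eta>) (\<lambda>j. cadjoint (a j) \<xi>) * norm h"
        using norm_tensor_op_le[of "{..<n}"] by simp
      also have "\<dots> = hsT n a b \<xi> \<eta> * norm h"
        by (simp only: hsnorm_swap)
      also have "\<dots> \<le> (1 / real (Suc N)) * A"
        using P(3)[OF \<xi>(2) \<open>Pg \<eta>\<close>] nh by (intro mult_mono) auto
      finally show "norm (\<Sum>i<n. scaleC (s i) (b i \<eta>)) \<le> A / real (Suc N)" by simp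
    qed
    ultimately show "\<exists>s. (\<forall>i. cmod (s i) \<le> A * A) \<and> r\<^sup>2 \<le> Re (s k) \<and>
      (\<forall>\<^sub>F \<eta> in wnhds. norm (\<Sum>i<n. scaleC (s i) (b i \<eta>)) \<le> A / real (Suc N))"
      by (intro exI[of _ s] conjI allI)
  qed
  from choice[OF this] obtain s where s': "\<forall>N. (\<forall>i. cmod (s N i) \<le> A * A) \<and> r\<^sup>2 \<le> Re (s N k) \<and>
      (\<forall>\<^sub>F \<eta> in wnhds. norm (\<Sum>i<n. scaleC (s N i) (b i \<eta>)) \<le> A / real (Suc N))"
    by (elim exE)
  have s: "cmod (s N i) \<le> A * A" "r\<^sup>2 \<le> Re (s N k)"
    "\<forall>\<^sub>F \<eta> in wnhds. norm (\<Sum>i<n. scaleC (s N i) (b i \<eta>)) \<le> A / real (Suc N)" for N i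
    using s'[rule_format, of N] by blast+
  have inS: "s N \<in> {f. \<forall>i. cmod (f i) \<le> A * A}" for N using s(1) by simp
  obtain p where "p \<in> {f. \<forall>i. cmod (f i) \<le> A * A}"
    and p': "\<forall>U N. open U \<longrightarrow> p \<in> U \<longrightarrow> (\<exists>m\<ge>N. s m \<in> U)"
    by (rule cluster_point_exists[where f = s, OF compact_Pi_cball inS])
  note p = p'[rule_format]
  have "p k \<noteq> 0"
  proof
    assume "p k = 0"
    then have "p \<in> {f. f k \<in> ball 0 (r\<^sup>2)}" using r by simp
    then obtain m where "s m k \<in> ball 0 (r\<^sup>2)"
      using p[OF open_coord[OF open_ball], of k 0 "r\<^sup>2" 0] by auto
    then show False
      using s(2)[of m] complex_Re_le_cmod[of "s m k"] by simp
  qed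
  moreover have "compact_op (\<lambda>h. \<Sum>i<n. scaleC (p i) (b i h))"
  proof (rule compact_op_if_tendsto_wnhds)
    show "bounded_clinear (\<lambda>h. \<Sum>i<n. scaleC (p i) (b i h))"
      using b by (intro bounded_clinear_setsum bounded_clinear_scale) auto
    show "((\<lambda>h. \<Sum>i<n. scaleC (p i) (b i h)) \<longlongrightarrow> 0) wnhds"
    proof (rule tendstoI)
      fix e :: real assume e: "0 < e"
      \<comment> \<open>At most \<open>n\<close> coefficient errors of size \<open>e'\<close>,
        against vectors of norm at most \<open>B\<close>, cost no more than \<open>e / 3\<close> in
        total.\<close>
      define e' where "e' = e / 3 / (real n + 1) / B"
      have e': "0 < e'" using e B(1) by (simp add: e'_def)
      have eB: "e' * B = e / 3 / (real n + 1)" using B(1) by (simp add: e'_def)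
      obtain N where N: "A / real (Suc N) < e / 3"
      proof -
        obtain N where "A / (e / 3) < real N" using reals_Archimedean2 by blast
        then have "A / real (Suc N) < e / 3"
          using e A(1) by (simp add: field_simps)
        then show ?thesis by (rule that)
      qed
      have "open (\<Inter>i\<in>{..<n}. {f. f i \<in> ball (p i) e'})"
        by (intro open_INT ballI open_coord open_ball finite_lessThan)
      from p[OF this, of N] e' obtain m where m: "m \<ge> N" "\<And>i. i < n \<Longrightarrow> s m i \<in> ball (p i) e'"
        by auto
      have "A / real (Suc m) \<le> A / real (Suc N)"
        using m(1) A(1) by (intro divide_left_mono) auto
      from this N have Nm: "A / real (Suc m) < e / 3" by (rule order_le_less_trans)
      from eventually_conj[OF s(3)[of m] eventually_wnhds_norm_le]
      show "\<forall>\<^sub>F \<eta> in wnhds. dist (\<Sum>i<n. scaleC (p i) (b i \<eta>)) 0 < e"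
      proof (rule eventually_mono)
        fix \<eta> :: 'a
        assume \<eta>: "norm (\<Sum>i<n. scaleC (s m i) (b i \<eta>)) \<le> A / real (Suc m) \<and> norm \<eta> \<le> 1"
        have "(\<Sum>i<n. scaleC (p i) (b i \<eta>))
            = (\<Sum>i<n. scaleC (s m i) (b i \<eta>)) + (\<Sum>i<n. scaleC (p i - s m i) (b i \<eta>))"
          by (simp add: sum.distrib[symmetric] scaleC_add_left[symmetric])
        also have "norm \<dots> \<le> A / real (Suc m) + (\<Sum>i<n. e' * B)"
        proof (intro norm_triangle_mono sum_norm_le)
          fix i assume "i \<in> {..<n}"
          then have i: "i < n" by simp
          have "norm (b i \<eta>) \<le> B"
          proof -
            have "B * norm \<eta> \<le> B * 1" using B(1) \<eta> by (intro mult_left_mono) auto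
            then show ?thesis using B(2)[OF i, of \<eta>] by simp
          qed
          then show "norm (scaleC (p i - s m i) (b i \<eta>)) \<le> e' * B"
            using m(2)[OF i] e' unfolding norm_scaleC by (intro mult_mono) (auto simp: dist_norm)
        qed (use \<eta> in simp)
        also have "(\<Sum>i<n. e' * B) = (real n / (real n + 1)) * (e / 3)"
          unfolding eB by simp
        also have "\<dots> \<le> 1 * (e / 3)"
          using e by (intro mult_right_mono) auto
        finally show "dist (\<Sum>i<n. scaleC (p i) (b i \<eta>)) 0 < e"
          unfolding dist_norm diff_zero using Nm e by linarith
      qed
    qed
  qed
  ultimately show ?thesis by (rule that)
qed

text \<open>The increasing enumeration of the indices other than \<open>k\<close>.\<close>

definition skip :: "nat \<Rightarrow> nat \<Rightarrow> nat" where
  "skip k i = (if i < k then i else Suc i)"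

lemma bij_betw_skip:
  assumes "k \<le> l"
  shows "bij_betw (skip k) {..<l} ({..<Suc l} - {k})"
proof (rule bij_betw_imageI)
  show "inj_on (skip k) {..<l}" by (auto simp: inj_on_def skip_def split: if_splits)
  show "skip k ` {..<l} = {..<Suc l} - {k}"
  proof (intro equalityI subsetI)
    fix j assume j: "j \<in> {..<Suc l} - {k}"
    show "j \<in> skip k ` {..<l}"
    proof (cases "j < k")
      case True
      then show ?thesis using assms by (intro image_eqI[of _ _ j]) (auto simp: skip_def)
    next
      case False
      then show ?thesis using j by (intro image_eqI[of _ _ "j - 1"]) (auto simp: skip_def)
    qed
  qed (use assms in \<open>auto simp: skip_def split: if_splits\<close>)
qed

lemma sum_skip:
  assumes "k \<le> l"
  shows "(\<Sum>i<Suc l. f i) = f k + (\<Sum>i<l. f (skip k i))"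
proof -
  have "(\<Sum>i<Suc l. f i) = f k + (\<Sum>i\<in>{..<Suc l} - {k}. f i)"
    using assms by (intro sum.remove) auto
  also have "(\<Sum>i\<in>{..<Suc l} - {k}. f i) = (\<Sum>i<l. f (skip k i))"
    by (rule sum.reindex_bij_betw[OF bij_betw_skip[OF assms], symmetric])
  finally show ?thesis .
qed

text \<open>If some \<open>a k\<close> is not compact, a linear combination \<open>c\<close> of the \<open>b i\<close> in which \<open>b k\<close> occurs
  is compact; solving for \<open>b k\<close> trades the \<open>k\<close>-th term for a term with compact right factor \<open>c\<close>.\<close>

lemma compact_rep_if_small_op:
  fixes a b :: "nat \<Rightarrow> 'a::chilbert_space \<Rightarrow> 'a"
  assumes "\<forall>j<l. bounded_clinear (a j)" "\<forall>j<l. bounded_clinear (b j)" "small_op (elem_op l a b)"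
  shows "compact_rep l (elem_op l a b)"
  using assms
proof (induction l arbitrary: a b)
  case 0
  then show ?case by (simp add: compact_rep_def elem_op_def)
next
  case (Suc l)
  note a = Suc.prems(1) and b = Suc.prems(2)
  show ?case
  proof (cases "\<forall>k<Suc l. compact_op (a k)")
    case True
    then show ?thesis
      unfolding compact_rep_def elem_op_def
      \<comment> \<open>All left factors are compact: \<open>m\<close> is the full length and the
        second sum is empty.\<close>
      using b by (intro exI[of _ a] exI[of _ b] exI[of _ "Suc l"]) simp
  next
    case False
    then obtain k where k: "k < Suc l" "\<not> compact_op (a k)" by blast
    obtain s where s: "s k \<noteq> 0" and comp: "compact_op (\<lambda>h. \<Sum>i<Suc l. scaleC (s i) (b i h))"
      using compact_combination_exists[OF a b Suc.prems(3) k] by blast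
    define c where "c = (\<lambda>h. \<Sum>i<Suc l. scaleC (s i) (b i h))"
    define d where "d = (\<lambda>h. scaleC (1 / s k) (a k h))"
    \<comment> \<open>Solving for the \<open>k\<close>-th right factor gives b_k = (c - sum of s_i
      b_i over the other i) / s_k. Substituted into the \<open>k\<close>-th term, this subtracts a
      multiple of \<open>a k\<close> from every other left factor and leaves
      \<open>d (x (c h))\<close>.\<close>
    define a' where "a' i = (\<lambda>h. a (skip k i) h - scaleC (s (skip k i) / s k) (a k h))" for i
    define b' where "b' i = b (skip k i)" for i
    have sk: "skip k i < Suc l" if "i < l" for i using that k by (simp add: skip_def)
    have kl: "k \<le> l" using k by simp
    have ak: "bounded_clinear (a k)" using a k by blast
    have d: "bounded_clinear d" unfolding d_def by (rule bounded_clinear_scale[OF ak])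
    have a': "\<forall>i<l. bounded_clinear (a' i)"
      unfolding a'_def using a sk by (intro allI impI bounded_clinear_sub bounded_clinear_scale ak) blast
    have b': "\<forall>i<l. bounded_clinear (b' i)"
      unfolding b'_def using b sk by blast
    have split: "elem_op (Suc l) a b x h = elem_op l a' b' x h + d (x (c h))" if x: "bounded_clinear x" for x h
    proof -
      have "a k (x (c h)) = (\<Sum>i<Suc l. scaleC (s i) (a k (x (b i h))))"
        unfolding c_def bounded_clinear_sum[OF x] bounded_clinear_sum[OF ak]
        by (intro sum.cong) (simp_all add: bounded_clinear_scaleC[OF x] bounded_clinear_scaleC[OF ak])
      also have "\<dots> = scaleC (s k) (a k (x (b k h))) + (\<Sum>i<l. scaleC (s (skip k i)) (a k (x (b' i h))))"
        unfolding sum_skip[OF kl] b'_def ..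
      finally have "d (x (c h)) = a k (x (b k h)) + (\<Sum>i<l. scaleC (s (skip k i) / s k) (a k (x (b' i h))))"
        using s by (simp add: d_def scaleC_add_right scaleC_sum_right scaleC_scaleC scaleC_one)
      moreover have "elem_op l a' b' x h = (\<Sum>i<l. a (skip k i) (x (b' i h)))
          - (\<Sum>i<l. scaleC (s (skip k i) / s k) (a k (x (b' i h))))"
        by (simp add: elem_op_def a'_def sum_subtractf)
      moreover have "elem_op (Suc l) a b x h = a k (x (b k h)) + (\<Sum>i<l. a (skip k i) (x (b' i h)))"
        unfolding elem_op_def sum_skip[OF kl] b'_def ..
      ultimately show ?thesis by simp
    qed
    have "compact_op c" using comp by (simp only: c_def)
    \<comment> \<open>The term split off is itself small because \<open>c\<close> is compact, so the
      shorter operator inherits smallness.\<close>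
    have "small_op (elem_op l a' b')"
      by (rule small_op_diff[OF Suc.prems(3) small_op_right_compact[OF \<open>compact_op c\<close> d]])
         (simp add: split HS_ballD(1))
    from Suc.IH[OF a' b' this] obtain c' d' m where m: "m \<le> l" and c': "\<forall>j<l. compact_op (c' j)"
      and d': "\<forall>j<l. bounded_clinear (d' j)"
      and T: "\<And>x. bounded_clinear x \<Longrightarrow> elem_op l a' b' x
        = (\<lambda>h. (\<Sum>j<m. c' j (x (d' j h))) + (\<Sum>j\<in>{m..<l}. d' j (x (c' j h))))"
      unfolding compact_rep_def by blast
    \<comment> \<open>The new pair gets the index \<open>l\<close>, which is at least
      \<open>m\<close>, and so joins the sum with compact right factors.\<close>
    define c'' where "c'' = c'(l := c)"
    define d'' where "d'' = d'(l := d)"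
    have "elem_op (Suc l) a b x
        = (\<lambda>h. (\<Sum>j<m. c'' j (x (d'' j h))) + (\<Sum>j\<in>{m..<Suc l}. d'' j (x (c'' j h))))"
      if x: "bounded_clinear x" for x
    proof
      fix h
      have "(\<Sum>j<m. c'' j (x (d'' j h))) = (\<Sum>j<m. c' j (x (d' j h)))"
        using m by (intro sum.cong) (auto simp: c''_def d''_def)
      moreover have "(\<Sum>j\<in>{m..<l}. d'' j (x (c'' j h))) = (\<Sum>j\<in>{m..<l}. d' j (x (c' j h)))"
        by (intro sum.cong) (auto simp: c''_def d''_def)
      then have "(\<Sum>j\<in>{m..<Suc l}. d'' j (x (c'' j h))) = (\<Sum>j\<in>{m..<l}. d' j (x (c' j h))) + d (x (c h))"
        using m by (simp add: c''_def d''_def)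
      ultimately show "elem_op (Suc l) a b x h
        = (\<Sum>j<m. c'' j (x (d'' j h))) + (\<Sum>j\<in>{m..<Suc l}. d'' j (x (c'' j h)))"
        by (simp only: split[OF x] T[OF x] add.assoc)
    qed
    moreover have "\<forall>j<Suc l. compact_op (c'' j)" "\<forall>j<Suc l. bounded_clinear (d'' j)"
      using c' d' d \<open>compact_op c\<close> by (auto simp: c''_def d''_def less_Suc_eq)
    ultimately show ?thesis
      unfolding compact_rep_def using m
      by (intro exI[of _ c''] exI[of _ d''] exI[of _ m] conjI allI impI) auto
  qed
qed

section \<open>Compact coefficients imply weak compactness\<close>

abbreviation KHdual :: "(('a::complex_inner \<Rightarrow> 'a) \<Rightarrow> complex) set" where
  "KHdual \<equiv> cdual KH op_add op_scale onorm"

lemma cdual_mono: "Y \<subseteq> X \<Longrightarrow> cdual X add sc nrm \<subseteq> cdual Y add sc nrm"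
  unfolding cdual_def by blast

lemma KHdual_bound:
  assumes "\<phi> \<in> KHdual"
  obtains C where "0 < C" "\<And>f. compact_op f \<Longrightarrow> cmod (\<phi> f) \<le> C * onorm f"
proof -
  obtain C where C: "\<And>f. compact_op f \<Longrightarrow> cmod (\<phi> f) \<le> C * onorm f"
    using assms unfolding cdual_def by auto
  have "cmod (\<phi> f) \<le> (\<bar>C\<bar> + 1) * onorm f" if "compact_op f" for f
  proof -
    have "C * onorm f \<le> (\<bar>C\<bar> + 1) * onorm f"
      using onorm_nonneg[OF compact_op_bounded_clinear[OF that]] by (intro mult_right_mono) auto
    then show ?thesis using C[OF that] by linarith
  qed
  moreover have "0 < \<bar>C\<bar> + 1" by simp
  ultimately show ?thesis using that by blast
qed

lemma KHdual_add:
  assumes "\<phi> \<in> KHdual" "compact_op f" "compact_op g"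
  shows "\<phi> (\<lambda>h. f h + g h) = \<phi> f + \<phi> g"
  using assms unfolding cdual_def op_add_def by simp

lemma KHdual_scale:
  assumes "\<phi> \<in> KHdual" "compact_op f"
  shows "\<phi> (\<lambda>h. scaleC c (f h)) = c * \<phi> f"
  using assms unfolding cdual_def op_scale_def by simp

lemma compact_op_zero: "compact_op (\<lambda>h. 0 :: 'a::chilbert_space)"
  using compact_op_tensor_op[of "{}"] by (simp add: tensor_op_def)

lemma KHdual_sum:
  fixes f :: "'i \<Rightarrow> 'a::chilbert_space \<Rightarrow> 'a"
  assumes \<phi>: "\<phi> \<in> KHdual" and "finite I" "\<And>i. i \<in> I \<Longrightarrow> compact_op (f i)"
  shows "\<phi> (\<lambda>h. \<Sum>i\<in>I. f i h) = (\<Sum>i\<in>I. \<phi> (f i))"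
  using assms(2,3)
proof (induction I rule: finite_induct)
  case empty
  show ?case using KHdual_scale[OF \<phi> compact_op_zero, of 0] by simp
next
  case (insert i I)
  then show ?case
    using KHdual_add[OF \<phi> insert.prems[of i] compact_op_sum[of I f]] by simp
qed

lemma compact_op_rank_one: "compact_op (\<lambda>h. scaleC (cinner h u) (v::'a::chilbert_space))"
  using compact_op_tensor_op[of "{()}" "\<lambda>_. v" "\<lambda>_. u"] by (simp add: tensor_op_def)

lemma onorm_rank_one_le:
  fixes u :: "'a::chilbert_space"
  shows "onorm (\<lambda>h. scaleC (cinner h u) (v::'a)) \<le> norm u * norm v"
proof (rule onorm_le[OF _ bounded_clinear_rank_one])
  fix x :: 'a assume "norm x \<le> 1"
  then have "norm x * norm u * norm v \<le> 1 * norm u * norm v"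
    by (intro mult_right_mono) auto
  then show "norm (scaleC (cinner x u) v) \<le> norm u * norm v"
    using mult_right_mono[OF cinner_Cauchy_Schwarz[of x u], of "norm v"] by (simp add: norm_scaleC)
qed

text \<open>Riesz makes \<open>\<phi>\<close> explicit on rank one operators. These depend conjugate
  linearly on \<open>w\<close>, which is why \<open>\<theta>\<close> conjugates the value.\<close>

lemma KHdual_rank_one_left:
  fixes e :: "'a::chilbert_space"
  assumes \<phi>: "\<phi> \<in> KHdual"
  obtains q where "\<And>w. \<phi> (\<lambda>h. scaleC (cinner h w) e) = cinner q w"
proof -
  obtain C where C: "0 < C" "\<And>f. compact_op f \<Longrightarrow> cmod (\<phi> f) \<le> C * onorm f"
    using KHdual_bound[OF \<phi>] by blast
  define \<theta> where "\<theta> w = cnj (\<phi> (\<lambda>h. scaleC (cinner h w) e))" for w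
  have "\<theta> (x + y) = \<theta> x + \<theta> y" for x y
    using KHdual_add[OF \<phi> compact_op_rank_one compact_op_rank_one, of x e y e]
    by (simp add: \<theta>_def cinner_add_right scaleC_add_left)
  moreover have "\<theta> (scaleC c x) = c * \<theta> x" for c x
    using KHdual_scale[OF \<phi> compact_op_rank_one, of "cnj c" x e]
    by (simp add: \<theta>_def cinner_scaleC_right scaleC_scaleC)
  moreover have "cmod (\<theta> x) \<le> C * norm e * norm x" for x
  proof -
    have "cmod (\<theta> x) \<le> C * onorm (\<lambda>h. scaleC (cinner h x) e)"
      unfolding \<theta>_def complex_mod_cnj by (rule C(2)[OF compact_op_rank_one])
    also have "\<dots> \<le> C * (norm x * norm e)"
      using C(1) by (intro mult_left_mono onorm_rank_one_le) auto
    finally show ?thesis by (simp add: mult_ac)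
  qed
  ultimately obtain q where q: "\<And>x. \<theta> x = cinner x q"
    by (rule Riesz_representation) blast
  have "\<phi> (\<lambda>h. scaleC (cinner h w) e) = cinner q w" for w
    using q[of w] cinner_commute[of q w] by (metis \<theta>_def complex_cnj_cnj)
  then show ?thesis by (rule that)
qed

lemma KHdual_rank_one_right:
  fixes e :: "'a::chilbert_space"
  assumes \<phi>: "\<phi> \<in> KHdual" and d: "bounded_clinear d"
  obtains q where "\<And>v. \<phi> (\<lambda>h. scaleC (cinner h e) (d v)) = cinner v q"
proof -
  obtain C where C: "0 < C" "\<And>f. compact_op f \<Longrightarrow> cmod (\<phi> f) \<le> C * onorm f"
    using KHdual_bound[OF \<phi>] by blast
  define \<theta> where "\<theta> v = \<phi> (\<lambda>h. scaleC (cinner h e) (d v))" for v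
  have "\<theta> (x + y) = \<theta> x + \<theta> y" for x y
    using KHdual_add[OF \<phi> compact_op_rank_one compact_op_rank_one, of e "d x" e "d y"]
    by (simp add: \<theta>_def scaleC_add_right bounded_clinear_add[OF d])
  moreover have "\<theta> (scaleC c x) = c * \<theta> x" for c x
    using KHdual_scale[OF \<phi> compact_op_rank_one, of c e "d x"]
    by (simp add: \<theta>_def bounded_clinear_scaleC[OF d] scaleC_scaleC mult.commute)
  moreover have "cmod (\<theta> x) \<le> C * norm e * onorm d * norm x" for x
  proof -
    have "cmod (\<theta> x) \<le> C * onorm (\<lambda>h. scaleC (cinner h e) (d x))"
      unfolding \<theta>_def by (rule C(2)[OF compact_op_rank_one])
    also have "\<dots> \<le> C * (norm e * norm (d x))"
      using C(1) by (intro mult_left_mono onorm_rank_one_le) auto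
    also have "\<dots> \<le> C * (norm e * (onorm d * norm x))"
      using C(1) by (intro mult_left_mono norm_le_onorm[OF d]) auto
    finally show ?thesis by (simp add: mult_ac)
  qed
  ultimately obtain q where "\<And>x. \<theta> x = cinner x q"
    by (rule Riesz_representation) blast
  then show ?thesis using that unfolding \<theta>_def by blast
qed

text \<open>The unit ball of \<open>B(H)\<close>, with the weak operator topology, is represented by the sesquilinear
  forms of norm at most one, a compact subset of a product of discs.\<close>

definition form_ball :: "('a::complex_inner \<times> 'a \<Rightarrow> complex) set" where
  "form_ball = {F. \<forall>p. cmod (F p) \<le> norm (fst p) * norm (snd p)} \<inter>
     ({F. \<forall>h h' k. F (h + h', k) = F (h, k) + F (h', k)} \<inter>
      {F. \<forall>c h k. F (scaleC c h, k) = c * F (h, k)} \<inter>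
      {F. \<forall>h k k'. F (h, k + k') = F (h, k) + F (h, k')} \<inter>
      {F. \<forall>c h k. F (h, scaleC c k) = cnj c * F (h, k)})"

lemma continuous_on_coord: "continuous_on S (\<lambda>F :: 'i \<Rightarrow> complex. F p)"
  by (rule continuous_on_subset[OF continuous_on_product_coordinates subset_UNIV])

text \<open>Each defining equation involves finitely many coordinates, hence is closed under
  pointwise convergence.\<close>

lemma compact_form_ball: "compact form_ball"
  unfolding form_ball_def
  by (intro compact_Int_closed compact_Pi_cball closed_Int closed_Collect_all closed_Collect_eq
      continuous_on_add continuous_on_mult continuous_on_const continuous_on_coord)

lemma form_ball_iff:
  "F \<in> form_ball \<longleftrightarrow> (\<forall>h k. cmod (F (h, k)) \<le> norm h * norm k) \<and>
    (\<forall>h h' k. F (h + h', k) = F (h, k) + F (h', k)) \<and> (\<forall>c h k. F (scaleC c h, k) = c * F (h, k)) \<and>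
    (\<forall>h k k'. F (h, k + k') = F (h, k) + F (h, k')) \<and> (\<forall>c h k. F (h, scaleC c k) = cnj c * F (h, k))"
  by (auto simp: form_ball_def)

definition form_op :: "('a::chilbert_space \<times> 'a \<Rightarrow> complex) \<Rightarrow> 'a \<Rightarrow> 'a" where
  "form_op F h = (SOME w. \<forall>k. F (h, k) = cinner w k)"

lemma cinner_form_op:
  assumes F: "F \<in> form_ball"
  shows "cinner (form_op F h) k = F (h, k)"
proof -
  note F' = F[unfolded form_ball_iff]
  obtain q where q: "\<And>x. cnj (F (h, x)) = cinner x q"
    by (rule Riesz_representation[of "\<lambda>k. cnj (F (h, k))" "norm h"]) (use F' in auto)
  have "\<forall>k. F (h, k) = cinner q k"
  proof
    fix k
    show "F (h, k) = cinner q k"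
      using arg_cong[OF q[of k], of cnj] by (simp flip: cinner_commute)
  qed
  then have "\<forall>k. F (h, k) = cinner (form_op F h) k"
    unfolding form_op_def by (rule someI)
  then show ?thesis by simp
qed

lemma norm_form_op_le:
  assumes F: "F \<in> form_ball"
  shows "norm (form_op F h) \<le> norm h"
proof (rule norm_le_if_cinner_le)
  fix y :: 'a assume y: "norm y \<le> 1"
  have "cmod (F (h, y)) \<le> norm h * norm y" using F by (simp add: form_ball_iff)
  also have "\<dots> \<le> norm h * 1" using y by (intro mult_left_mono) auto
  finally show "cmod (cinner (form_op F h) y) \<le> norm h" by (simp add: cinner_form_op[OF F])
qed

lemma bounded_clinear_form_op:
  assumes F: "F \<in> form_ball"
  shows "bounded_clinear (form_op F)"
proof (rule bounded_clinearI[where K = 1])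
  show "norm (form_op F x) \<le> 1 * norm x" for x using norm_form_op_le[OF F] by simp
  show "form_op F (x + y) = form_op F x + form_op F y" for x y
    by (rule cinner_eqI) (use F in \<open>simp add: cinner_form_op cinner_add_left form_ball_iff\<close>)
  show "form_op F (scaleC c x) = scaleC c (form_op F x)" for c x
    by (rule cinner_eqI) (use F in \<open>simp add: cinner_form_op cinner_scaleC_left form_ball_iff\<close>)
qed

lemma form_op_surj:
  fixes x :: "'a::chilbert_space \<Rightarrow> 'a"
  assumes x: "bounded_clinear x" "onorm x \<le> 1"
  obtains F where "F \<in> form_ball" "form_op F = x"
proof
  define F where "F = (\<lambda>(h, k). cinner (x h) k)"
  have "norm (x h) \<le> norm h" for h
    using norm_le_onorm[OF x(1), of h] mult_right_mono[OF x(2), of "norm h"] by simp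
  then have "cmod (cinner (x h) k) \<le> norm h * norm k" for h k
    using cinner_Cauchy_Schwarz[of "x h" k] mult_right_mono[of "norm (x h)" "norm h" "norm k"] by fastforce
  then show F: "F \<in> form_ball"
    by (simp add: form_ball_iff F_def bounded_clinear_add[OF x(1)] bounded_clinear_scaleC[OF x(1)] cinner_simps)
  show "form_op F = x"
  proof
    fix h show "form_op F h = x h"
      by (rule cinner_eqI) (simp add: cinner_form_op[OF F], simp add: F_def)
  qed
qed

section \<open>Continuity of functionals in the form variable\<close>

lemma continuous_on_uniform_approx:
  fixes f :: "'b::topological_space \<Rightarrow> 'c::metric_space"
  assumes "\<And>e. 0 < e \<Longrightarrow> \<exists>g. continuous_on S g \<and> (\<forall>x\<in>S. dist (f x) (g x) \<le> e)"
  shows "continuous_on S f"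
  unfolding continuous_on_def
proof (intro ballI tendstoI)
  fix x and e :: real assume x: "x \<in> S" and e: "0 < e"
  then obtain g where g: "continuous_on S g" "\<forall>x\<in>S. dist (f x) (g x) \<le> e / 4"
    using assms[of "e / 4"] by auto
  have "\<forall>\<^sub>F y in at x within S. dist (g y) (g x) < e / 4"
    using g(1) x e by (intro tendstoD) (auto simp: continuous_on_def)
  moreover have "\<forall>\<^sub>F y in at x within S. y \<in> S"
    by (simp add: eventually_at_filter)
  ultimately show "\<forall>\<^sub>F y in at x within S. dist (f y) (f x) < e"
  proof eventually_elim
    case (elim y)
    have "dist (f y) (g y) \<le> e / 4" "dist (f x) (g x) \<le> e / 4" using g(2) elim(2) x by auto
    moreover have "dist (f y) (f x) \<le> dist (f y) (g y) + dist (g y) (g x) + dist (g x) (f x)"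
      using dist_triangle[of "f y" "f x" "g y"] dist_triangle[of "g y" "f x" "g x"] by linarith
    ultimately show ?case using elim(1) e dist_commute[of "g x" "f x"] by linarith
  qed
qed

lemma KHdual_dist_le:
  assumes \<phi>: "\<And>f. compact_op f \<Longrightarrow> cmod (\<phi> f) \<le> C * onorm f" "\<phi> \<in> KHdual" "0 < C"
    and f: "compact_op f" and g: "compact_op (g :: 'a::chilbert_space \<Rightarrow> 'a)"
    and le: "\<And>h. norm (f h - g h) \<le> r * norm h" and r: "0 \<le> r"
  shows "dist (\<phi> f) (\<phi> g) \<le> C * r"
proof -
  have c: "compact_op (\<lambda>h. f h - g h)"
    using compact_op_add[OF f compact_op_scaleC[OF g, of "-1"]] by (simp add: scaleC_minus_one)
  have "\<phi> f = \<phi> (\<lambda>h. f h - g h) + \<phi> g"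
    using KHdual_add[OF \<phi>(2) c g] by simp
  then have "dist (\<phi> f) (\<phi> g) \<le> C * onorm (\<lambda>h. f h - g h)"
    using \<phi>(1)[OF c] by (simp add: dist_norm)
  also have "\<dots> \<le> C * r"
    using \<phi>(3) le r by (intro mult_left_mono onorm_bound) auto
  finally show ?thesis .
qed

text \<open>Inserting \<open>proj E\<close> after \<open>c\<close> changes the value of
  \<open>\<phi>\<close> by at most \<open>e\<close>, uniformly in \<open>F\<close>. What remains is
  a finite sum of rank one operators, and Riesz turns each term into one coordinate
  \<open>F (d (q e), cadjoint c e)\<close>.\<close>

lemma KHdual_left_compact_continuous:
  fixes c d :: "'a::chilbert_space \<Rightarrow> 'a"
  assumes \<phi>: "\<phi> \<in> KHdual" and c: "compact_op c" and d: "bounded_clinear d"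
  shows "continuous_on form_ball (\<lambda>F. \<phi> (\<lambda>h. c (form_op F (d h))))"
proof (rule continuous_on_uniform_approx)
  fix e :: real assume e: "0 < e"
  have bc: "bounded_clinear c" using c by (rule compact_op_bounded_clinear)
  obtain C where C: "0 < C" "\<And>f. compact_op f \<Longrightarrow> cmod (\<phi> f) \<le> C * onorm f"
    using KHdual_bound[OF \<phi>] by blast
  define D where "D = onorm d + 1"
  have D: "0 < D" "onorm d \<le> D" using onorm_nonneg[OF d] by (auto simp: D_def)
  define r where "r = e / (C * D)"
  have r: "0 < r" using e C(1) D by (simp add: r_def)
  obtain E where E: "orthonormal_set E" "\<And>h. norm (c h - proj E (c h)) \<le> r * norm h"
    using compact_op_proj_approx[OF c r] by blast
  have finE: "finite E" using E by (simp add: orthonormal_set_def)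
  have "\<forall>e. \<exists>q. \<forall>w. \<phi> (\<lambda>h. scaleC (cinner h w) e) = cinner q w"
    using KHdual_rank_one_left[OF \<phi>] by metis
  then obtain q where q: "\<And>e w. \<phi> (\<lambda>h. scaleC (cinner h w) e) = cinner (q e) w"
    by metis
  define g :: "('a \<times> 'a \<Rightarrow> complex) \<Rightarrow> complex" where "g F = (\<Sum>e\<in>E. F (d (q e), cadjoint c e))" for F
  have "continuous_on form_ball g"
    unfolding g_def by (intro continuous_on_sum continuous_on_coord)
  moreover have "dist (\<phi> (\<lambda>h. c (form_op F (d h)))) (g F) \<le> e" if F: "F \<in> form_ball" for F
  proof -
    note x = bounded_clinear_form_op[OF F]
    have k1: "compact_op (\<lambda>h. c (form_op F (d h)))"
      by (rule compact_op_compose_right[OF c bounded_clinear_compose[OF x d]])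
    have k2: "compact_op (\<lambda>h. proj E (c (form_op F (d h))))"
      by (rule compact_op_compose_left[OF k1 bounded_clinear_tensor_op])
    define w where "w e = cadjoint d (cadjoint (form_op F) (cadjoint c e))" for e
    have "\<phi> (\<lambda>h. proj E (c (form_op F (d h)))) = \<phi> (\<lambda>h. \<Sum>e\<in>E. scaleC (cinner h (w e)) e)"
      by (simp add: tensor_op_def w_def cadjoint[OF bc] cadjoint[OF x] cadjoint[OF d])
    also have "\<dots> = (\<Sum>e\<in>E. cinner (q e) (w e))"
      unfolding q[symmetric] by (rule KHdual_sum[OF \<phi> finE compact_op_rank_one])
    also have "\<dots> = g F"
      unfolding g_def w_def
      by (simp add: cadjoint[OF d, symmetric] cadjoint[OF x, symmetric] cinner_form_op[OF F])
    finally have "g F = \<phi> (\<lambda>h. proj E (c (form_op F (d h))))" ..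
    moreover have "dist (\<phi> (\<lambda>h. c (form_op F (d h)))) (\<phi> (\<lambda>h. proj E (c (form_op F (d h))))) \<le> C * (r * D)"
    proof (rule KHdual_dist_le[OF C(2) \<phi> C(1) k1 k2])
      fix h
      have "norm (c (form_op F (d h)) - proj E (c (form_op F (d h)))) \<le> r * norm (form_op F (d h))"
        by (rule E(2))
      also have "\<dots> \<le> r * (D * norm h)"
      proof (rule mult_left_mono)
        have "norm (form_op F (d h)) \<le> norm (d h)" by (rule norm_form_op_le[OF F])
        also have "\<dots> \<le> onorm d * norm h" by (rule norm_le_onorm[OF d])
        also have "\<dots> \<le> D * norm h" using D by (intro mult_right_mono) auto
        finally show "norm (form_op F (d h)) \<le> D * norm h" .
      qed (use r in simp)
      finally show "norm (c (form_op F (d h)) - proj E (c (form_op F (d h)))) \<le> r * D * norm h"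
        by (simp add: mult.assoc)
    qed (use r D in simp_all)
    moreover have "C * (r * D) = e" using C(1) D by (simp add: r_def)
    ultimately show ?thesis by simp
  qed
  ultimately show "\<exists>g. continuous_on form_ball g \<and>
      (\<forall>F\<in>form_ball. dist (\<phi> (\<lambda>h. c (form_op F (d h)))) (g F) \<le> e)"
    by blast
qed

text \<open>The mirror image of the preceding lemma: \<open>proj E\<close> now has to stand before
  \<open>c\<close>, so the approximation is made for \<open>cadjoint c\<close> and transferred by
  duality.\<close>

lemma KHdual_right_compact_continuous:
  fixes c d :: "'a::chilbert_space \<Rightarrow> 'a"
  assumes \<phi>: "\<phi> \<in> KHdual" and c: "compact_op c" and d: "bounded_clinear d"
  shows "continuous_on form_ball (\<lambda>F. \<phi> (\<lambda>h. d (form_op F (c h))))"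
proof (rule continuous_on_uniform_approx)
  fix e :: real assume e: "0 < e"
  have bc: "bounded_clinear c" using c by (rule compact_op_bounded_clinear)
  obtain C where C: "0 < C" "\<And>f. compact_op f \<Longrightarrow> cmod (\<phi> f) \<le> C * onorm f"
    using KHdual_bound[OF \<phi>] by blast
  define D where "D = onorm d + 1"
  have D: "0 < D" "onorm d \<le> D" using onorm_nonneg[OF d] by (auto simp: D_def)
  define r where "r = e / (C * D)"
  have r: "0 < r" using e C(1) D by (simp add: r_def)
  obtain E where E: "orthonormal_set E" "\<And>h. norm (cadjoint c h - proj E (cadjoint c h)) \<le> r * norm h"
    using compact_op_proj_approx[OF compact_op_cadjoint[OF c] r] by blast
  have finE: "finite E" using E by (simp add: orthonormal_set_def)
  have proj_adj: "cinner (proj E x) y = cinner x (proj E y)" for x y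
    using cadjoint[OF bounded_clinear_tensor_op, of E "\<lambda>e. e" "\<lambda>e. e" x y] by (simp add: cadjoint_tensor_op)
  have approx: "norm (c h - c (proj E h)) \<le> r * norm h" for h
  proof (rule norm_le_if_cinner_le)
    fix y :: 'a assume y: "norm y \<le> 1"
    have "cinner (c h - c (proj E h)) y = cinner h (cadjoint c y - proj E (cadjoint c y))"
      by (simp add: cinner_diff_left cinner_diff_right cadjoint[OF bc] proj_adj)
    also have "cmod \<dots> \<le> norm h * norm (cadjoint c y - proj E (cadjoint c y))"
      by (rule cinner_Cauchy_Schwarz)
    also have "\<dots> \<le> norm h * (r * norm y)"
      by (intro mult_left_mono E(2)) simp
    also have "\<dots> \<le> norm h * (r * 1)"
      using y r by (intro mult_left_mono) auto
    finally show "cmod (cinner (c h - c (proj E h)) y) \<le> r * norm h" by (simp add: mult.commute)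
  qed
  have "\<forall>e. \<exists>q. \<forall>v. \<phi> (\<lambda>h. scaleC (cinner h e) (d v)) = cinner v q"
    using KHdual_rank_one_right[OF \<phi> d] by metis
  then obtain q where q: "\<And>e v. \<phi> (\<lambda>h. scaleC (cinner h e) (d v)) = cinner v (q e)"
    by metis
  define g :: "('a \<times> 'a \<Rightarrow> complex) \<Rightarrow> complex" where "g F = (\<Sum>e\<in>E. F (c e, q e))" for F
  have "continuous_on form_ball g"
    unfolding g_def by (intro continuous_on_sum continuous_on_coord)
  moreover have "dist (\<phi> (\<lambda>h. d (form_op F (c h)))) (g F) \<le> e" if F: "F \<in> form_ball" for F
  proof -
    note x = bounded_clinear_form_op[OF F]
    have dx: "bounded_clinear (\<lambda>h. d (form_op F h))" by (rule bounded_clinear_compose[OF d x])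
    have k1: "compact_op (\<lambda>h. d (form_op F (c h)))"
      by (rule compact_op_compose_left[OF c dx])
    have k2: "compact_op (\<lambda>h. d (form_op F (c (proj E h))))"
      by (rule compact_op_compose_right[OF k1 bounded_clinear_tensor_op])
    have "\<phi> (\<lambda>h. d (form_op F (c (proj E h)))) = \<phi> (\<lambda>h. \<Sum>e\<in>E. scaleC (cinner h e) (d (form_op F (c e))))"
      by (simp add: tensor_op_def bounded_clinear_sum[OF bc] bounded_clinear_sum[OF x] bounded_clinear_sum[OF d]
          bounded_clinear_scaleC[OF bc] bounded_clinear_scaleC[OF x] bounded_clinear_scaleC[OF d])
    also have "\<dots> = (\<Sum>e\<in>E. cinner (form_op F (c e)) (q e))"
      unfolding q[symmetric] by (rule KHdual_sum[OF \<phi> finE compact_op_rank_one])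
    also have "\<dots> = g F"
      unfolding g_def by (simp add: cinner_form_op[OF F])
    finally have "g F = \<phi> (\<lambda>h. d (form_op F (c (proj E h))))" ..
    moreover have "dist (\<phi> (\<lambda>h. d (form_op F (c h)))) (\<phi> (\<lambda>h. d (form_op F (c (proj E h))))) \<le> C * (r * D)"
    proof (rule KHdual_dist_le[OF C(2) \<phi> C(1) k1 k2])
      fix h
      have "norm (d (form_op F (c h)) - d (form_op F (c (proj E h)))) = norm (d (form_op F (c h - c (proj E h))))"
        by (simp add: bounded_clinear_diff[OF d] bounded_clinear_diff[OF x])
      also have "\<dots> \<le> onorm d * norm (form_op F (c h - c (proj E h)))"
        by (rule norm_le_onorm[OF d])
      also have "\<dots> \<le> D * (r * norm h)"
        using D by (intro mult_mono order_trans[OF norm_form_op_le[OF F]] approx) auto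
      finally show "norm (d (form_op F (c h)) - d (form_op F (c (proj E h)))) \<le> r * D * norm h"
        by (simp add: mult_ac)
    qed (use r D in simp_all)
    moreover have "C * (r * D) = e" using C(1) D by (simp add: r_def)
    ultimately show ?thesis by simp
  qed
  ultimately show "\<exists>g. continuous_on form_ball g \<and>
      (\<forall>F\<in>form_ball. dist (\<phi> (\<lambda>h. d (form_op F (c h)))) (g F) \<le> e)"
    by blast
qed

text \<open>The compact set is the image of all of \<open>form_ball\<close>. All values are compact
  operators, so each functional on \<open>X\<close> acts through its restriction to
  \<open>KH\<close>, and that is continuous in the form.\<close>

lemma weakly_compact_map_if_compact_rep:
  fixes T :: "('a::chilbert_space \<Rightarrow> 'a) \<Rightarrow> 'a \<Rightarrow> 'a"
  assumes rep: "compact_rep l T" and X: "KH \<subseteq> X" "X \<subseteq> BH"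
  shows "weakly_compact_map X op_add op_scale onorm T"
proof -
  obtain c d m where m: "m \<le> l" and c: "\<And>j. j < l \<Longrightarrow> compact_op (c j)"
    and d: "\<And>j. j < l \<Longrightarrow> bounded_clinear (d j)"
    and T: "\<And>x. bounded_clinear x \<Longrightarrow>
       T x = (\<lambda>h. (\<Sum>j<m. c j (x (d j h))) + (\<Sum>j\<in>{m..<l}. d j (x (c j h))))"
    using rep unfolding compact_rep_def by blast
  have k1: "compact_op (\<lambda>h. c j (x (d j h)))" if "j \<in> {..<m}" "bounded_clinear x" for j x
    by (rule compact_op_compose_right[OF c bounded_clinear_compose[OF that(2) d]]) (use that m in auto)
  have k2: "compact_op (\<lambda>h. d j (x (c j h)))" if "j \<in> {m..<l}" "bounded_clinear x" for j x
    by (rule compact_op_compose_left[OF c bounded_clinear_compose[OF d that(2)]]) (use that in auto)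
  have s1: "compact_op (\<lambda>h. \<Sum>j<m. c j (x (d j h)))" if "bounded_clinear x" for x
    by (rule compact_op_sum[OF k1]) (use that in auto)
  have s2: "compact_op (\<lambda>h. \<Sum>j\<in>{m..<l}. d j (x (c j h)))" if "bounded_clinear x" for x
    by (rule compact_op_sum[OF k2]) (use that in auto)
  have Tx: "compact_op (T x)" if "bounded_clinear x" for x
    unfolding T[OF that] by (rule compact_op_add[OF s1[OF that] s2[OF that]])
  have cont: "continuous_on form_ball (\<lambda>F. \<phi> (T (form_op F)))" if "\<phi> \<in> KHdual" for \<phi>
  proof -
    have eq: "\<phi> (T (form_op F)) = (\<Sum>j<m. \<phi> (\<lambda>h. c j (form_op F (d j h))))
        + (\<Sum>j\<in>{m..<l}. \<phi> (\<lambda>h. d j (form_op F (c j h))))" if "F \<in> form_ball" for F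
    proof -
      note x = bounded_clinear_form_op[OF that]
      have "(\<Sum>j<m. \<phi> (\<lambda>h. c j (form_op F (d j h)))) = \<phi> (\<lambda>h. \<Sum>j<m. c j (form_op F (d j h)))"
        by (rule KHdual_sum[OF \<open>\<phi> \<in> KHdual\<close> finite_lessThan k1[OF _ x], symmetric])
      moreover have "(\<Sum>j\<in>{m..<l}. \<phi> (\<lambda>h. d j (form_op F (c j h)))) = \<phi> (\<lambda>h. \<Sum>j\<in>{m..<l}. d j (form_op F (c j h)))"
        by (rule KHdual_sum[OF \<open>\<phi> \<in> KHdual\<close> finite_atLeastLessThan k2[OF _ x], symmetric])
      ultimately show ?thesis
        unfolding T[OF x] using KHdual_add[OF \<open>\<phi> \<in> KHdual\<close> s1[OF x] s2[OF x]] by simp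
    qed
    have "continuous_on form_ball (\<lambda>F. (\<Sum>j<m. \<phi> (\<lambda>h. c j (form_op F (d j h))))
        + (\<Sum>j\<in>{m..<l}. \<phi> (\<lambda>h. d j (form_op F (c j h)))))"
      using m that by (intro continuous_on_add continuous_on_sum KHdual_left_compact_continuous
          KHdual_right_compact_continuous c d) auto
    then show ?thesis
      by (rule continuous_on_eq) (simp add: eq)
  qed
  define W where "W = weak_topology X op_add op_scale onorm"
  define G where "G = (\<lambda>F. T (form_op F))"
  have GK: "G F \<in> X" if "F \<in> form_ball" for F
    unfolding G_def using Tx[OF bounded_clinear_form_op[OF that]] X(1) by blast
  have "continuous_map (top_of_set form_ball) W G"
    unfolding W_def weak_topology_def
  proof (rule continuous_on_generated_topo)
    fix A assume "A \<in> {{x \<in> X. \<phi> x \<in> U} |\<phi> U. \<phi> \<in> cdual X op_add op_scale onorm \<and> open U}"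
    then obtain \<phi> U where A: "A = {x \<in> X. \<phi> x \<in> U}" and \<phi>: "\<phi> \<in> cdual X op_add op_scale onorm"
      and U: "open U" by blast
    have "\<phi> \<in> KHdual" using \<phi> cdual_mono[OF X(1)] by blast
    have "G -` A \<inter> topspace (top_of_set form_ball) = form_ball \<inter> (\<lambda>F. \<phi> (T (form_op F))) -` U"
      using GK by (auto simp: A G_def)
    then show "openin (top_of_set form_ball) (G -` A \<inter> topspace (top_of_set form_ball))"
      using continuous_openin_preimage_gen[OF cont[OF \<open>\<phi> \<in> KHdual\<close>] U] by simp
  next
    \<comment> \<open>Continuity into a generated topology also asks that the values lie in the
      union of the generators; the zero functional contributes \<open>X\<close> itself.\<close>
    have "(\<lambda>x. 0) \<in> cdual X op_add op_scale onorm"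
      by (auto simp: cdual_def intro!: exI[of _ 0])
    then have "X \<in> {{x \<in> X. \<phi> x \<in> U} |\<phi> U. \<phi> \<in> cdual X op_add op_scale onorm \<and> open U}"
      by (intro CollectI exI[of _ "\<lambda>x. 0"] exI[of _ UNIV]) auto
    then show "G ` topspace (top_of_set form_ball)
        \<subseteq> \<Union> {{x \<in> X. \<phi> x \<in> U} |\<phi> U. \<phi> \<in> cdual X op_add op_scale onorm \<and> open U}"
      using GK by auto
  qed
  moreover have "compactin (top_of_set form_ball) form_ball"
    using compact_form_ball by (simp add: compactin_subtopology)
  ultimately have "compactin W (G ` form_ball)"
    by (rule image_compactin[rotated])
  moreover have "G ` form_ball \<subseteq> X" using GK by blast
  moreover have "T ` {x \<in> X. onorm x \<le> 1} \<subseteq> G ` form_ball"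
  proof (clarify)
    fix x assume x: "x \<in> X" "onorm x \<le> 1"
    then have "bounded_clinear x" using X(2) by blast
    then obtain F where "F \<in> form_ball" "form_op F = x" using form_op_surj[OF _ x(2)] by blast
    then show "T x \<in> G ` form_ball" unfolding G_def by blast
  qed
  ultimately show ?thesis
    unfolding weakly_compact_map_def W_def by blast
qed

section \<open>Weak compactness implies smallness\<close>

lemma elem_op_HS_ball_bound:
  fixes a b :: "nat \<Rightarrow> 'a::chilbert_space \<Rightarrow> 'a"
  assumes a: "\<forall>j<l. bounded_clinear (a j)" and b: "\<forall>j<l. bounded_clinear (b j)"
  obtains C where "0 < C" "\<forall>x\<in>HS_ball. \<forall>h. norm (elem_op l a b x h) \<le> C * norm h"
proof -
  obtain A where A: "0 < A" "\<And>j h. j < l \<Longrightarrow> norm (a j h) \<le> A * norm h"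
    using finite_common_bound[OF a] by blast
  obtain B where B: "0 < B" "\<And>j h. j < l \<Longrightarrow> norm (b j h) \<le> B * norm h"
    using finite_common_bound[OF b] by blast
  have "norm (elem_op l a b x h) \<le> (real l * (A * B) + 1) * norm h" if x: "x \<in> HS_ball" for x h
  proof -
    have "norm (elem_op l a b x h) \<le> (\<Sum>j<l. A * B * norm h)"
      unfolding elem_op_def
    proof (rule sum_norm_le)
      fix j assume "j \<in> {..<l}"
      then have j: "j < l" by simp
      have "norm (a j (x (b j h))) \<le> A * norm (x (b j h))" by (rule A(2)[OF j])
      also have "\<dots> \<le> A * (B * norm h)"
        using A(1) by (intro mult_left_mono order_trans[OF norm_HS_ball_le[OF x] B(2)[OF j]]) simp
      finally show "norm (a j (x (b j h))) \<le> A * B * norm h" by (simp add: mult.assoc)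
    qed
    also have "\<dots> = (real l * (A * B)) * norm h" by simp
    also have "\<dots> \<le> (real l * (A * B) + 1) * norm h"
      by (intro mult_right_mono) auto
    finally show ?thesis .
  qed
  moreover have "0 < real l * (A * B) + 1"
    using A(1) B(1) by (intro add_nonneg_pos mult_nonneg_nonneg) auto
  ultimately show ?thesis using that by blast
qed

section \<open>From weak smallness to exact orthogonality\<close>

lemma proj_minus_orthogonal:
  assumes E: "orthonormal_set E" and z: "proj E z = z"
  shows "cinner (\<xi> - proj E \<xi>) z = 0"
proof -
  have "cinner (\<xi> - proj E \<xi>) e = 0" if "e \<in> E" for e
    by (simp add: cinner_diff_left cinner_proj[OF E that])
  moreover have "cinner g (proj E z) = (\<Sum>e\<in>E. cnj (cinner z e) * cinner g e)" for g
    by (simp add: tensor_op_def cinner_sum_right cinner_scaleC_right)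
  ultimately have "cinner (\<xi> - proj E \<xi>) (proj E z) = 0"
    by simp
  then show ?thesis using z by simp
qed

lemma norm_minus_proj_le:
  assumes E: "orthonormal_set E"
  shows "norm (\<xi> - proj E \<xi>) \<le> norm \<xi>"
proof (cases "\<xi> - proj E \<xi> = 0")
  case False
  have proj: "proj E g = (\<Sum>e\<in>E. scaleC (cinner g e) e)" for g
    by (simp add: tensor_op_def)
  have "proj E (proj E \<xi>) = (\<Sum>e\<in>E. scaleC (cinner (proj E \<xi>) e) e)"
    by (rule proj)
  also have "\<dots> = (\<Sum>e\<in>E. scaleC (cinner \<xi> e) e)"
    by (intro sum.cong refl) (simp add: cinner_proj[OF E])
  also have "\<dots> = proj E \<xi>"
    by (rule proj[symmetric])
  finally have "proj E (proj E \<xi>) = proj E \<xi>" .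
  from proj_minus_orthogonal[OF E this, of \<xi>]
  have "cinner (\<xi> - proj E \<xi>) (\<xi> - proj E \<xi>) = cinner (\<xi> - proj E \<xi>) \<xi>"
    by (simp add: cinner_diff_right)
  moreover have "(norm (\<xi> - proj E \<xi>))\<^sup>2 = cmod (cinner (\<xi> - proj E \<xi>) (\<xi> - proj E \<xi>))"
    by (simp add: cinner_self norm_power)
  ultimately have "norm (\<xi> - proj E \<xi>) * norm (\<xi> - proj E \<xi>) \<le> norm (\<xi> - proj E \<xi>) * norm \<xi>"
    using cinner_Cauchy_Schwarz[of "\<xi> - proj E \<xi>" \<xi>] by (simp add: power2_eq_square)
  then show ?thesis using False by (simp add: mult_le_cancel_left)
qed simp

text \<open>Removing the components in the span of \<open>Z\<close> makes weakly small vectors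
  orthogonal to \<open>Z\<close>. It costs a multiple of the norms of these components, which tend
  to 0 because \<open>proj E\<close> has finite rank. The gliding hump needs the criterion in this
  form.\<close>

lemma small_op_if_orthogonal:
  fixes a b :: "nat \<Rightarrow> 'a::chilbert_space \<Rightarrow> 'a"
  assumes a: "\<forall>j<l. bounded_clinear (a j)" and b: "\<forall>j<l. bounded_clinear (b j)"
    and orth: "\<And>e. 0 < e \<Longrightarrow> \<exists>Z. finite Z \<and> (\<forall>\<xi> \<eta>. norm \<xi> \<le> 1 \<longrightarrow> norm \<eta> \<le> 1 \<longrightarrow>
       (\<forall>z\<in>Z. cinner \<xi> z = 0 \<and> cinner \<eta> z = 0) \<longrightarrow> hsT l a b \<xi> \<eta> < e)"
  shows "small_op (elem_op l a b)"
  unfolding small_op_def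
proof (intro allI impI)
  fix e :: real assume e: "0 < e"
  obtain C where C: "0 < C" "\<forall>x\<in>HS_ball. \<forall>h. norm (elem_op l a b x h) \<le> C * norm h"
    by (rule elem_op_HS_ball_bound[OF a b])
  from orth[of "e / 2"] e obtain Z where Z: "finite Z" "\<forall>\<xi> \<eta>. norm \<xi> \<le> 1 \<longrightarrow> norm \<eta> \<le> 1 \<longrightarrow>
       (\<forall>z\<in>Z. cinner \<xi> z = 0 \<and> cinner \<eta> z = 0) \<longrightarrow> hsT l a b \<xi> \<eta> < e / 2"
    by auto
  obtain E where E: "orthonormal_set E" "\<forall>z\<in>Z. proj E z = z"
    using orthonormal_set_spanning[OF Z(1)] by blast
  have P: "(proj E \<longlongrightarrow> 0) wnhds"
    by (rule compact_op_tendsto_wnhds[OF compact_op_tensor_op])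
  have "((\<lambda>p. C * norm (proj E (fst p)) + C * norm (proj E (snd p))) \<longlongrightarrow> 0) (wnhds \<times>\<^sub>F wnhds)"
    by (intro tendsto_add_zero tendsto_mult_right_zero tendsto_norm_zero filterlim_fst_snd_wnhds P)
  from tendstoD[OF this, of "e / 2"] e
  have "\<forall>\<^sub>F p in wnhds \<times>\<^sub>F wnhds. dist (C * norm (proj E (fst p)) + C * norm (proj E (snd p))) 0 < e / 2"
    by simp
  from eventually_conj[OF this eventually_prod_wnhds_norm_le]
  show "\<forall>\<^sub>F p in wnhds \<times>\<^sub>F wnhds. \<forall>x\<in>HS_ball. cmod (cinner (elem_op l a b x (snd p)) (fst p)) \<le> e"
  proof (rule eventually_mono, intro ballI)
    fix p :: "'a \<times> 'a" and x :: "'a \<Rightarrow> 'a"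
    assume p: "dist (C * norm (proj E (fst p)) + C * norm (proj E (snd p))) 0 < e / 2 \<and>
      norm (fst p) \<le> 1 \<and> norm (snd p) \<le> 1" and x: "x \<in> HS_ball"
    define \<xi> where "\<xi> = fst p"
    define \<eta> where "\<eta> = snd p"
    define \<xi>' where "\<xi>' = \<xi> - proj E \<xi>"
    define \<eta>' where "\<eta>' = \<eta> - proj E \<eta>"
    have n: "norm \<xi> \<le> 1" "norm \<eta> \<le> 1" using p by (simp_all add: \<xi>_def \<eta>_def)
    have n': "norm \<xi>' \<le> 1" "norm \<eta>' \<le> 1"
      using norm_minus_proj_le[OF E(1), of \<xi>] norm_minus_proj_le[OF E(1), of \<eta>] n
      unfolding \<xi>'_def \<eta>'_def by linarith+
    have "\<forall>z\<in>Z. cinner \<xi>' z = 0 \<and> cinner \<eta>' z = 0"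
      unfolding \<xi>'_def \<eta>'_def using proj_minus_orthogonal[OF E(1)] E(2) by blast
    with Z(2) n' have h: "hsT l a b \<xi>' \<eta>' < e / 2" by blast
    define A where "A = elem_op l a b x"
    have A: "bounded_clinear A"
      unfolding A_def by (rule bounded_clinear_elem_op[OF a b HS_ballD(1)[OF x]])
    have CA: "norm (A h) \<le> C * norm h" for h using C(2) x unfolding A_def by blast
    have "A \<eta> = A \<eta>' + A (proj E \<eta>)"
      unfolding \<eta>'_def bounded_clinear_diff[OF A] by simp
    then have "cinner (A \<eta>) \<xi> = cinner (A \<eta>') \<xi>' + cinner (A \<eta>') (proj E \<xi>) + cinner (A (proj E \<eta>)) \<xi>"
      by (simp add: \<xi>'_def cinner_add_left cinner_diff_right)
    also have "cmod \<dots> \<le> cmod (cinner (A \<eta>') \<xi>') + cmod (cinner (A \<eta>') (proj E \<xi>)) + cmod (cinner (A (proj E \<eta>)) \<xi>)"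
      by (intro norm_triangle_le add_mono norm_triangle_ineq order_refl)
    also have "cmod (cinner (A \<eta>') \<xi>') \<le> hsT l a b \<xi>' \<eta>'"
      unfolding A_def by (rule HS_ball_elem_op_le[OF a x])
    also have "cmod (cinner (A \<eta>') (proj E \<xi>)) \<le> C * norm (proj E \<xi>)"
    proof -
      have "cmod (cinner (A \<eta>') (proj E \<xi>)) \<le> norm (A \<eta>') * norm (proj E \<xi>)"
        by (rule cinner_Cauchy_Schwarz)
      also have "\<dots> \<le> (C * 1) * norm (proj E \<xi>)"
        using n'(2) C(1) by (intro mult_right_mono order_trans[OF CA] mult_left_mono) auto
      finally show ?thesis by simp
    qed
    also have "cmod (cinner (A (proj E \<eta>)) \<xi>) \<le> C * norm (proj E \<eta>)"
    proof -
      have "cmod (cinner (A (proj E \<eta>)) \<xi>) \<le> norm (A (proj E \<eta>)) * norm \<xi>"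
        by (rule cinner_Cauchy_Schwarz)
      also have "\<dots> \<le> (C * norm (proj E \<eta>)) * 1"
        using n(1) C(1) by (intro mult_mono CA) auto
      finally show ?thesis by simp
    qed
    finally have "cmod (cinner (A \<eta>) \<xi>) \<le> hsT l a b \<xi>' \<eta>' + C * norm (proj E \<xi>) + C * norm (proj E \<eta>)"
      by simp
    moreover have "C * norm (proj E \<xi>) + C * norm (proj E \<eta>) < e / 2"
      using p C(1) unfolding dist_norm \<xi>_def \<eta>_def by auto
    ultimately show "cmod (cinner (elem_op l a b x (snd p)) (fst p)) \<le> e"
      using h unfolding A_def \<xi>_def \<eta>_def by linarith
  qed
qed

text \<open>Moving the operators across the inner product turns the required relations with the
  earlier vectors into orthogonality of \<open>\<xi>\<close> and \<open>\<eta>\<close> to a finite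
  set \<open>Z\<close>, so the recursion can always continue.\<close>

lemma orthogonal_sequence:
  fixes a b :: "nat \<Rightarrow> 'a::chilbert_space \<Rightarrow> 'a"
  assumes a: "\<forall>j<l. bounded_clinear (a j)" and b: "\<forall>j<l. bounded_clinear (b j)"
    and orth: "\<And>Z. finite Z \<Longrightarrow> \<exists>\<xi> \<eta>. norm \<xi> \<le> 1 \<and> norm \<eta> \<le> 1 \<and>
       (\<forall>z\<in>Z. cinner \<xi> z = 0 \<and> cinner \<eta> z = 0) \<and> r \<le> hsT l a b \<xi> \<eta>"
  obtains f :: "nat \<Rightarrow> 'a \<times> 'a" where
    "\<forall>n. norm (fst (f n)) \<le> 1 \<and> norm (snd (f n)) \<le> 1 \<and> r \<le> hsT l a b (fst (f n)) (snd (f n))"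
    "\<forall>n m i j. m < n \<longrightarrow> i < l \<longrightarrow> j < l \<longrightarrow>
       cinner (cadjoint (a i) (fst (f n))) (cadjoint (a j) (fst (f m))) = 0 \<and>
       cinner (b i (snd (f n))) (b j (snd (f m))) = 0"
proof -
  define P where "P f n p \<longleftrightarrow> (norm (fst p) \<le> 1 \<and> norm (snd p) \<le> 1 \<and> r \<le> hsT l a b (fst p) (snd p)) \<and>
     (\<forall>m<n. \<forall>i<l. \<forall>j<l. cinner (cadjoint (a i) (fst p)) (cadjoint (a j) (fst (f m))) = 0 \<and>
       cinner (b i (snd p)) (b j (snd (f m))) = 0)" for f :: "nat \<Rightarrow> 'a \<times> 'a" and n :: nat and p
  have "\<exists>f. \<forall>n. P f n (f n)"
  proof (rule dependent_wellorder_choice)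
    fix p and f g :: "nat \<Rightarrow> 'a \<times> 'a" and n :: nat
    assume "\<And>m. m < n \<Longrightarrow> f m = g m"
    then show "P f n p = P g n p" unfolding P_def by simp
  next
    fix n :: nat and f :: "nat \<Rightarrow> 'a \<times> 'a"
    define Z where "Z = (\<lambda>(m, i, j). a i (cadjoint (a j) (fst (f m)))) ` ({..<n} \<times> {..<l} \<times> {..<l}) \<union>
      (\<lambda>(m, i, j). cadjoint (b i) (b j (snd (f m)))) ` ({..<n} \<times> {..<l} \<times> {..<l})"
    have "finite Z" by (simp add: Z_def)
    from orth[OF this] obtain \<xi> \<eta> where pr: "norm \<xi> \<le> 1" "norm \<eta> \<le> 1" "r \<le> hsT l a b \<xi> \<eta>"
      and z: "\<And>z. z \<in> Z \<Longrightarrow> cinner \<xi> z = 0 \<and> cinner \<eta> z = 0" by blast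
    have "cinner (cadjoint (a i) \<xi>) (cadjoint (a j) (fst (f m))) = 0 \<and> cinner (b i \<eta>) (b j (snd (f m))) = 0"
      if "m < n" "i < l" "j < l" for m i j
    proof -
      have "(m, i, j) \<in> {..<n} \<times> {..<l} \<times> {..<l}" using that by simp
      then have "a i (cadjoint (a j) (fst (f m))) \<in> Z" "cadjoint (b i) (b j (snd (f m))) \<in> Z"
        unfolding Z_def by force+
      then have "cinner \<xi> (a i (cadjoint (a j) (fst (f m)))) = 0" "cinner \<eta> (cadjoint (b i) (b j (snd (f m)))) = 0"
        using z by blast+
      then show ?thesis
        using that a b by (simp add: cadjoint' cadjoint)
    qed
    then show "\<exists>p. P f n p"
      unfolding P_def using pr by (intro exI[of _ "(\<xi>, \<eta>)"]) simp
  qed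
  then obtain f where f: "\<And>n. P f n (f n)" by blast
  show ?thesis
  proof (rule that[of f])
    show "\<forall>n. norm (fst (f n)) \<le> 1 \<and> norm (snd (f n)) \<le> 1 \<and> r \<le> hsT l a b (fst (f n)) (snd (f n))"
      using f unfolding P_def by blast
    show "\<forall>n m i j. m < n \<longrightarrow> i < l \<longrightarrow> j < l \<longrightarrow>
       cinner (cadjoint (a i) (fst (f n))) (cadjoint (a j) (fst (f m))) = 0 \<and>
       cinner (b i (snd (f n))) (b j (snd (f m))) = 0"
      using f unfolding P_def by blast
  qed
qed

text \<open>By Pythagoras, \<open>Q\<close> is the squared norm of the sum at \<open>h\<close>. It
  is also the inner product with \<open>h\<close> of the sum of the \<open>w n\<close>, where
  \<open>w n\<close> is the adjoint of \<open>x n\<close> applied to \<open>x n h\<close>.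
  Orthogonality of the \<open>v\<close> bounds that sum by M sqrt(Q), so Q <= M sqrt(Q) |h|.\<close>

lemma norm_orthogonal_tensor_sum_le:
  fixes u v :: "nat \<Rightarrow> nat \<Rightarrow> 'a::chilbert_space"
  assumes u: "\<And>n m i j. n \<noteq> m \<Longrightarrow> i < l \<Longrightarrow> j < l \<Longrightarrow> cinner (u n i) (u m j) = 0"
    and v: "\<And>n m i j. n \<noteq> m \<Longrightarrow> i < l \<Longrightarrow> j < l \<Longrightarrow> cinner (v n i) (v m j) = 0"
    and M: "\<And>n. hsnorm {..<l} (u n) (v n) \<le> M" "0 \<le> M"
  shows "norm (\<Sum>n<N. tensor_op {..<l} (u n) (v n) h) \<le> M * norm h"
proof -
  define x where "x n = tensor_op {..<l} (u n) (v n)" for n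
  define w where "w n = tensor_op {..<l} (v n) (u n) (x n h)" for n
  define Q where "Q = (\<Sum>n<N. (norm (x n h))\<^sup>2)"
  have orth: "cinner (tensor_op {..<l} p q g) (tensor_op {..<l} p' q' g') = 0"
    if "\<And>i j. i < l \<Longrightarrow> j < l \<Longrightarrow> cinner (p i) (p' j) = 0" for p q p' q' :: "nat \<Rightarrow> 'a" and g g'
    using that by (simp add: tensor_op_def cinner_sum_left cinner_sum_right cinner_simps)
  have x: "(norm (\<Sum>n<N. x n h))\<^sup>2 = Q"
    unfolding Q_def x_def by (intro norm_sum_pythagoras finite_lessThan orth u) auto
  have "(norm (\<Sum>n<N. w n))\<^sup>2 = (\<Sum>n<N. (norm (w n))\<^sup>2)"
    unfolding w_def by (intro norm_sum_pythagoras finite_lessThan orth v) auto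
  also have "\<dots> \<le> (\<Sum>n<N. M\<^sup>2 * (norm (x n h))\<^sup>2)"
  proof (rule sum_mono)
    fix n
    have "norm (w n) \<le> hsnorm {..<l} (v n) (u n) * norm (x n h)"
      unfolding w_def by (rule norm_tensor_op_le) simp
    also have "\<dots> \<le> M * norm (x n h)"
      unfolding hsnorm_swap[of _ "v n"] by (intro mult_right_mono M) simp
    finally have "(norm (w n))\<^sup>2 \<le> (M * norm (x n h))\<^sup>2" by (rule power_mono) simp
    then show "(norm (w n))\<^sup>2 \<le> M\<^sup>2 * (norm (x n h))\<^sup>2" by (simp add: power_mult_distrib)
  qed
  finally have w: "(norm (\<Sum>n<N. w n))\<^sup>2 \<le> M\<^sup>2 * Q"
    by (simp add: Q_def sum_distrib_left)
  have "cinner (w n) h = complex_of_real ((norm (x n h))\<^sup>2)" for n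
  proof -
    have "w n = cadjoint (x n) (x n h)"
      by (simp add: w_def x_def cadjoint_tensor_op)
    then have "cinner (w n) h = cinner (x n h) (x n h)"
      unfolding x_def by (simp only: cadjoint'[OF bounded_clinear_tensor_op])
    then show ?thesis by (simp only: cinner_self)
  qed
  then have "cinner (\<Sum>n<N. w n) h = complex_of_real Q"
    by (simp add: cinner_sum_left Q_def)
  then have "\<bar>Q\<bar> \<le> norm (\<Sum>n<N. w n) * norm h"
    using cinner_Cauchy_Schwarz[of "\<Sum>n<N. w n" h] by simp
  then have "Q\<^sup>2 \<le> (norm (\<Sum>n<N. w n) * norm h)\<^sup>2"
    by (metis abs_ge_zero power2_abs power_mono)
  also have "\<dots> \<le> (M\<^sup>2 * Q) * (norm h)\<^sup>2"
    using w by (simp add: power_mult_distrib mult_right_mono)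
  finally have Q2: "Q * Q \<le> Q * (M * norm h)\<^sup>2"
    by (simp add: power2_eq_square mult_ac)
  have "0 \<le> Q" unfolding Q_def by (intro sum_nonneg) simp
  have "Q \<le> (M * norm h)\<^sup>2"
  proof (cases "Q = 0")
    case False
    then show ?thesis using Q2 \<open>0 \<le> Q\<close> by (simp add: mult_le_cancel_left)
  qed simp
  then have "(norm (\<Sum>n<N. x n h))\<^sup>2 \<le> (M * norm h)\<^sup>2" unfolding x .
  then show ?thesis
    unfolding x_def by (rule power2_le_imp_le) (simp add: M)
qed

text \<open>Otherwise the open sets that the sequence eventually avoids cover \<open>K\<close>, and
  a finite subcover leaves no room for late terms. The weak topology is a value of type
  \<open>topology\<close>, so this version is separate from
  \<open>cluster_point_exists\<close>.\<close>

lemma compactin_cluster_point: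
  fixes u :: "nat \<Rightarrow> 'b"
  assumes K: "compactin W K" and u: "\<And>n. u n \<in> K"
  obtains z where "z \<in> K" "\<forall>U N. openin W U \<longrightarrow> z \<in> U \<longrightarrow> (\<exists>n\<ge>N. u n \<in> U)"
proof -
  have "\<exists>z\<in>K. \<forall>U N. openin W U \<longrightarrow> z \<in> U \<longrightarrow> (\<exists>n\<ge>N. u n \<in> U)"
  proof (rule ccontr)
    assume neg: "\<not> ?thesis"
    define \<U> where "\<U> = {U. openin W U \<and> (\<exists>N. \<forall>n\<ge>N. u n \<notin> U)}"
    have cover: "K \<subseteq> \<Union>\<U>"
    proof
      fix z assume "z \<in> K"
      with neg obtain U N where U: "openin W U" "z \<in> U" "\<not> (\<exists>n\<ge>N. u n \<in> U)" by blast
      then have "U \<in> \<U>" unfolding \<U>_def by (intro CollectI conjI exI[of _ N]) auto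
      with U(2) show "z \<in> \<Union>\<U>" by (rule UnionI[rotated])
    qed
    have "openin W U" if "U \<in> \<U>" for U using that unfolding \<U>_def by simp
    with cover obtain F where F: "finite F" "F \<subseteq> \<U>" "K \<subseteq> \<Union>F"
      using K[unfolded compactin_def, THEN conjunct2, rule_format, of \<U>] by auto
    have "\<exists>N. \<forall>U\<in>F. \<forall>n\<ge>N. u n \<notin> U"
      using F(1,2)
    proof (induction F rule: finite_induct)
      case (insert U F)
      then obtain N1 where N1: "\<forall>U\<in>F. \<forall>n\<ge>N1. u n \<notin> U" by auto
      have "U \<in> \<U>" using insert.prems by simp
      then obtain N2 where N2: "\<forall>n\<ge>N2. u n \<notin> U" unfolding \<U>_def by (elim CollectE conjE exE)
      show ?case
        using N1 N2 by (intro exI[of _ "max N1 N2"]) auto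
    qed simp
    then obtain N where N: "\<forall>U\<in>F. \<forall>n\<ge>N. u n \<notin> U" by (elim exE)
    obtain U where "U \<in> F" "u N \<in> U" using F(3) u[of N] by auto
    then show False using N by simp
  qed
  then obtain z where "z \<in> K" "\<forall>U N. openin W U \<longrightarrow> z \<in> U \<longrightarrow> (\<exists>n\<ge>N. u n \<in> U)"
    by (elim bexE)
  then show ?thesis by (rule that)
qed

lemma cluster_point_closed:
  assumes p: "\<forall>U N. open U \<longrightarrow> p \<in> U \<longrightarrow> (\<exists>n\<ge>N. f n \<in> U)"
    and A: "closed A" "\<And>n. N \<le> n \<Longrightarrow> f n \<in> A"
  shows "p \<in> A"
proof (rule ccontr)
  assume "p \<notin> A"
  then obtain n where "n \<ge> N" "f n \<in> - A"
    using p[rule_format, of "- A" N] A(1) by (auto simp: open_Compl)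
  then show False using A(2) by blast
qed

text \<open>If the values differed, the preimage of the complement of \<open>c\<close> would be a
  subbasic neighbourhood of \<open>z\<close>, to which the sequence would have to return.\<close>

lemma cdual_cluster_point:
  assumes \<psi>: "\<psi> \<in> cdual X add sc nrm" and "z \<in> X" and u: "\<And>n. N \<le> n \<Longrightarrow> \<psi> (u n) = c"
    and z: "\<forall>U N. openin (weak_topology X add sc nrm) U \<longrightarrow> z \<in> U \<longrightarrow> (\<exists>n\<ge>N. u n \<in> U)"
  shows "\<psi> z = c"
proof (rule ccontr)
  assume "\<psi> z \<noteq> c"
  then have "z \<in> {x \<in> X. \<psi> x \<in> - {c}}" using \<open>z \<in> X\<close> by simp
  then obtain n where "n \<ge> N" "u n \<in> {x \<in> X. \<psi> x \<in> - {c}}"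
    using z[rule_format, OF openin_weak_topology_basic[OF \<psi>, of "- {c}"], of N] by auto
  then show False using u by simp
qed

text \<open>Otherwise there are \<open>\<xi> n\<close>, \<open>\<eta> n\<close> such that the rank-\<open>l\<close> operators attached to them have pairwise
  orthogonal ranges and supports. Their partial sums \<open>y N\<close> stay bounded, the vector functionals
  \<open>\<omega> n\<close> of \<open>\<xi> n\<close>, \<open>\<eta> n\<close> vanish on \<open>T (y N)\<close> for \<open>n \<ge> N\<close> and are bounded away from zero for \<open>n < N\<close>.
  So a weak cluster point of \<open>T (y N)\<close> contradicts a weak-star cluster point of \<open>\<omega> n\<close>.\<close>

lemma small_op_if_weakly_compact_map:
  fixes a b :: "nat \<Rightarrow> 'a::chilbert_space \<Rightarrow> 'a"
  assumes a: "\<forall>j<l. bounded_clinear (a j)" and b: "\<forall>j<l. bounded_clinear (b j)"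
    and X: "KH \<subseteq> X" "X \<subseteq> BH"
    and wc: "weakly_compact_map X op_add op_scale onorm (elem_op l a b)"
  shows "small_op (elem_op l a b)"
proof (rule ccontr)
  assume ns: "\<not> small_op (elem_op l a b)"
  have "\<exists>r>0. \<forall>Z. finite Z \<longrightarrow> (\<exists>\<xi> \<eta>. norm \<xi> \<le> 1 \<and> norm \<eta> \<le> 1 \<and>
       (\<forall>z\<in>Z. cinner \<xi> z = 0 \<and> cinner \<eta> z = 0) \<and> r \<le> hsT l a b \<xi> \<eta>)"
  proof (rule ccontr)
    assume neg: "\<not> ?thesis"
    have "small_op (elem_op l a b)"
    proof (rule small_op_if_orthogonal[OF a b])
      fix e :: real assume "0 < e"
      with neg obtain Z where "finite Z" "\<not> (\<exists>\<xi> \<eta>. norm \<xi> \<le> 1 \<and> norm \<eta> \<le> 1 \<and>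
       (\<forall>z\<in>Z. cinner \<xi> z = 0 \<and> cinner \<eta> z = 0) \<and> e \<le> hsT l a b \<xi> \<eta>)" by blast
      then show "\<exists>Z. finite Z \<and> (\<forall>\<xi> \<eta>. norm \<xi> \<le> 1 \<longrightarrow> norm \<eta> \<le> 1 \<longrightarrow>
       (\<forall>z\<in>Z. cinner \<xi> z = 0 \<and> cinner \<eta> z = 0) \<longrightarrow> hsT l a b \<xi> \<eta> < e)"
        unfolding not_le[symmetric] by blast
    qed
    with ns show False by simp
  qed
  then obtain r where r: "0 < r" and orth: "\<And>Z. finite Z \<Longrightarrow> \<exists>\<xi> \<eta>. norm \<xi> \<le> 1 \<and> norm \<eta> \<le> 1 \<and>
       (\<forall>z\<in>Z. cinner \<xi> z = 0 \<and> cinner \<eta> z = 0) \<and> r \<le> hsT l a b \<xi> \<eta>" by blast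
  obtain f :: "nat \<Rightarrow> 'a \<times> 'a" where
    f1: "\<forall>n. norm (fst (f n)) \<le> 1 \<and> norm (snd (f n)) \<le> 1 \<and> r \<le> hsT l a b (fst (f n)) (snd (f n))"
    and f2: "\<forall>n m i j. m < n \<longrightarrow> i < l \<longrightarrow> j < l \<longrightarrow>
       cinner (cadjoint (a i) (fst (f n))) (cadjoint (a j) (fst (f m))) = 0 \<and>
       cinner (b i (snd (f n))) (b j (snd (f m))) = 0"
    using orthogonal_sequence[OF a b orth] by blast
  define \<xi> where "\<xi> n = fst (f n)" for n
  define \<eta> where "\<eta> n = snd (f n)" for n
  define u where "u n i = cadjoint (a i) (\<xi> n)" for n i
  define v where "v n i = b i (\<eta> n)" for n i
  have \<xi>1: "norm (\<xi> n) \<le> 1" and \<eta>1: "norm (\<eta> n) \<le> 1" and hr: "r \<le> hsnorm {..<l} (u n) (v n)" for n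
    using f1 by (simp_all add: \<xi>_def \<eta>_def u_def[abs_def] v_def[abs_def])
  have uo: "cinner (u n i) (u m j) = 0" and vo: "cinner (v n i) (v m j) = 0"
    if "n \<noteq> m" "i < l" "j < l" for n m i j
  proof -
    consider "m < n" | "n < m" using \<open>n \<noteq> m\<close> by linarith
    then have "cinner (u n i) (u m j) = 0 \<and> cinner (v n i) (v m j) = 0"
    proof cases
      case 1
      then show ?thesis using f2 that by (simp add: u_def v_def \<xi>_def \<eta>_def)
    next
      case 2
      then have "cinner (u m j) (u n i) = 0 \<and> cinner (v m j) (v n i) = 0"
        using f2 that by (simp add: u_def v_def \<xi>_def \<eta>_def)
      then show ?thesis
        using cinner_commute[of "u n i" "u m j"] cinner_commute[of "v n i" "v m j"] by simp
    qed
    then show "cinner (u n i) (u m j) = 0" "cinner (v n i) (v m j) = 0" by auto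
  qed
  \<comment> \<open>The constant serves twice: it bounds the operator on \<open>HS_ball\<close>, and
    hence by duality the norm of every tensor in the sequence.\<close>
  obtain M where M: "0 < M" "\<forall>x\<in>HS_ball. \<forall>h. norm (elem_op l a b x h) \<le> M * norm h"
    by (rule elem_op_HS_ball_bound[OF a b])
  have hM: "hsnorm {..<l} (u n) (v n) \<le> M" for n
    unfolding u_def v_def
  proof (rule hsT_le_if_HS_ball[OF a])
    fix x :: "'a \<Rightarrow> 'a" assume x: "x \<in> HS_ball"
    have "cmod (cinner (elem_op l a b x (\<eta> n)) (\<xi> n)) \<le> norm (elem_op l a b x (\<eta> n)) * norm (\<xi> n)"
      by (rule cinner_Cauchy_Schwarz)
    also have "\<dots> \<le> (M * norm (\<eta> n)) * norm (\<xi> n)"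
      using M(2) x by (intro mult_right_mono) auto
    also have "\<dots> \<le> (M * 1) * 1"
      using M(1) \<xi>1 \<eta>1 by (intro mult_mono mult_left_mono) auto
    finally show "cmod (cinner (elem_op l a b x (\<eta> n)) (\<xi> n)) \<le> M" by simp
  qed (use M(1) in simp)
  \<comment> \<open>Dividing by \<open>M\<close> puts every partial sum into the unit ball of
    operators, by orthogonality of ranges and supports.\<close>
  define y where "y N = (\<lambda>h. scaleC (complex_of_real (1 / M)) (\<Sum>n<N. tensor_op {..<l} (u n) (v n) h))" for N
  have yK: "compact_op (y N)" for N
    unfolding y_def by (rule compact_op_scaleC[OF compact_op_sum[OF compact_op_tensor_op]])
  have yn: "onorm (y N) \<le> 1" for N
  proof (rule onorm_bound)
    fix h
    have "norm (\<Sum>n<N. tensor_op {..<l} (u n) (v n) h) \<le> M * norm h"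
      by (rule norm_orthogonal_tensor_sum_le[OF uo vo hM]) (use M(1) in auto)
    then show "norm (y N h) \<le> 1 * norm h"
      using M(1) by (simp add: y_def norm_scaleC norm_divide divide_le_eq mult.commute)
  qed simp
  define T where "T = elem_op l a b"
  \<comment> \<open>Orthogonality leaves only the summand with index \<open>n\<close>, and the
    pairing of a tensor with itself is its squared norm.\<close>
  have val: "cinner (T (y N) (\<eta> n)) (\<xi> n)
      = (if n < N then complex_of_real ((hsnorm {..<l} (u n) (v n))\<^sup>2 / M) else 0)" for N n
  proof -
    have "cinner (T (y N) (\<eta> n)) (\<xi> n) = (\<Sum>j<l. cinner (y N (v n j)) (u n j))"
      unfolding T_def cinner_elem_op[OF a] u_def v_def ..
    also have "\<dots> = complex_of_real (1 / M) * (\<Sum>j<l. \<Sum>k<N. cinner (tensor_op {..<l} (u k) (v k) (v n j)) (u n j))"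
      unfolding y_def cinner_scaleC_left cinner_sum_left by (simp only: sum_distrib_left)
    also have "(\<Sum>j<l. \<Sum>k<N. cinner (tensor_op {..<l} (u k) (v k) (v n j)) (u n j))
       = (\<Sum>k<N. \<Sum>j<l. cinner (tensor_op {..<l} (u k) (v k) (v n j)) (u n j))"
      by (rule sum.swap)
    also have "\<dots> = (\<Sum>k<N. hsip {..<l} (u k) (v k) {..<l} (u n) (v n))"
      by (simp only: sum_cinner_tensor_op)
    also have "\<dots> = (\<Sum>k<N. if k = n then complex_of_real ((hsnorm {..<l} (u n) (v n))\<^sup>2) else 0)"
    proof (rule sum.cong[OF refl])
      fix k
      show "hsip {..<l} (u k) (v k) {..<l} (u n) (v n)
         = (if k = n then complex_of_real ((hsnorm {..<l} (u n) (v n))\<^sup>2) else 0)"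
      proof (cases "k = n")
        case True
        then show ?thesis by (simp add: hsip_self)
      next
        case False
        then show ?thesis by (simp add: hsip_def uo)
      qed
    qed
    finally show ?thesis by (simp add: sum.delta)
  qed
  have bdT: "bounded_clinear (T (y N))" for N
    unfolding T_def by (rule bounded_clinear_elem_op[OF a b compact_op_bounded_clinear[OF yK]])
  define W where "W = weak_topology X op_add op_scale onorm"
  obtain K where K: "K \<subseteq> X" "compactin W K" "T ` {x \<in> X. onorm x \<le> 1} \<subseteq> K"
    using wc unfolding weakly_compact_map_def W_def T_def by blast
  have uK: "T (y N) \<in> K" for N
    using K(3) yK[of N] yn[of N] X(1) by blast
  obtain z where zK: "z \<in> K" and z: "\<forall>U N. openin W U \<longrightarrow> z \<in> U \<longrightarrow> (\<exists>n\<ge>N. T (y n) \<in> U)"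
    by (rule compactin_cluster_point[where u = "\<lambda>n. T (y n)", OF K(2) uK])
  have zX: "z \<in> X" and bz: "bounded_clinear z" using zK K(1) X(2) by auto
  \<comment> \<open>With the value 0 off the bounded operators, \<open>\<omega> n\<close> is a
    pointwise bounded function on all maps, as Tychonoff requires.\<close>
  define \<omega> where "\<omega> n x = (if bounded_clinear x then cinner (x (\<eta> n)) (\<xi> n) else 0)" for n x
  have \<omega>b: "cmod (\<omega> n x) \<le> onorm x" if x: "bounded_clinear x" for n x
  proof -
    have "cmod (\<omega> n x) \<le> norm (x (\<eta> n)) * norm (\<xi> n)"
      using x by (simp add: \<omega>_def cinner_Cauchy_Schwarz)
    also have "\<dots> \<le> (onorm x * norm (\<eta> n)) * norm (\<xi> n)"
      by (intro mult_right_mono norm_le_onorm[OF x]) simp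
    also have "\<dots> \<le> (onorm x * 1) * 1"
      using onorm_nonneg[OF x] \<xi>1 \<eta>1 by (intro mult_mono mult_left_mono) auto
    finally show ?thesis by simp
  qed
  have \<omega>add: "\<omega> n (op_add x x') = \<omega> n x + \<omega> n x'" if "bounded_clinear x" "bounded_clinear x'" for n x x'
    using that bounded_clinear_plus[OF that] by (simp add: \<omega>_def op_add_def cinner_add_left)
  have \<omega>sc: "\<omega> n (op_scale c x) = c * \<omega> n x" if "bounded_clinear x" for n c x
    using that bounded_clinear_scale[OF that] by (simp add: \<omega>_def op_scale_def cinner_scaleC_left)
  have dual: "\<psi> \<in> cdual X op_add op_scale onorm"
    if "\<And>x x'. bounded_clinear x \<Longrightarrow> bounded_clinear x' \<Longrightarrow> \<psi> (op_add x x') = \<psi> x + \<psi> x'"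
      "\<And>c x. bounded_clinear x \<Longrightarrow> \<psi> (op_scale c x) = c * \<psi> x"
      "\<And>x. bounded_clinear x \<Longrightarrow> cmod (\<psi> x) \<le> onorm x" for \<psi>
  proof -
    have "bounded_clinear x" if "x \<in> X" for x using that X(2) by blast
    with that show ?thesis
      unfolding cdual_def by (intro CollectI conjI ballI allI exI[of _ 1]) simp_all
  qed
  \<comment> \<open>For fixed \<open>n\<close> the values at \<open>T (y m)\<close> are constant
    from \<open>m = Suc n\<close> on, since \<open>y m\<close> contains the summands with index
    below \<open>m\<close>.\<close>
  have \<omega>z: "\<omega> n z = complex_of_real ((hsnorm {..<l} (u n) (v n))\<^sup>2 / M)" for n
  proof (rule cdual_cluster_point[OF dual zX, where u = "\<lambda>n. T (y n)" and N = "Suc n"])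
    show "\<omega> n (T (y m)) = complex_of_real ((hsnorm {..<l} (u n) (v n))\<^sup>2 / M)" if "Suc n \<le> m" for m
      using that bdT val[of m n] by (simp add: \<omega>_def)
  qed (use \<omega>add \<omega>sc \<omega>b z in \<open>simp_all add: W_def\<close>)
  define S where "S = {g :: ('a \<Rightarrow> 'a) \<Rightarrow> complex. \<forall>x. cmod (g x) \<le> (if bounded_clinear x then onorm x else 0)}"
  have "compact S" unfolding S_def by (rule compact_Pi_cball)
  moreover have "\<omega> n \<in> S" for n
    unfolding S_def using \<omega>b by (auto simp: \<omega>_def)
  ultimately obtain \<phi> where \<phi>S: "\<phi> \<in> S" and \<phi>: "\<forall>U N. open U \<longrightarrow> \<phi> \<in> U \<longrightarrow> (\<exists>n\<ge>N. \<omega> n \<in> U)"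
    by (rule cluster_point_exists[where f = \<omega>])
  note cc = continuous_on_coord continuous_on_add continuous_on_mult continuous_on_const
  have "\<phi> \<in> cdual X op_add op_scale onorm"
  proof (rule dual)
    fix x x' :: "'a \<Rightarrow> 'a" assume x: "bounded_clinear x" "bounded_clinear x'"
    have "\<phi> \<in> {g. g (op_add x x') = g x + g x'}"
      by (rule cluster_point_closed[OF \<phi>, where N = 0])
         (auto intro!: closed_Collect_eq cc simp: \<omega>add[OF x])
    then show "\<phi> (op_add x x') = \<phi> x + \<phi> x'" by simp
  next
    fix c and x :: "'a \<Rightarrow> 'a" assume x: "bounded_clinear x"
    have "\<phi> \<in> {g. g (op_scale c x) = c * g x}"
      by (rule cluster_point_closed[OF \<phi>, where N = 0])
         (auto intro!: closed_Collect_eq cc simp: \<omega>sc[OF x])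
    then show "\<phi> (op_scale c x) = c * \<phi> x" by simp
  next
    fix x :: "'a \<Rightarrow> 'a" assume x: "bounded_clinear x"
    have "cmod (\<phi> x) \<le> (if bounded_clinear x then onorm x else 0)" using \<phi>S unfolding S_def by blast
    then show "cmod (\<phi> x) \<le> onorm x" using x by simp
  qed
  \<comment> \<open>For fixed \<open>N\<close>, \<open>\<omega> n\<close> vanishes at
    \<open>T (y N)\<close> once \<open>n \<ge> N\<close>, so the cluster point \<open>\<phi>\<close>
    vanishes on the whole sequence and therefore at \<open>z\<close>.\<close>
  moreover have "\<phi> (T (y N)) = 0" for N
  proof -
    have "\<phi> \<in> {g. g (T (y N)) = 0}"
      by (rule cluster_point_closed[OF \<phi>, where N = N])
         (auto intro!: closed_Collect_eq cc simp: \<omega>_def val)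
    then show ?thesis by simp
  qed
  ultimately have "\<phi> z = 0"
    using cdual_cluster_point[of \<phi> X op_add op_scale onorm z 0 "\<lambda>n. T (y n)" 0] zX z
    unfolding W_def by blast
  \<comment> \<open>In the opposite order of limits, every \<open>\<omega> n z\<close> is at least
    \<open>r\<^sup>2 / M\<close>, a closed condition that passes to \<open>\<phi>\<close>.\<close>
  moreover have "r\<^sup>2 / M \<le> Re (\<phi> z)"
  proof -
    have "r\<^sup>2 / M \<le> Re (\<omega> n z)" for n
    proof -
      have "r\<^sup>2 \<le> (hsnorm {..<l} (u n) (v n))\<^sup>2" using hr r by (intro power_mono) auto
      then show ?thesis using M(1) unfolding \<omega>z Re_complex_of_real by (intro divide_right_mono) auto
    qed
    then have "\<phi> \<in> {g. r\<^sup>2 / M \<le> Re (g z)}"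
      by (intro cluster_point_closed[OF \<phi>, where N = 0] closed_Collect_le continuous_on_const
          continuous_on_Re continuous_on_coord) auto
    then show ?thesis by simp
  qed
  ultimately show False using r M(1) by (simp add: zero_less_divide_iff field_simps)
qed

theorem theorem3p3:
  fixes l :: nat and a b :: "nat \<Rightarrow> 'h::chilbert_space \<Rightarrow> 'h"
  assumes a_bd: "\<forall>j<l. bounded_clinear (a j)"
    and b_bd: "\<forall>j<l. bounded_clinear (b j)"
  defines "T \<equiv> elem_op l a b"
  shows "(weakly_compact_map BH op_add op_scale onorm T
            \<longleftrightarrow> weakly_compact_map KH op_add op_scale onorm T)
       \<and> (weakly_compact_map BH op_add op_scale onorm T
            \<longleftrightarrow> limitin euclidean (fT l a b) (fT l a b (0, 0))
                  (atin (prod_topology weak_ball_topology weak_ball_topology) (0, 0)))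
       \<and> (weakly_compact_map BH op_add op_scale onorm T
            \<longleftrightarrow> limitin euclidean (\<lambda>\<xi>. fT l a b (\<xi>, \<xi>)) (fT l a b (0, 0))
                  (atin weak_ball_topology 0))
       \<and> (weakly_compact_map BH op_add op_scale onorm T
            \<longleftrightarrow> (\<exists>c d m. m \<le> l \<and> (\<forall>j<l. compact_op (c j)) \<and> (\<forall>j<l. bounded_clinear (d j)) \<and>
                   (\<forall>x. bounded_clinear x \<longrightarrow>
                      T x = (\<lambda>h. (\<Sum>j<m. c j (x (d j h))) + (\<Sum>j\<in>{m..<l}. d j (x (c j h)))))))"
proof -
  have sub: "KH \<subseteq> (BH :: ('h \<Rightarrow> 'h) set)"
    by (auto intro: compact_op_bounded_clinear)
  have rep: "compact_rep l T \<longleftrightarrow> small_op T"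
    unfolding T_def using compact_rep_if_small_op[OF a_bd b_bd] small_op_if_compact_rep by blast
  \<comment> \<open>One equivalence for all \<open>X\<close> between \<open>KH\<close> and
    \<open>BH\<close>; (i) and (ii) are its two extreme cases.\<close>
  have wc: "weakly_compact_map X op_add op_scale onorm T \<longleftrightarrow> small_op T"
    if X: "KH \<subseteq> X" "X \<subseteq> BH" for X
  proof
    assume "weakly_compact_map X op_add op_scale onorm T"
    then show "small_op T"
      unfolding T_def by (rule small_op_if_weakly_compact_map[OF a_bd b_bd X])
  next
    assume "small_op T"
    then have "compact_rep l T" using rep by blast
    then show "weakly_compact_map X op_add op_scale onorm T"
      by (rule weakly_compact_map_if_compact_rep[OF _ X])
  qed
  show ?thesis
    unfolding wc[OF sub order_refl] wc[OF order_refl sub]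
      continuity_iff_small_op[OF a_bd b_bd] T_def[symmetric] compact_rep_def[symmetric] rep
    by simp
qed

end
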